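(* Let $q\in\mathbb N$, $d\in(0,1/2)$, and let $w:\mathbb T\to\mathbb C^{q\times q}$ be of the form $w(e^{i\theta})=|1-e^{i\theta}|^{-2d}g(e^{i\theta})g(e^{i\theta})^*$, where the entries of $g(z)$ are rational functions of $z$ with no poles in the closed unit disk and $\det g(z)$ has no zeros in the closed unit disk. Put $\tilde w(e^{i\theta}):=w(e^{-i\theta})$. For $\delta\in(0,1/2]$ and $n\in\mathbb N$, let $H_\delta(n)=\{1,\dots,[\delta n]\}$, $T_\delta(n)=\{n-[\delta n]+1,\dots,n\}$, and define $\Omega_{n,\delta}(w)\in\mathbb C^{nq\times nq}$ blockwise by $$(\Omega_{n,\delta}(w))^{s,t}=\begin{cases}(T_\infty(w)^{-1})^{s,t}, & (s,t)\in H_\delta(n)\times H_\delta(n),\\ (T_\infty(\tilde w)^{-1})^{n+1-s,n+1-t}, & (s,t)\in T_\delta(n)\times T_\delta(n),\\ \tfrac12\left\{(T_\infty(w)^{-1})^{s,t}+(T_\infty(\tilde w)^{-1})^{n+1-s,n+1-t}\right\}, & \text{otherwise},\end{cases}$$ for $s,t\in\{1,\dots,n\}$. Then: (i) $\Omega_{n,\delta}(w)$ is a Hermitian matrix for every $n\in\mathbb N$. (ii) For $p\in\{1,\infty\}$, $\|T_n(w)^{-1}-\Omega_{n,\delta}(w)\|_{p,\mathrm{block}}^{q\times q}=O(n^{-d})$ as $n\to\infty$.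
   Context: $\mathbb N=\{1,2,\dots\}$; $\mathbb T$ is the unit circle and $\mathbb D$ the open unit disk in $\mathbb C$; $\|a\|$ is the spectral norm and $a^*$ the Hermitian conjugate of a matrix $a$; $[x]$ is the floor of $x\in\mathbb R$. For a finite or semi-infinite block matrix $A$, $A^{s,t}\in\mathbb C^{q\times q}$ denotes its $(s,t)$ block. For $A_n\in\mathbb C^{qn\times qn}$ with $q\times q$ blocks $(A_n)^{s,t}$: $\|A_n\|_{1,\mathrm{block}}^{q\times q}=\sup_{1\le t\le n}\sum_{s=1}^n\|(A_n)^{s,t}\|$ and $\|A_n\|_{\infty,\mathrm{block}}^{q\times q}=\sup_{1\le s\le n}\sum_{t=1}^n\|(A_n)^{s,t}\|$. Put $\gamma(k)=\int_{-\pi}^{\pi}e^{-ik\theta}w(e^{i\theta})\frac{d\theta}{2\pi}$ for $k\in\mathbb Z$, $T_n(w)=(\gamma(s-t))_{1\le s,t\le n}\in\mathbb C^{qn\times qn}$ (which is invertible) and $T_\infty(w)=(\gamma(s-t))_{s,t\ge1}$; $T_\infty(\tilde w)$ is defined in the same way from $\tilde w$. The inverses $T_\infty(w)^{-1}$ and $T_\infty(\tilde w)^{-1}$ are the following semi-infinite block matrices. There is a rational $g_\sharp:\mathbb T\to\mathbb C^{q\times q}$ with the same two properties as $g$ (entries rational without poles in the closed unit disk, determinant without zeros there) such that $g(e^{i\theta})g(e^{i\theta})^*=g_\sharp(e^{i\theta})^*g_\sharp(e^{i\theta})$ for all $\theta$; fix one. Put $h(z)=(1-z)^{-d}g(z)$,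 $h_\sharp(z)=(1-z)^{-d}g_\sharp(z)$ (principal branch), $\tilde h(z)=\{h_\sharp(\overline z)\}^*$, and define $\{a_k\}_{k\ge0},\{\tilde a_k\}_{k\ge0}\subset\mathbb C^{q\times q}$ by $-h(z)^{-1}=\sum_{k=0}^\infty z^ka_k$ and $-\tilde h(z)^{-1}=\sum_{k=0}^\infty z^k\tilde a_k$ for $z\in\mathbb D$. Then, for $s,t\in\mathbb N$, $$(T_\infty(w)^{-1})^{s,t}=\sum_{\ell=1}^{\min(s,t)}\tilde a_{s-\ell}^*\tilde a_{t-\ell},\qquad (T_\infty(\tilde w)^{-1})^{s,t}=\sum_{\ell=1}^{\min(s,t)}a_{s-\ell}^*a_{t-\ell}.$$ *)

theory Defs
  imports
    "HOL-Analysis.Analysis"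
    "HOL-Computational_Algebra.Polynomial"
    "HOL-Library.Landau_Symbols"
begin

section \<open>Matrices of size \<open>q \<times> q\<close>\<close>

definition mscale :: "complex \<Rightarrow> complex^'q^'q \<Rightarrow> complex^'q^'q" where
  "mscale c A = map_matrix (\<lambda>x. c * x) A"

definition hconj :: "complex^'q^'q \<Rightarrow> complex^'q^'q" where
  "hconj A = map_matrix cnj (transpose A)"

definition spectral_norm :: "complex^'q^'q \<Rightarrow> real" where
  "spectral_norm A = onorm (\<lambda>v. A *v v)"

text \<open>A function into the matrices whose entries are rational without poles in the closed
  unit disk and whose determinant has no zeros there. Only the values on the closed disk
  matter; a fraction \<open>p / r\<close> in lowest terms has no poles there iff \<open>r\<close> has no zeros there.\<close>

definition regular_rational :: "(complex \<Rightarrow> complex^'q^'q) \<Rightarrow> bool" where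
  "regular_rational g \<longleftrightarrow>
     (\<forall>i j. \<exists>p r :: complex poly. \<forall>z\<in>cball 0 1.
        poly r z \<noteq> 0 \<and> g z $ i $ j = poly p z / poly r z) \<and>
     (\<forall>z\<in>cball 0 1. det (g z) \<noteq> 0)"

section \<open>Block matrices\<close>

text \<open>A block matrix is a function of the (1-based) block indices. An \<open>n \<times> n\<close> block matrix,
  that is, a \<open>qn \<times> qn\<close> matrix, is such a function of which only the blocks with both indices
  in \<open>{1..n}\<close> are considered.\<close>

type_synonym 'q block_matrix = "nat \<Rightarrow> nat \<Rightarrow> complex^'q^'q"

definition block_mult :: "nat \<Rightarrow> 'q::finite block_matrix \<Rightarrow> 'q block_matrix \<Rightarrow> 'q block_matrix" where
  "block_mult n A B = (\<lambda>s t. \<Sum>l=1..n. A s l ** B l t)"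

definition is_block_id :: "nat \<Rightarrow> 'q::finite block_matrix \<Rightarrow> bool" where
  "is_block_id n A \<longleftrightarrow> (\<forall>s\<in>{1..n}. \<forall>t\<in>{1..n}. A s t = (if s = t then mat 1 else 0))"

text \<open>As for \<^const>\<open>matrix_inv\<close>, the value is meaningful when an inverse exists; its blocks
  with indices in \<open>{1..n}\<close> are then uniquely determined.\<close>

definition block_inv :: "nat \<Rightarrow> 'q::finite block_matrix \<Rightarrow> 'q block_matrix" where
  "block_inv n A =
     (SOME B. is_block_id n (block_mult n A B) \<and> is_block_id n (block_mult n B A))"

definition block_hermitian :: "nat \<Rightarrow> 'q::finite block_matrix \<Rightarrow> bool" where
  "block_hermitian n A \<longleftrightarrow>
     (\<forall>s\<in>{1..n}. \<forall>t\<in>{1..n}. \<forall>i j. A s t $ i $ j = cnj (A t s $ j $ i))"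

definition block_norm_1 :: "nat \<Rightarrow> 'q::finite block_matrix \<Rightarrow> real" where
  "block_norm_1 n A = (SUP t\<in>{1..n}. \<Sum>s=1..n. spectral_norm (A s t))"

definition block_norm_inf :: "nat \<Rightarrow> 'q::finite block_matrix \<Rightarrow> real" where
  "block_norm_inf n A = (SUP s\<in>{1..n}. \<Sum>t=1..n. spectral_norm (A s t))"

section \<open>Toeplitz matrices\<close>

definition fourier_coeff :: "(complex \<Rightarrow> complex^'q^'q) \<Rightarrow> int \<Rightarrow> complex^'q::finite^'q" where
  "fourier_coeff w k =
     (1 / (2 * pi)) *\<^sub>R
       (LINT \<theta>:{-pi..pi}|lborel. mscale (cis (- of_int k * \<theta>)) (w (cis \<theta>)))"

text \<open>The same function of the block indices represents \<open>T_n(w)\<close> for every \<open>n\<close>.\<close>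

definition toeplitz :: "(complex \<Rightarrow> complex^'q^'q) \<Rightarrow> 'q::finite block_matrix" where
  "toeplitz w s t = fourier_coeff w (int s - int t)"

section \<open>Inverses of the semi-infinite Toeplitz matrices\<close>

definition h_fun :: "real \<Rightarrow> (complex \<Rightarrow> complex^'q^'q) \<Rightarrow> complex \<Rightarrow> complex^'q::finite^'q" where
  "h_fun d g z = mscale ((1 - z) powr complex_of_real (- d)) (g z)"

definition h_tilde :: "real \<Rightarrow> (complex \<Rightarrow> complex^'q^'q) \<Rightarrow> complex \<Rightarrow> complex^'q::finite^'q" where
  "h_tilde d gs z = hconj (h_fun d gs (cnj z))"

definition neg_inv_coeffs :: "(complex \<Rightarrow> complex^'q^'q) \<Rightarrow> nat \<Rightarrow> complex^'q::finite^'q" where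
  "neg_inv_coeffs h =
     (THE c. \<forall>z\<in>ball 0 1. (\<lambda>k. mscale (z ^ k) (c k)) sums (- matrix_inv (h z)))"

definition coeff_gram :: "(nat \<Rightarrow> complex^'q^'q) \<Rightarrow> 'q::finite block_matrix" where
  "coeff_gram c s t = (\<Sum>l=1..min s t. hconj (c (s - l)) ** c (t - l))"

text \<open>Let \<open>w(z) = |1 - z| powr (-2d) g(z) g(z)\<^sup>*\<close> on the unit circle, with
  \<open>g(z) g(z)\<^sup>* = gs(z)\<^sup>* gs(z)\<close> there, and \<open>w'(z) = w(cnj z)\<close>. Then \<open>Tinf_inv d gs\<close> is the inverse of
  the semi-infinite Toeplitz matrix of \<open>w\<close> and \<open>Tinf_tilde_inv d g\<close> is that of \<open>w'\<close>: both are
  given by the explicit formula for these inverses. The first one involves the factor \<open>gs\<close>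
  (via \<open>h_tilde\<close>), the second one the factor \<open>g\<close>.\<close>

definition Tinf_inv :: "real \<Rightarrow> (complex \<Rightarrow> complex^'q^'q) \<Rightarrow> 'q::finite block_matrix" where
  "Tinf_inv d gs = coeff_gram (neg_inv_coeffs (h_tilde d gs))"

definition Tinf_tilde_inv :: "real \<Rightarrow> (complex \<Rightarrow> complex^'q^'q) \<Rightarrow> 'q::finite block_matrix" where
  "Tinf_tilde_inv d g = coeff_gram (neg_inv_coeffs (h_fun d g))"

section \<open>The approximating matrix\<close>

definition head_idx :: "real \<Rightarrow> nat \<Rightarrow> nat set" where
  "head_idx \<delta> n = {1..nat \<lfloor>\<delta> * real n\<rfloor>}"

definition tail_idx :: "real \<Rightarrow> nat \<Rightarrow> nat set" where
  "tail_idx \<delta> n = {n - nat \<lfloor>\<delta> * real n\<rfloor> + 1..n}"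

definition Omega ::
  "real \<Rightarrow> real \<Rightarrow> (complex \<Rightarrow> complex^'q^'q) \<Rightarrow> (complex \<Rightarrow> complex^'q^'q) \<Rightarrow> nat
    \<Rightarrow> 'q::finite block_matrix" where
  "Omega \<delta> d g gs n = (\<lambda>s t.
     if s \<in> head_idx \<delta> n \<and> t \<in> head_idx \<delta> n then Tinf_inv d gs s t
     else if s \<in> tail_idx \<delta> n \<and> t \<in> tail_idx \<delta> n
       then Tinf_tilde_inv d g (n + 1 - s) (n + 1 - t)
     else (1 / 2) *\<^sub>R (Tinf_inv d gs s t + Tinf_tilde_inv d g (n + 1 - s) (n + 1 - t)))"

end

theory Submission
  imports Defs "HOL-Complex_Analysis.Complex_Analysis"
begin

text \<open>A solution \<open>x\<close> of the finite system, extended by zero, satisfies \<open>\<gamma> \<star> x = y\<close> on \<open>{1..n}\<close> with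
  unknown remainders to the left of \<open>1\<close> and to the right of \<open>n\<close>. Dividing by one factor of \<open>\<gamma>\<close> at
  each end expresses \<open>x\<close> as the column of the semi-infinite inverse plus two correction terms, built
  from sequences \<open>\<phi>\<close> on \<open>{n<..}\<close> and \<open>\<psi>\<close> on \<open>{..0}\<close> that solve a coupled system whose kernel consists
  of the Fourier coefficients \<open>\<beta>\<close> of the phase function. Asymptotically
  \<open>\<parallel>\<beta> j\<parallel> \<le> sin (\<pi> d) / (\<pi> j)\<close>, so in the sup norm with weight \<open>sqrt (l - n / 2)\<close> the system is
  dominated by \<open>sin (\<pi> d) / \<pi>\<close> times the Hilbert kernel, whose norm there is at most \<open>\<pi>\<close>: it is a
  contraction because \<open>sin (\<pi> d) < 1\<close>. For a column at distance at least \<open>\<delta> n\<close> from the right end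
  this yields a correction of block \<open>l\<^sup>1\<close> norm \<open>O(n powr (- d))\<close>; reversing the order of the
  indices gives the other columns, and both approximations agree up to that order in the middle.\<close>

section \<open>Convolution of bi-infinite sequences\<close>

text \<open>The symbol is singular at \<open>1\<close>: its coefficients are of order
  \<open>k powr (2 * d - 1)\<close> and not summable, while those of the inverse factors
  \<open>- 1 / h\<close> are. So no single algebra of summable sequences contains all factors, and
  each regrouping of a product needs absolute convergence of a triple sum, sometimes available only
  because supports are separated. The contraction constant must be sharp. The scalar phase
  \<open>(1 - z)^d (1 - 1/z)^(-d)\<close> has the exact coefficients
  \<open>sin (pi d) / (pi (d - j))\<close>; the remaining matrix factor is smooth and unitary at
  \<open>1\<close>. Only a norm with value 1 on unitaries preserves the constant, whence the
  abstract C*-algebra, realised by matrices with the spectral norm. The shift by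
  \<open>n / 2\<close> writes the distance \<open>l - p\<close> of the two supports as
  \<open>(l - n/2) + (n/2 - p)\<close>, the argument of the Hilbert kernel, so the contraction holds
  for each large \<open>n\<close> and not just in a limit. The rate is
  \<open>n powr (- 1) * n powr (1 - d)\<close>: the auxiliary sequences are \<open>O(1 / n)\<close>,
  and the tails of \<open>a\<close> and \<open>b\<close>, summed over the rows, give
  \<open>n powr (1 - d)\<close>.\<close>

class cstar_algebra = banach + real_normed_algebra_1 +
  fixes adj :: "'a \<Rightarrow> 'a"
  assumes adj_add: "adj (x + y) = adj x + adj y"
    and adj_scaleR: "adj (r *\<^sub>R x) = r *\<^sub>R adj x"
    and adj_mult: "adj (x * y) = adj y * adj x"
    and adj_adj [simp]: "adj (adj x) = x"
    and cstar_identity: "norm (adj x * x) = (norm x)\<^sup>2"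

lemma norm_adj [simp]: "norm (adj x) = norm x"
proof -
  have *: "norm y \<le> norm (adj y)" for y :: 'a
  proof (cases "y = 0")
    case False
    have "norm y * norm y \<le> norm (adj y) * norm y"
      using cstar_identity[of y] norm_mult_ineq[of "adj y" y] by (simp add: power2_eq_square)
    with False show ?thesis by simp
  qed simp
  show ?thesis using *[of x] *[of "adj x"] by simp
qed

lemma bounded_linear_adj: "bounded_linear adj"
  by (rule bounded_linear_intro[where K = 1]) (simp_all add: adj_add adj_scaleR)

lemma adj_0 [simp]: "adj 0 = 0"
  using linear_0[OF bounded_linear.linear[OF bounded_linear_adj]] .

lemma adj_minus [simp]: "adj (- x) = - adj x"
  using linear_neg[OF bounded_linear.linear[OF bounded_linear_adj]] .

lemma adj_1 [simp]: "adj 1 = 1"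
  by (metis adj_adj adj_mult mult.left_neutral mult.right_neutral)

lemma adj_of_real [simp]: "adj (of_real r) = of_real r"
  by (simp add: of_real_def adj_scaleR)

lemma adj_sum: "adj (sum f A) = (\<Sum>x\<in>A. adj (f x))"
  using linear_sum[OF bounded_linear.linear[OF bounded_linear_adj]] .

text \<open>Applied to the value at \<open>1\<close> of the smooth factor of the phase function; it
  keeps the contraction constant at \<open>sin (pi * d)\<close>.\<close>

lemma norm_le_1_if_coisometry:
  assumes "x * adj x = 1"
  shows "norm x \<le> 1"
proof -
  have "(norm (adj x))\<^sup>2 = 1" using cstar_identity[of "adj x"] assms by simp
  then have "norm x = 1 \<or> norm x = - 1" by (simp add: power2_eq_1_iff)
  then show ?thesis by auto
qed

text \<open>Coefficients of a product of generating series. \<open>infsum\<close> is unconditional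
  summation with value \<open>0\<close> where it diverges, so algebraic laws carry explicit
  hypotheses of absolute convergence.\<close>

definition conv :: "(int \<Rightarrow> 'a::real_normed_algebra) \<Rightarrow> (int \<Rightarrow> 'a) \<Rightarrow> int \<Rightarrow> 'a"
    (infixl \<open>\<star>\<close> 70) where
  "(f \<star> g) i = (\<Sum>\<^sub>\<infinity>j. f j * g (i - j))"

text \<open>On the unit circle, the pointwise adjoint of the generating series.\<close>

definition star :: "(int \<Rightarrow> 'a::cstar_algebra) \<Rightarrow> int \<Rightarrow> 'a" where
  "star f k = adj (f (- k))"

definition delta :: "int \<Rightarrow> 'a::zero \<Rightarrow> int \<Rightarrow> 'a" where
  "delta t x k = (if k = t then x else 0)"

definition l1 :: "(int \<Rightarrow> 'a::real_normed_vector) \<Rightarrow> bool" where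
  "l1 f \<longleftrightarrow> (\<lambda>k. norm (f k)) summable_on UNIV"

definition bdd :: "(int \<Rightarrow> 'a::real_normed_vector) \<Rightarrow> bool" where
  "bdd f \<longleftrightarrow> (\<exists>C. \<forall>k. norm (f k) \<le> C)"

definition conv_abs :: "(int \<Rightarrow> 'a::real_normed_vector) \<Rightarrow> (int \<Rightarrow> 'a) \<Rightarrow> int \<Rightarrow> bool" where
  "conv_abs f g i \<longleftrightarrow> (\<lambda>j. norm (f j) * norm (g (i - j))) summable_on UNIV"

text \<open>The bound is uniform in \<open>i\<close> so that one more convolution with an
  \<open>l1\<close> sequence converges absolutely.\<close>

definition conv_bdd :: "(int \<Rightarrow> 'a::real_normed_vector) \<Rightarrow> (int \<Rightarrow> 'a) \<Rightarrow> bool" where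
  "conv_bdd f g \<longleftrightarrow> (\<forall>i. conv_abs f g i) \<and>
     (\<exists>C. \<forall>i. (\<Sum>\<^sub>\<infinity>j. norm (f j) * norm (g (i - j))) \<le> C)"

text \<open>The hypothesis of associativity. It concerns a single index \<open>i\<close>, since it
  may be provable only for \<open>i\<close> on one side of the supports.\<close>

definition conv3_abs ::
    "(int \<Rightarrow> 'a::real_normed_vector) \<Rightarrow> (int \<Rightarrow> 'a) \<Rightarrow> (int \<Rightarrow> 'a) \<Rightarrow> int \<Rightarrow> bool" where
  "conv3_abs f g h i \<longleftrightarrow> (\<lambda>(j, k). norm (f j) * norm (g k) * norm (h (i - j - k))) summable_on UNIV"

lemma bddE:
  assumes "bdd f"
  obtains C where "C > 0" "\<And>k. norm (f k) \<le> C"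
proof -
  obtain C where C: "\<And>k. norm (f k) \<le> C" using assms by (auto simp: bdd_def)
  show ?thesis by (rule that[of "max C 1"]) (auto simp: le_max_iff_disj C)
qed

lemma conv_absI:
  fixes f g :: "int \<Rightarrow> 'a::real_normed_algebra"
  assumes "conv_abs f g i"
  shows "(\<lambda>j. norm (f j * g (i - j))) summable_on UNIV"
  by (rule summable_on_comparison_test[OF assms[unfolded conv_abs_def]]) (auto simp: norm_mult_ineq)

lemma conv_abs_summable:
  fixes f g :: "int \<Rightarrow> 'a::{real_normed_algebra, banach}"
  assumes "conv_abs f g i"
  shows "(\<lambda>j. f j * g (i - j)) summable_on UNIV"
  using conv_absI[OF assms] by (rule abs_summable_summable)

lemma norm_conv_le:
  assumes "conv_abs f g i"
  shows "norm ((f \<star> g) i) \<le> (\<Sum>\<^sub>\<infinity>j. norm (f j) * norm (g (i - j)))"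
proof -
  have "norm ((f \<star> g) i) \<le> (\<Sum>\<^sub>\<infinity>j. norm (f j * g (i - j)))"
    unfolding conv_def by (rule norm_infsum_bound) (use conv_absI[OF assms] in simp)
  also have "\<dots> \<le> (\<Sum>\<^sub>\<infinity>j. norm (f j) * norm (g (i - j)))"
    by (rule infsum_mono) (use conv_absI[OF assms] assms norm_mult_ineq in \<open>auto simp: conv_abs_def\<close>)
  finally show ?thesis .
qed

lemma bij_diff_int: "bij (\<lambda>j::int. i - j)"
  by (rule bij_betw_byWitness[where f' = "\<lambda>j. i - j"]) auto

lemma conv_abs_commute: "conv_abs f g i \<longleftrightarrow> conv_abs g f i"
  unfolding conv_abs_def
  by (subst summable_on_reindex_bij_betw[OF bij_diff_int[of i], symmetric]) (simp add: mult.commute)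

lemma infsum_conv_commute:
  "(\<Sum>\<^sub>\<infinity>j. norm (f j) * norm (g (i - j))) = (\<Sum>\<^sub>\<infinity>j. norm (g j) * norm (f (i - j :: int)))"
  by (subst infsum_reindex_bij_betw[OF bij_diff_int[of i], symmetric]) (simp add: mult.commute)

lemma conv_bdd_commute: "conv_bdd f g \<longleftrightarrow> conv_bdd g f"
  unfolding conv_bdd_def infsum_conv_commute[of f g] using conv_abs_commute[of f g] by blast

lemma conv_bddI1:
  assumes "l1 f" "bdd g"
  shows "conv_bdd f g"
proof -
  obtain C where C: "C > 0" "\<And>k. norm (g k) \<le> C" using bddE[OF assms(2)] by blast
  have S: "(\<lambda>j. norm (f j) * C) summable_on UNIV"
    using assms(1) by (intro summable_on_cmult_left) (simp add: l1_def)
  have c: "conv_abs f g i" for i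
    unfolding conv_abs_def
    by (rule summable_on_comparison_test[OF S]) (use C in \<open>auto intro!: mult_left_mono\<close>)
  have "(\<Sum>\<^sub>\<infinity>j. norm (f j) * norm (g (i - j))) \<le> (\<Sum>\<^sub>\<infinity>j. norm (f j) * C)" for i
    by (rule infsum_mono) (use S c C in \<open>auto intro!: mult_left_mono simp: conv_abs_def\<close>)
  then show ?thesis using c unfolding conv_bdd_def by blast
qed

lemma conv_bddI2: "bdd f \<Longrightarrow> l1 g \<Longrightarrow> conv_bdd f g"
  using conv_bddI1 conv_bdd_commute by blast

lemma conv_bdd_abs: "conv_bdd f g \<Longrightarrow> conv_abs f g i"
  by (simp add: conv_bdd_def)

lemma l1_bdd: "l1 f \<Longrightarrow> bdd f"
  unfolding l1_def bdd_def
proof (intro exI allI)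
  fix k assume "(\<lambda>k. norm (f k)) summable_on UNIV"
  from finite_sum_le_infsum[OF this, of "{k}"] show "norm (f k) \<le> (\<Sum>\<^sub>\<infinity>k. norm (f k))" by simp
qed

lemma bdd_conv: "conv_bdd f g \<Longrightarrow> bdd (f \<star> g)"
  unfolding bdd_def conv_bdd_def using norm_conv_le order_trans by blast

lemma conv3_absI_left:
  assumes f: "l1 f" and gh: "conv_bdd g h"
  shows "conv3_abs f g h i"
proof -
  obtain C where C: "\<And>i. (\<Sum>\<^sub>\<infinity>j. norm (g j) * norm (h (i - j))) \<le> C"
    using gh by (auto simp: conv_bdd_def)
  have s: "(\<lambda>k. norm (g k) * norm (h (i - k))) summable_on UNIV" for i
    using gh by (simp add: conv_bdd_def conv_abs_def)
  have "(\<lambda>(j, k). norm (f j) * (norm (g k) * norm (h (i - j - k)))) summable_on Sigma UNIV (\<lambda>_. UNIV)"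
  proof (rule summable_on_SigmaI)
    show "((\<lambda>k. case (j, k) of (j, k) \<Rightarrow> norm (f j) * (norm (g k) * norm (h (i - j - k)))) has_sum
        norm (f j) * (\<Sum>\<^sub>\<infinity>k. norm (g k) * norm (h (i - j - k)))) UNIV" for j
      using has_sum_cmult_right[OF has_sum_infsum[OF s[of "i - j"]]] by simp
    show "(\<lambda>j. norm (f j) * (\<Sum>\<^sub>\<infinity>k. norm (g k) * norm (h (i - j - k)))) summable_on UNIV"
    proof (rule summable_on_comparison_test)
      show "(\<lambda>j. norm (f j) * C) summable_on UNIV"
        using f by (intro summable_on_cmult_left) (simp add: l1_def)
    qed (use C in \<open>auto intro!: mult_left_mono mult_nonneg_nonneg infsum_nonneg\<close>)
  qed auto
  then show ?thesis by (simp add: conv3_abs_def mult.assoc)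
qed

lemma bij_conv3: "bij (\<lambda>(j, k). (i - j - k, j :: int))"
  by (rule bij_betw_byWitness[where f' = "\<lambda>(a, b). (b, i - a - b)"]) auto

text \<open>The terms are indexed by triples with sum \<open>i\<close>, on which cyclic shifts act,
  and norms commute. This moves a summable factor from the left end to the right one.\<close>

lemma conv3_abs_rotate:
  "conv3_abs f g h i \<longleftrightarrow> conv3_abs h f g i"
proof -
  have "conv3_abs h f g i \<longleftrightarrow>
      ((\<lambda>(j, k). norm (h j) * norm (f k) * norm (g (i - j - k))) \<circ> (\<lambda>(j, k). (i - j - k, j))) summable_on UNIV"
    unfolding conv3_abs_def
    using summable_on_reindex_bij_betw[OF bij_conv3[of i],
        of "\<lambda>(j, k). norm (h j) * norm (f k) * norm (g (i - j - k))"] by (simp add: o_def)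
  then show ?thesis by (simp add: conv3_abs_def o_def case_prod_unfold mult_ac)
qed

lemma conv3_absI_right:
  assumes "conv_bdd f g" "l1 h"
  shows "conv3_abs f g h i"
  using conv3_absI_left[OF assms(2,1)] conv3_abs_rotate by blast

lemma conv3_absI_finite:
  assumes "finite F" "\<And>j k. (j, k) \<notin> F \<Longrightarrow> f j = 0 \<or> g k = 0 \<or> h (i - j - k) = 0"
  shows "conv3_abs f g h i"
  unfolding conv3_abs_def
proof (rule finite_nonzero_values_imp_summable_on)
  have "{x \<in> UNIV. (case x of (j, k) \<Rightarrow> norm (f j) * norm (g k) * norm (h (i - j - k))) \<noteq> 0} \<subseteq> F"
    using assms(2) by fastforce
  then show "finite {x \<in> UNIV. (case x of (j, k) \<Rightarrow> norm (f j) * norm (g k) * norm (h (i - j - k))) \<noteq> 0}"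
    using assms(1) finite_subset by blast
qed

text \<open>Fubini on the triple sum, iterated once by rows and once, after a change of variables,
  by diagonals.\<close>

lemma conv_assoc:
  fixes f g h :: "int \<Rightarrow> 'a::{real_normed_algebra, banach}"
  assumes "conv3_abs f g h i"
  shows "(f \<star> g \<star> h) i = (f \<star> (g \<star> h)) i"
proof -
  define F where "F = (\<lambda>(j, k). f j * g k * h (i - j - k))"
  have N: "(\<lambda>p. norm (F p)) summable_on UNIV"
    by (rule summable_on_comparison_test[OF assms[unfolded conv3_abs_def]])
      (auto simp: F_def intro!: order_trans[OF norm_mult_ineq] mult_right_mono[OF norm_mult_ineq])
  then have S: "F summable_on UNIV" by (rule abs_summable_summable)
  have rows: "(\<lambda>k. norm (f j) * (norm (g k) * norm (h (i - j - k)))) summable_on UNIV" for j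
    using summable_on_SigmaD1[of "\<lambda>j k. norm (f j) * norm (g k) * norm (h (i - j - k))" UNIV "\<lambda>_. UNIV" j]
      assms by (simp add: conv3_abs_def mult.assoc)
  have R: "f j * (g \<star> h) (i - j) = (\<Sum>\<^sub>\<infinity>k. F (j, k))" for j
  \<comment> \<open>A row is known to converge only if its coefficient is nonzero; otherwise both
    sides vanish, whatever \<open>infsum\<close> returns.\<close>
  proof (cases "f j = 0")
    case False
    have "(\<lambda>k. norm (g k) * norm (h (i - j - k))) summable_on UNIV"
      using summable_on_cmult_right[OF rows[of j], of "inverse (norm (f j))"] False by (simp add: field_simps)
    then have "conv_abs g h (i - j)" by (simp add: conv_abs_def)
    from infsum_cmult_right[OF conv_abs_summable[OF this], of "f j"] show ?thesis
      by (simp add: conv_def F_def mult.assoc)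
  qed (simp add: F_def)
  have "(f \<star> (g \<star> h)) i = (\<Sum>\<^sub>\<infinity>j. \<Sum>\<^sub>\<infinity>k. F (j, k))"
    unfolding conv_def[of f "g \<star> h"] by (simp add: R)
  also have "\<dots> = infsum F UNIV"
    using infsum_Sigma_banach[of F UNIV "\<lambda>_. UNIV"] S by simp
  finally have 1: "(f \<star> (g \<star> h)) i = infsum F UNIV" .
  define G where "G = (\<lambda>(m, j). f j * g (m - j) * h (i - m))"
  have bij: "bij (\<lambda>(m, j). (j, m - j :: int))"
    by (rule bij_betw_byWitness[where f' = "\<lambda>(a, b). (a + b, a)"]) auto
  have GF: "G = (\<lambda>x. F ((\<lambda>(m, j). (j, m - j)) x))" by (auto simp: G_def F_def)
  have SG: "G summable_on UNIV"
    unfolding GF using summable_on_reindex_bij_betw[OF bij, of F] S by simp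
  have IG: "infsum G UNIV = infsum F UNIV"
    unfolding GF using infsum_reindex_bij_betw[OF bij, of F] by simp
  have "conv3_abs h f g i" using assms conv3_abs_rotate by blast
  then have cols: "(\<lambda>j. norm (h (i - m)) * (norm (f j) * norm (g (m - j)))) summable_on UNIV" for m
    using summable_on_SigmaD1[of "\<lambda>j k. norm (h j) * norm (f k) * norm (g (i - j - k))" UNIV "\<lambda>_. UNIV" "i - m"]
    by (simp add: conv3_abs_def mult.assoc)
  have L: "(f \<star> g) m * h (i - m) = (\<Sum>\<^sub>\<infinity>j. G (m, j))" for m
  proof (cases "h (i - m) = 0")
    case False
    have "(\<lambda>j. norm (f j) * norm (g (m - j))) summable_on UNIV"
      using summable_on_cmult_right[OF cols[of m], of "inverse (norm (h (i - m)))"] False by (simp add: field_simps)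
    then have "conv_abs f g m" by (simp add: conv_abs_def)
    from infsum_cmult_left[OF conv_abs_summable[OF this], of "h (i - m)"] show ?thesis
      by (simp add: conv_def G_def)
  qed (simp add: G_def)
  have "(f \<star> g \<star> h) i = (\<Sum>\<^sub>\<infinity>m. \<Sum>\<^sub>\<infinity>j. G (m, j))"
    unfolding conv_def[of "f \<star> g" h] by (simp add: L)
  also have "\<dots> = infsum G UNIV"
    using infsum_Sigma_banach[of G UNIV "\<lambda>_. UNIV"] SG by simp
  finally show ?thesis using 1 IG by simp
qed

text \<open>A constant sequence \<open>1\<close> as third factor makes the convergence of the double
  sum an instance of \<open>conv3_abs\<close>, and rotation turns it into a sum over the output
  index.\<close>

lemma l1_conv:
  assumes "l1 f" "l1 g"
  shows "l1 (f \<star> g)"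
proof -
  have 1: "bdd (\<lambda>_. 1 :: real)" by (auto simp: bdd_def)
  have a: "l1 (\<lambda>k. norm (f k))" "l1 (\<lambda>k. norm (g k))" using assms by (simp_all add: l1_def)
  have "conv3_abs (\<lambda>k. norm (f k)) (\<lambda>k. norm (g k)) (\<lambda>_. 1) 0"
    by (rule conv3_absI_left[OF a(1) conv_bddI1[OF a(2) 1]])
  then have "conv3_abs (\<lambda>_. 1) (\<lambda>k. norm (f k)) (\<lambda>k. norm (g k)) 0"
    using conv3_abs_rotate by blast
  then have s: "(\<lambda>(m, j). norm (f j) * norm (g (- m - j))) summable_on UNIV"
    by (simp add: conv3_abs_def)
  have "(\<lambda>m. \<Sum>\<^sub>\<infinity>j. norm (f j) * norm (g (- m - j))) summable_on UNIV"
    using summable_on_Sigma_banach[of "\<lambda>m j. norm (f j) * norm (g (- m - j))" UNIV "\<lambda>_. UNIV"] s by simp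
  then have "(\<lambda>m. \<Sum>\<^sub>\<infinity>j. norm (f j) * norm (g (m - j))) summable_on UNIV"
    using summable_on_reindex_bij_betw[OF bij_uminus, of "\<lambda>m. \<Sum>\<^sub>\<infinity>j. norm (f j) * norm (g (m - j))"] by simp
  then show ?thesis
    unfolding l1_def
    by (rule summable_on_comparison_test)
      (use conv_bdd_abs[OF conv_bddI1[OF assms(1) l1_bdd[OF assms(2)]]] norm_conv_le in auto)
qed

lemma l1_finite_support: "finite {k. f k \<noteq> 0} \<Longrightarrow> l1 f"
  unfolding l1_def by (rule finite_nonzero_values_imp_summable_on) simp

lemma l1_delta [simp]: "l1 (delta t x)"
  by (rule l1_finite_support) (auto simp: delta_def intro: finite_subset[of _ "{t}"])

lemma conv_single:
  assumes "\<And>k. k \<noteq> m \<Longrightarrow> f k * g (i - k) = 0"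
  shows "(f \<star> g) i = f m * g (i - m)"
proof -
  have "(f \<star> g) i = (\<Sum>\<^sub>\<infinity>j\<in>{m}. f j * g (i - j))"
    unfolding conv_def by (rule infsum_cong_neutral) (use assms in auto)
  then show ?thesis by simp
qed

lemma conv_delta_right: "(f \<star> delta t x) i = f (i - t) * x"
  by (subst conv_single[where m = "i - t"]) (auto simp: delta_def)

lemma conv_delta_left: "(delta t x \<star> f) i = x * f (i - t)"
  by (subst conv_single[where m = t]) (auto simp: delta_def)

lemma conv_minus_right: "(f \<star> (\<lambda>k. - g k)) i = - (f \<star> g) i"
  by (simp add: conv_def infsum_uminus)

lemma conv_minus_left: "((\<lambda>k. - f k) \<star> g) i = - (f \<star> g) i"
  by (simp add: conv_def infsum_uminus)

lemma conv_add_right: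
  fixes f g :: "int \<Rightarrow> 'a::{real_normed_algebra, banach}"
  assumes "conv_abs f g i" "conv_abs f h i"
  shows "(f \<star> (\<lambda>k. g k + h k)) i = (f \<star> g) i + (f \<star> h) i"
  unfolding conv_def distrib_left
  by (rule infsum_add) (use assms conv_abs_summable in auto)

lemma star_star [simp]: "star (star f) = f"
  by (simp add: star_def fun_eq_iff)

lemma norm_star: "norm (star f k) = norm (f (- k))"
  by (simp add: star_def)

lemma l1_star [simp]: "l1 (star f) \<longleftrightarrow> l1 f"
  unfolding l1_def norm_star using summable_on_reindex_bij_betw[OF bij_uminus, of "\<lambda>m. norm (f m)"] by simp

lemma bdd_star [simp]: "bdd (star f) \<longleftrightarrow> bdd f"
  unfolding bdd_def norm_star by (metis minus_minus)

lemma star_conv: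
  assumes "conv_abs f g (- i)"
  shows "star (f \<star> g) i = (star g \<star> star f) i"
proof -
  have "star (f \<star> g) i = (\<Sum>\<^sub>\<infinity>j. adj (f j * g (- i - j)))"
    unfolding star_def conv_def
    using infsumI[OF has_sum_bounded_linear[OF bounded_linear_adj has_sum_infsum[OF conv_abs_summable[OF assms]]]]
    by (simp add: o_def)
  also have "\<dots> = (\<Sum>\<^sub>\<infinity>j. adj (g (- i - j)) * adj (f j))" by (simp add: adj_mult)
  also have "\<dots> = (\<Sum>\<^sub>\<infinity>j. adj (g (- j)) * adj (f (- (i - j))))"
    by (rule infsum_reindex_bij_witness[where i = "\<lambda>j. j - i" and j = "\<lambda>j. i + j"]) auto
  finally show ?thesis by (simp add: conv_def star_def)
qed

section \<open>Weights and elementary sums\<close>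

definition wt :: "real \<Rightarrow> int \<Rightarrow> real" where
  "wt s k = (1 + \<bar>of_int k\<bar>) powr (- s)"

lemma wt_pos [simp]: "wt s k > 0"
  by (simp add: wt_def add_pos_nonneg)

lemma wt_nonneg [simp]: "wt s k \<ge> 0"
  by (simp add: less_imp_le)

lemma wt_minus [simp]: "wt s (- k) = wt s k"
  by (simp add: wt_def)

lemma wt_0 [simp]: "wt s 0 = 1"
  by (simp add: wt_def)

lemma wt_zero [simp]: "wt 0 k = 1"
proof -
  have "1 + \<bar>real_of_int k\<bar> \<noteq> 0" by linarith
  then show ?thesis by (simp add: wt_def)
qed

lemma wt_add: "wt (s + t) k = wt s k * wt t k"
  by (simp add: wt_def flip: powr_add)

lemma wt_antimono: "s \<le> t \<Longrightarrow> wt t k \<le> wt s k"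
  unfolding wt_def by (rule powr_mono) auto

lemma wt_mono_abs: "s \<ge> 0 \<Longrightarrow> \<bar>j\<bar> \<le> \<bar>k\<bar> \<Longrightarrow> wt s k \<le> wt s j"
  unfolding wt_def by (rule powr_mono2') auto

text \<open>Peetre's inequality, from \<open>1 + |i| \<le> (1 + |i - j|) * (1 + |j|)\<close>: a
  shift of the argument costs a growing weight of the shift.\<close>

lemma wt_peetre:
  assumes "s \<ge> 0"
  shows "wt s (i - j) \<le> wt s i * wt (- s) j"
proof -
  have "(1 + \<bar>real_of_int i\<bar>) \<le> (1 + \<bar>of_int (i - j)\<bar>) * (1 + \<bar>of_int j\<bar>)"
  proof -
    have "\<bar>real_of_int i\<bar> \<le> \<bar>of_int (i - j)\<bar> + \<bar>of_int j\<bar>" by simp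
    moreover have "\<bar>real_of_int (i - j)\<bar> * \<bar>of_int j\<bar> \<ge> 0" by (intro mult_nonneg_nonneg) auto
    moreover have "(1 + \<bar>real_of_int (i - j)\<bar>) * (1 + \<bar>of_int j\<bar>)
        = 1 + \<bar>real_of_int (i - j)\<bar> + \<bar>of_int j\<bar> + \<bar>real_of_int (i - j)\<bar> * \<bar>of_int j\<bar>"
      by (simp add: distrib_left distrib_right)
    ultimately show ?thesis by linarith
  qed
  then have "((1 + \<bar>of_int (i - j)\<bar>) * (1 + \<bar>of_int j\<bar>)) powr (- s) \<le> wt s i"
    unfolding wt_def using assms by (intro powr_mono2') auto
  then have "wt s (i - j) * wt s j \<le> wt s i"
    by (simp add: wt_def powr_mult)
  then have "wt s (i - j) * (wt s j * wt (- s) j) \<le> wt s i * wt (- s) j"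
    by (simp add: mult.assoc[symmetric] mult_right_mono)
  moreover have "wt s j * wt (- s) j = 1"
    using wt_add[of s "- s" j] by simp
  ultimately show ?thesis by simp
qed

text \<open>Comparison of a series with a primitive \<open>F\<close>; serves for tails of powers and
  for the Hilbert kernel.\<close>

lemma infsum_le_telescope:
  fixes f F :: "nat \<Rightarrow> real"
  assumes f: "\<And>k. 0 \<le> f k" "\<And>k. f k \<le> F (Suc k) - F k" and L: "\<And>k. F k \<le> L"
  shows "f summable_on UNIV" "infsum f UNIV \<le> L - F 0"
proof -
  have b: "sum f {..<n} \<le> L - F 0" for n
  proof -
    have "sum f {..<n} \<le> (\<Sum>k<n. F (Suc k) - F k)" by (rule sum_mono) (use f in auto)
    also have "\<dots> = F n - F 0" by (rule sum_lessThan_telescope)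
    finally show ?thesis using L[of n] by simp
  qed
  have "summable f"
    by (rule summableI_nonneg_bounded[of f "L - F 0"]) (use f(1) b in auto)
  then show s: "f summable_on UNIV"
    using f(1) by (intro summable_nonneg_imp_summable_on)
  have "f sums infsum f UNIV" using s by (intro has_sum_imp_sums has_sum_infsum)
  then show "infsum f UNIV \<le> L - F 0"
    unfolding sums_def by (rule LIMSEQ_le_const2) (use b in auto)
qed

lemma bij_betw_int_ge: "bij_betw (\<lambda>k. m + int k) UNIV {m..}"
  by (rule bij_betw_byWitness[where f' = "\<lambda>k. nat (k - m)"]) auto

lemma summable_on_int_ge: "f summable_on {m..} \<longleftrightarrow> (\<lambda>k. f (m + int k)) summable_on UNIV"
  by (rule summable_on_reindex_bij_betw[OF bij_betw_int_ge, symmetric])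

lemma infsum_int_ge: "infsum f {m..} = (\<Sum>\<^sub>\<infinity>k. f (m + int k))"
  by (rule infsum_reindex_bij_betw[OF bij_betw_int_ge, symmetric])

lemma bij_betw_int_le: "bij_betw (\<lambda>k. m - int k) UNIV {..m}"
  by (rule bij_betw_byWitness[where f' = "\<lambda>k. nat (m - k)"]) auto

lemma summable_on_int_le: "f summable_on {..m} \<longleftrightarrow> (\<lambda>k. f (m - int k)) summable_on UNIV"
  by (rule summable_on_reindex_bij_betw[OF bij_betw_int_le, symmetric])

lemma infsum_int_le: "infsum f {..m} = (\<Sum>\<^sub>\<infinity>k. f (m - int k))"
  by (rule infsum_reindex_bij_betw[OF bij_betw_int_le, symmetric])

lemma summable_on_wt:
  assumes "s > 1"
  shows "wt s summable_on A"
proof -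
  have "summable (\<lambda>n. real n powr (- s))" using assms by (simp add: summable_real_powr_iff)
  then have "summable (\<lambda>n. real (Suc n) powr (- s))" by (subst summable_Suc_iff)
  then have n: "(\<lambda>n. real (Suc n) powr (- s)) summable_on UNIV"
    by (intro summable_nonneg_imp_summable_on) auto
  have "wt s summable_on {0..}" "wt s summable_on {..0}"
    unfolding summable_on_int_ge summable_on_int_le using n by (simp_all add: wt_def)
  then have "wt s summable_on ({0..} \<union> {..0})" by (rule summable_on_union)
  moreover have "{0..} \<union> {..0} = (UNIV :: int set)" by auto
  ultimately show ?thesis using summable_on_subset_banach[of "wt s" UNIV A] by simp
qed

lemma powr_diff_ge:
  fixes x d :: real
  assumes "x > 0" "d > 0"
  shows "(x + 1) powr (- 1 - d) \<le> (x powr (- d) - (x + 1) powr (- d)) / d"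
proof -
  have "\<exists>z>x. z < x + 1 \<and> (x + 1) powr (- d) - x powr (- d) = (x + 1 - x) * (- d * z powr (- d - 1))"
    by (rule MVT2) (use assms in \<open>auto intro!: derivative_eq_intros\<close>)
  then obtain z where z: "x < z" "z < x + 1"
    "(x + 1) powr (- d) - x powr (- d) = - d * z powr (- d - 1)" by auto
  have "(x + 1) powr (- d - 1) \<le> z powr (- d - 1)"
    using z assms by (intro powr_mono2') auto
  moreover have "(x powr (- d) - (x + 1) powr (- d)) / d = z powr (- d - 1)"
    using z(3) assms by (simp add: field_simps)
  moreover have "- d - 1 = - 1 - d" by simp
  ultimately show ?thesis by simp
qed

lemma infsum_wt_tail:
  assumes "d > 0" "K \<ge> (1 :: int)"
  shows "(\<Sum>\<^sub>\<infinity>k\<in>{K..}. wt (1 + d) k) \<le> of_int K powr (- d) / d"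
proof -
  define F where "F = (\<lambda>k::nat. - ((of_int K + real k) powr (- d) / d))"
  have "(\<Sum>\<^sub>\<infinity>k. wt (1 + d) (K + int k)) \<le> 0 - F 0"
  proof (rule infsum_le_telescope(2))
    fix k :: nat
    have *: "\<bar>real_of_int K + real k\<bar> = real_of_int K + real k" using assms by simp
    show "wt (1 + d) (K + int k) \<le> F (Suc k) - F k"
      using powr_diff_ge[of "of_int K + real k" d] assms
      by (simp add: wt_def F_def * diff_divide_distrib add_ac)
  qed (use assms in \<open>auto simp: F_def\<close>)
  then show ?thesis by (simp add: infsum_int_ge F_def)
qed

lemma sum_powr_le:
  fixes d :: real
  assumes "0 < d" "d < 1"
  shows "(\<Sum>u=1..n. real u powr (- d)) \<le> real n powr (1 - d) / (1 - d)"
proof (induction n)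
  case (Suc n)
  show ?case
  proof (cases "n = 0")
    case True
    then show ?thesis using assms by simp
  next
    case False
    let ?x = "real n"
    have "\<exists>z>?x. z < ?x + 1 \<and> (?x + 1) powr (1 - d) - ?x powr (1 - d) = (?x + 1 - ?x) * ((1 - d) * z powr (1 - d - 1))"
      by (rule MVT2) (use assms False in \<open>auto intro!: derivative_eq_intros\<close>)
    then obtain z where z: "?x < z" "z < ?x + 1"
      "(?x + 1) powr (1 - d) - ?x powr (1 - d) = (1 - d) * z powr (- d)" by auto
    have "(?x + 1) powr (- d) \<le> z powr (- d)" using z assms False by (intro powr_mono2') auto
    also have "z powr (- d) = ((?x + 1) powr (1 - d) - ?x powr (1 - d)) / (1 - d)"
      using z(3) assms by (simp add: field_simps)
    finally have "real (Suc n) powr (- d) \<le> (real (Suc n) powr (1 - d) - real n powr (1 - d)) / (1 - d)"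
      by (simp add: add.commute)
    with Suc.IH show ?thesis by (simp add: diff_divide_distrib)
  qed
qed simp

text \<open>The kernel \<open>1 / (x + y)\<close> has the weight \<open>y powr (-1/2)\<close> as an eigenfunction with eigenvalue
  \<open>\<pi>\<close>; the primitive of \<open>1 / ((x + y) * sqrt y)\<close> is \<open>2 / sqrt x * arctan (sqrt (y / x))\<close>.\<close>

lemma hilbert_kernel_step:
  fixes x y :: real
  assumes "x > 0" "y > 0"
  shows "1 / ((x + (y + 1)) * sqrt (y + 1)) \<le> 2 / sqrt x * (arctan (sqrt ((y + 1) / x)) - arctan (sqrt (y / x)))"
proof -
  let ?f = "\<lambda>y. 2 / sqrt x * arctan (sqrt (y / x))"
  have "\<exists>z>y. z < y + 1 \<and> ?f (y + 1) - ?f y = (y + 1 - y) * (1 / ((x + z) * sqrt z))"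
  proof (rule MVT2)
    fix z assume z: "y \<le> z" "z \<le> y + 1"
    then have zp: "z > 0" using assms by simp
    have "(?f has_real_derivative 2 / sqrt x * (inverse (1 + (sqrt (z / x))\<^sup>2) * (inverse (sqrt (z / x)) / 2 * (1 / x)))) (at z)"
      using divide_pos_pos[OF zp assms(1)] assms(1)
      by (intro DERIV_cmult DERIV_chain2[where f = arctan] DERIV_chain2[where f = sqrt]
        DERIV_arctan DERIV_real_sqrt DERIV_cdivide DERIV_ident)
    moreover have "2 / sqrt x * (inverse (1 + (sqrt (z / x))\<^sup>2) * (inverse (sqrt (z / x)) / 2 * (1 / x)))
        = 1 / ((x + z) * sqrt z)"
    proof -
      define r t where "r = sqrt z" and "t = sqrt x"
      have rt: "r > 0" "t > 0" "z = r * r" "x = t * t" using zp assms by (auto simp: r_def t_def)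
      have "sqrt (z / x) = r / t" by (simp add: real_sqrt_divide r_def t_def)
      moreover have "t * t + r * r > 0" using rt by (intro add_pos_pos mult_pos_pos)
      ultimately show ?thesis unfolding r_def[symmetric] t_def[symmetric] unfolding rt(3,4)
        using rt(1,2) by (simp add: divide_simps power2_eq_square) (simp add: algebra_simps)
    qed
    ultimately show "(?f has_real_derivative 1 / ((x + z) * sqrt z)) (at z)" by simp
  qed simp
  then obtain z where z: "y < z" "z < y + 1" "?f (y + 1) - ?f y = 1 / ((x + z) * sqrt z)" by auto
  have "1 / ((x + (y + 1)) * sqrt (y + 1)) \<le> 1 / ((x + z) * sqrt z)"
    using z assms by (intro divide_left_mono mult_mono mult_pos_pos) auto
  also have "\<dots> = 2 / sqrt x * (arctan (sqrt ((y + 1) / x)) - arctan (sqrt (y / x)))"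
    using z(3) by (simp add: right_diff_distrib)
  finally show ?thesis .
qed

lemma hilbert_kernel_sum:
  fixes x y :: real
  assumes "x > 0" "y > 1"
  shows "(\<lambda>k::nat. 1 / ((x + (y + real k)) * sqrt (y + real k))) summable_on UNIV"
    and "(\<Sum>\<^sub>\<infinity>k::nat. 1 / ((x + (y + real k)) * sqrt (y + real k))) \<le> pi / sqrt x"
proof -
  define f where "f = (\<lambda>k::nat. 1 / ((x + (y + real k)) * sqrt (y + real k)))"
  \<comment> \<open>\<open>hilbert_kernel_step\<close> bounds the term at \<open>y + 1\<close> by
    the increment starting at \<open>y\<close>; the primitive therefore starts at
    \<open>y - 1\<close>, which has to be positive.\<close>
  define F where "F = (\<lambda>k::nat. 2 / sqrt x * arctan (sqrt ((y - 1 + real k) / x)))"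
  have f0: "0 \<le> f k" for k using assms by (simp add: f_def)
  have f1: "f k \<le> F (Suc k) - F k" for k
    using hilbert_kernel_step[of x "y - 1 + real k"] assms
    by (simp add: f_def F_def right_diff_distrib algebra_simps)
  have f2: "F k \<le> pi / sqrt x" for k
  proof -
    have "2 * arctan (sqrt ((y - 1 + real k) / x)) \<le> pi"
      using arctan_ubound[of "sqrt ((y - 1 + real k) / x)"] by simp
    then show ?thesis using assms unfolding F_def by (simp add: field_simps)
  qed
  have "F 0 \<ge> 0" using assms by (simp add: F_def)
  with infsum_le_telescope[of f F, OF f0 f1 f2] show
    "(\<lambda>k::nat. 1 / ((x + (y + real k)) * sqrt (y + real k))) summable_on UNIV"
    "(\<Sum>\<^sub>\<infinity>k::nat. 1 / ((x + (y + real k)) * sqrt (y + real k))) \<le> pi / sqrt x"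
    by (auto simp: f_def)
qed

section \<open>Sequences of power decay and their convolutions\<close>

definition dec :: "real \<Rightarrow> (int \<Rightarrow> 'a::real_normed_vector) \<Rightarrow> bool" where
  "dec s f \<longleftrightarrow> (\<exists>C. \<forall>k. norm (f k) \<le> C * wt s k)"

lemma decE:
  assumes "dec s f"
  obtains C where "C > 0" "\<And>k. norm (f k) \<le> C * wt s k"
proof -
  obtain C where C: "\<And>k. norm (f k) \<le> C * wt s k" using assms by (auto simp: dec_def)
  have "norm (f k) \<le> max C 1 * wt s k" for k
    by (rule order_trans[OF C]) (auto intro!: mult_right_mono)
  then show ?thesis by (intro that[of "max C 1"]) auto
qed

lemma dec_mono:
  assumes "dec t f" "s \<le> t"
  shows "dec s f"
proof -
  obtain C where C: "C > 0" "\<And>k. norm (f k) \<le> C * wt t k" using decE[OF assms(1)] by blast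
  have "norm (f k) \<le> C * wt s k" for k
    by (rule order_trans[OF C(2)]) (use C(1) wt_antimono[OF assms(2)] in auto)
  then show ?thesis by (auto simp: dec_def)
qed

lemma l1_dec:
  assumes "dec s f" "s > 1"
  shows "l1 f"
proof -
  obtain C where C: "\<And>k. norm (f k) \<le> C * wt s k" using decE[OF assms(1)] by blast
  show ?thesis unfolding l1_def
    by (rule summable_on_comparison_test[OF summable_on_cmult_right[OF summable_on_wt[OF assms(2)]]])
      (use C in auto)
qed

lemma bdd_dec:
  assumes "dec s f" "s \<ge> 0"
  shows "bdd f"
proof -
  have "dec 0 f" using dec_mono[OF assms] .
  then show ?thesis by (auto simp: dec_def bdd_def)
qed

lemma dec_star [simp]: "dec s (star f) \<longleftrightarrow> dec s f"
  unfolding dec_def norm_star by (metis minus_minus wt_minus)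

lemma dec_finite_support:
  assumes "finite {k. f k \<noteq> 0}"
  shows "dec s f"
proof -
  have "norm (f k) \<le> (\<Sum>j\<in>{j. f j \<noteq> 0}. norm (f j) / wt s j) * wt s k" for k
  proof (cases "f k = 0")
    case True
    then show ?thesis by (auto intro!: mult_nonneg_nonneg sum_nonneg)
  next
    case False
    have "norm (f k) / wt s k \<le> (\<Sum>j\<in>{j. f j \<noteq> 0}. norm (f j) / wt s j)"
      by (rule member_le_sum) (use False assms in auto)
    then show ?thesis using wt_pos[of s k] by (simp add: field_simps del: wt_pos)
  qed
  then show ?thesis unfolding dec_def by blast
qed

lemma dec_add:
  assumes "dec s f" "dec s g"
  shows "dec s (\<lambda>k. f k + g k)"
proof -
  obtain C D where "\<And>k. norm (f k) \<le> C * wt s k" "\<And>k. norm (g k) \<le> D * wt s k"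
    using decE[OF assms(1)] decE[OF assms(2)] by metis
  then have "norm (f k + g k) \<le> (C + D) * wt s k" for k
    by (intro order_trans[OF norm_triangle_ineq]) (simp add: distrib_right add_mono)
  then show ?thesis unfolding dec_def by blast
qed

lemma dec_minus [simp]: "dec s (\<lambda>k. - f k) \<longleftrightarrow> dec s f"
  by (simp add: dec_def)

lemma dec_restrict:
  assumes "dec s f"
  shows "dec s (\<lambda>k. if P k then f k else 0)"
proof -
  obtain C where "C > 0" "\<And>k. norm (f k) \<le> C * wt s k" using decE[OF assms] by blast
  then show ?thesis unfolding dec_def by (intro exI[of _ C]) auto
qed

text \<open>The argument of smaller absolute value carries the larger weights, so both weights may
  be evaluated there.\<close>

lemma wt_mult_le:
  assumes "s \<ge> 0" "t \<ge> 0"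
  shows "wt s j * wt t k \<le> wt (s + t) j + wt (s + t) k"
proof (cases "\<bar>j\<bar> \<le> \<bar>k\<bar>")
  case True
  then have "wt s j * wt t k \<le> wt s j * wt t j" by (intro mult_left_mono wt_mono_abs assms) auto
  also have "\<dots> = wt (s + t) j" by (simp add: wt_add)
  finally show ?thesis using wt_nonneg[of "s + t" k] by linarith
next
  case False
  then have "wt s j * wt t k \<le> wt s k * wt t k" by (intro mult_right_mono wt_mono_abs assms) auto
  also have "\<dots> = wt (s + t) k" by (simp add: wt_add)
  finally show ?thesis using wt_nonneg[of "s + t" j] by linarith
qed

lemma wt_half:
  assumes "r \<ge> 0" "\<bar>i\<bar> \<le> 2 * \<bar>j\<bar>"
  shows "wt r j \<le> 2 powr r * wt r i"
proof -
  have "((1 + \<bar>real_of_int i\<bar>) / 2) powr r \<le> (1 + \<bar>of_int j\<bar>) powr r"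
  proof (rule powr_mono2)
    have "real_of_int \<bar>i\<bar> \<le> real_of_int (2 * \<bar>j\<bar>)" using assms(2) by (simp only: of_int_le_iff)
    then show "(1 + \<bar>real_of_int i\<bar>) / 2 \<le> 1 + \<bar>of_int j\<bar>" by simp
  qed (use assms in auto)
  then have "(1 + \<bar>of_int j\<bar>) powr (- r) \<le> ((1 + \<bar>real_of_int i\<bar>) / 2) powr (- r)"
    unfolding powr_minus by (intro le_imp_inverse_le) (auto simp: add_pos_nonneg)
  then show ?thesis by (simp add: wt_def powr_divide powr_minus field_simps)
qed

text \<open>One of \<open>j\<close> and \<open>i - j\<close> has absolute value at least
  \<open>|i| / 2\<close>. There a factor \<open>wt r i\<close> is split off; the remaining
  exponents, of sum \<open>s + t - r\<close>, are gathered at one point by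
  \<open>wt_mult_le\<close>.\<close>

lemma wt_conv_le:
  assumes "0 \<le> r" "r \<le> s" "r \<le> t"
  shows "wt s j * wt t (i - j) \<le> 2 powr r * wt r i * (wt (s + t - r) j + wt (s + t - r) (i - j))"
proof (cases "\<bar>i\<bar> \<le> 2 * \<bar>j\<bar>")
  case True
  have "wt s j * wt t (i - j) = wt r j * (wt (s - r) j * wt t (i - j))"
    using wt_add[of r "s - r" j] by simp
  also have "\<dots> \<le> (2 powr r * wt r i) * (wt (s - r + t) j + wt (s - r + t) (i - j))"
    using assms True by (intro mult_mono wt_half wt_mult_le) auto
  finally show ?thesis by (simp add: algebra_simps)
next
  case False
  then have F: "\<bar>i\<bar> \<le> 2 * \<bar>i - j\<bar>" by arith
  have "wt s j * wt t (i - j) = wt r (i - j) * (wt s j * wt (t - r) (i - j))"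
    using wt_add[of r "t - r" "i - j"] by simp
  also have "\<dots> \<le> (2 powr r * wt r i) * (wt (s + (t - r)) j + wt (s + (t - r)) (i - j))"
    using assms F by (intro mult_mono wt_half wt_mult_le) auto
  finally show ?thesis by (simp add: algebra_simps)
qed

text \<open>The case \<open>r = 0\<close> yields absolute convergence with a uniform bound;
  \<open>r > 0\<close> transfers a rate, provided that the exponent left over for the summation
  exceeds 1.\<close>

lemma dec_conv_aux:
  assumes f: "dec s f" and g: "dec t g" and r: "0 \<le> r" "r \<le> s" "r \<le> t" "s + t - r > 1"
  shows "\<exists>C. \<forall>i. conv_abs f g i \<and> (\<Sum>\<^sub>\<infinity>j. norm (f j) * norm (g (i - j))) \<le> C * wt r i"
proof -
  let ?u = "s + t - r"
  obtain C D where C: "C > 0" "\<And>k. norm (f k) \<le> C * wt s k" and D: "D > 0" "\<And>k. norm (g k) \<le> D * wt t k"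
    using decE[OF f] decE[OF g] by metis
  have W: "wt ?u summable_on UNIV" by (rule summable_on_wt[OF r(4)])
  have W': "(\<lambda>j. wt ?u (i - j)) summable_on UNIV" for i
    using summable_on_reindex_bij_betw[OF bij_diff_int[of i], of "wt ?u"] W by simp
  have IW': "(\<Sum>\<^sub>\<infinity>j. wt ?u (i - j)) = infsum (wt ?u) UNIV" for i
    using infsum_reindex_bij_betw[OF bij_diff_int[of i], of "wt ?u"] by simp
  define m where "m = (\<lambda>i j. (C * D * 2 powr r * wt r i) * (wt ?u j + wt ?u (i - j)))"
  have S: "m i summable_on UNIV" for i
    unfolding m_def by (intro summable_on_cmult_right summable_on_add W W')
  have I: "infsum (m i) UNIV = (C * D * 2 powr r * wt r i) * (2 * infsum (wt ?u) UNIV)" for i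
    unfolding m_def by (simp add: infsum_cmult_right' infsum_add[OF W W'] IW')
  have le: "norm (f j) * norm (g (i - j)) \<le> m i j" for i j
  proof -
    have "norm (f j) * norm (g (i - j)) \<le> (C * wt s j) * (D * wt t (i - j))"
      using C D by (intro mult_mono) auto
    also have "\<dots> = C * D * (wt s j * wt t (i - j))" by simp
    also have "\<dots> \<le> C * D * (2 powr r * wt r i * (wt ?u j + wt ?u (i - j)))"
      using C(1) D(1) by (intro mult_left_mono wt_conv_le r) auto
    finally show ?thesis by (simp add: m_def mult_ac)
  qed
  have c: "conv_abs f g i" for i
    unfolding conv_abs_def by (rule summable_on_comparison_test[OF S[of i]]) (use le in auto)
  have "(\<Sum>\<^sub>\<infinity>j. norm (f j) * norm (g (i - j))) \<le> infsum (m i) UNIV" for i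
    by (rule infsum_mono) (use c S le in \<open>auto simp: conv_abs_def\<close>)
  then have "(\<Sum>\<^sub>\<infinity>j. norm (f j) * norm (g (i - j))) \<le> (C * D * 2 powr r * (2 * infsum (wt ?u) UNIV)) * wt r i" for i
    unfolding I by (simp add: mult_ac)
  with c show ?thesis by blast
qed

lemma dec_conv:
  assumes "dec s f" "dec t g" "0 \<le> r" "r \<le> s" "r \<le> t" "s + t - r > 1"
  shows "dec r (f \<star> g)"
  using dec_conv_aux[OF assms] norm_conv_le order_trans unfolding dec_def by blast

lemma conv_bdd_dec:
  assumes "dec s f" "dec t g" "0 \<le> s" "0 \<le> t" "s + t > 1"
  shows "conv_bdd f g"
  using dec_conv_aux[of s f t g 0] assms unfolding conv_bdd_def by auto

text \<open>Reduces convolutions with one-sided support to sums over natural numbers with an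
  explicit majorant; \<open>h\<close> enumerates the contributing indices.\<close>

lemma conv_norm_le_majorant:
  assumes "conv_abs f g i" "inj_on h UNIV" "\<And>j. j \<notin> range h \<Longrightarrow> f j = 0 \<or> g (i - j) = 0"
    and "u summable_on (UNIV :: nat set)" "\<And>k. norm (f (h k)) * norm (g (i - h k)) \<le> u k"
  shows "norm ((f \<star> g) i) \<le> infsum u UNIV"
proof -
  have "norm ((f \<star> g) i) \<le> (\<Sum>\<^sub>\<infinity>j. norm (f j) * norm (g (i - j)))"
    by (rule norm_conv_le[OF assms(1)])
  also have "\<dots> = (\<Sum>\<^sub>\<infinity>j\<in>range h. norm (f j) * norm (g (i - j)))"
    by (rule infsum_cong_neutral) (use assms(3) in force)+
  also have "\<dots> = (\<Sum>\<^sub>\<infinity>k. norm (f (h k)) * norm (g (i - h k)))"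
    by (subst infsum_reindex[OF assms(2)]) (simp add: o_def)
  also have "\<dots> \<le> infsum u UNIV"
  proof (rule infsum_mono)
    show "(\<lambda>k. norm (f (h k)) * norm (g (i - h k))) summable_on UNIV"
      by (rule summable_on_comparison_test[OF assms(4)]) (use assms(5) in auto)
  qed (use assms in auto)
  finally show ?thesis .
qed

lemma conv_norm_le_support_ge:
  assumes "conv_abs f g i" "\<And>k. k < m \<Longrightarrow> g k = 0"
    and "u summable_on UNIV" "\<And>k. norm (f (i - m - int k)) * norm (g (m + int k)) \<le> u k"
  shows "norm ((f \<star> g) i) \<le> infsum u UNIV"
proof (rule conv_norm_le_majorant[where h = "\<lambda>k. i - m - int k"])
  fix j assume "j \<notin> range (\<lambda>k. i - m - int k)"
  moreover have "j = i - m - int (nat (i - m - j))" if "j \<le> i - m" using that by simp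
  ultimately have "\<not> j \<le> i - m" by blast
  then show "f j = 0 \<or> g (i - j) = 0" using assms(2)[of "i - j"] by simp
qed (use assms in \<open>auto simp: inj_on_def algebra_simps\<close>)

lemma conv_norm_le_support_le:
  assumes "conv_abs f g i" "\<And>k. k > m \<Longrightarrow> g k = 0"
    and "u summable_on UNIV" "\<And>k. norm (f (i - m + int k)) * norm (g (m - int k)) \<le> u k"
  shows "norm ((f \<star> g) i) \<le> infsum u UNIV"
proof (rule conv_norm_le_majorant[where h = "\<lambda>k. i - m + int k"])
  fix j assume "j \<notin> range (\<lambda>k. i - m + int k)"
  moreover have "j = i - m + int (nat (j - (i - m)))" if "j \<ge> i - m" using that by simp
  ultimately have "\<not> j \<ge> i - m" by blast
  then show "f j = 0 \<or> g (i - j) = 0" using assms(2)[of "i - j"] by simp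
qed (use assms in \<open>auto simp: inj_on_def algebra_simps\<close>)

text \<open>The rates of \<open>g\<close> and \<open>h\<close> do not make them summable. But
  \<open>j + k + m = l \<ge> 0\<close> with \<open>k, m \<le> 0\<close> forces \<open>|j|\<close> to
  be at least \<open>|k|\<close> and \<open>|m|\<close>, so decay of \<open>f\<close> can be lent to
  both.\<close>

lemma conv3_abs_dec:
  assumes f: "dec (1 + d) f" and g: "dec (1 - d) g" and h: "dec (1 / 2) h" and d: "0 < d" "d < 1 / 2"
    and l: "l \<ge> 0" and gs: "\<And>k. k > 0 \<Longrightarrow> g k = 0" and hs: "\<And>k. k > 0 \<Longrightarrow> h k = 0"
  shows "conv3_abs f g h l"
proof -
  obtain A B C where A: "A > 0" "\<And>k. norm (f k) \<le> A * wt (1 + d) k"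
    and B: "B > 0" "\<And>k. norm (g k) \<le> B * wt (1 - d) k" and C: "C > 0" "\<And>k. norm (h k) \<le> C * wt (1 / 2) k"
    using decE[OF f] decE[OF g] decE[OF h] by metis
  have w: "l1 (wt (5 / 4))" unfolding l1_def using summable_on_wt[of "5 / 4" UNIV] by simp
  have "conv3_abs (\<lambda>_. 1) (wt (5 / 4)) (wt (5 / 4)) l"
    by (intro conv3_absI_right conv_bddI2 w) (auto simp: bdd_def)
  then have S: "(\<lambda>(j, k). (A * B * C) * (wt (5 / 4) k * wt (5 / 4) (l - j - k))) summable_on UNIV"
    unfolding case_prod_unfold by (intro summable_on_cmult_right) (simp add: conv3_abs_def case_prod_unfold)
  have le: "norm (f j) * norm (g k) * norm (h (l - j - k)) \<le> (A * B * C) * (wt (5 / 4) k * wt (5 / 4) (l - j - k))" for j k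
  proof (cases "k \<le> 0 \<and> l - j - k \<le> 0")
    case True
    let ?m = "l - j - k"
    \<comment> \<open>The split of \<open>1 + d\<close> makes both exponents equal to
      \<open>5 / 4\<close>: \<open>(d + 1 / 4) + (1 - d)\<close> at \<open>k\<close> and
      \<open>3 / 4 + 1 / 2\<close> at \<open>?m\<close>.\<close>
    have "wt (1 + d) j = wt (d + 1 / 4) j * wt (3 / 4) j" by (simp flip: wt_add)
    also have "\<dots> \<le> wt (d + 1 / 4) k * wt (3 / 4) ?m"
      using True l d by (intro mult_mono wt_mono_abs) auto
    finally have w: "wt (1 + d) j \<le> wt (d + 1 / 4) k * wt (3 / 4) ?m" .
    have "norm (f j) * norm (g k) * norm (h ?m) \<le> (A * wt (1 + d) j) * (B * wt (1 - d) k) * (C * wt (1 / 2) ?m)"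
      using A B C by (intro mult_mono mult_nonneg_nonneg) auto
    also have "\<dots> \<le> (A * (wt (d + 1 / 4) k * wt (3 / 4) ?m)) * (B * wt (1 - d) k) * (C * wt (1 / 2) ?m)"
      using A(1) B(1) C(1) w by (intro mult_right_mono mult_left_mono) auto
    also have "\<dots> = (A * B * C) * (wt ((d + 1 / 4) + (1 - d)) k * wt (3 / 4 + 1 / 2) ?m)"
      unfolding wt_add by (simp add: mult_ac)
    finally show ?thesis by simp
  next
    case False
    then have "norm (f j) * norm (g k) * norm (h (l - j - k)) = 0" using gs hs by force
    then show ?thesis using A(1) B(1) C(1) by (auto intro!: mult_nonneg_nonneg)
  qed
  show ?thesis unfolding conv3_abs_def
    by (rule summable_on_comparison_test[OF S]) (use le in auto)
qed

lemma conv3_abs_reflect: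
  "conv3_abs (\<lambda>k. f (- k)) (\<lambda>k. g (- k)) (\<lambda>k. h (- k)) i \<longleftrightarrow> conv3_abs f g h (- i)"
proof -
  have bij: "bij (\<lambda>(j, k). (- j :: int, - k :: int))"
    by (rule bij_betw_byWitness[where f' = "\<lambda>(j, k). (- j, - k)"]) auto
  show ?thesis
    unfolding conv3_abs_def
    using summable_on_reindex_bij_betw[OF bij, of "\<lambda>(j, k). norm (f j) * norm (g k) * norm (h (- i - j - k))"]
    by (simp add: case_prod_unfold algebra_simps)
qed

lemma conv_reflect: "((\<lambda>k. f (- k)) \<star> (\<lambda>k. g (- k))) i = (f \<star> g) (- i)"
  unfolding conv_def
  using infsum_reindex_bij_betw[OF bij_uminus, of "\<lambda>j. f j * g (- i - j)"] by (simp add: minus_diff_commute)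

lemma dec_reflect: "dec s (\<lambda>k. f (- k)) \<longleftrightarrow> dec s f"
  unfolding dec_def by (metis minus_minus wt_minus)

text \<open>The decay of \<open>f\<close> gains from the separation of the supports of \<open>f (l - \<cdot>)\<close> and \<open>r\<close>.\<close>

lemma conv_separated_decay:
  assumes f: "dec (1 + d) f" and r: "dec s r" and d: "0 < d" and s: "1 / 2 + d + s > 1" "s \<ge> 0"
    and rs: "\<And>k. k > 0 \<Longrightarrow> r k = 0"
  shows "\<exists>C. \<forall>l\<ge>0. norm ((f \<star> r) l) \<le> C * wt (1 / 2) l"
proof -
  obtain A B where A: "A > 0" "\<And>k. norm (f k) \<le> A * wt (1 + d) k" and B: "B > 0" "\<And>k. norm (r k) \<le> B * wt s k"
    using decE[OF f] decE[OF r] by metis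
  let ?u = "1 / 2 + d + s"
  have W: "wt ?u summable_on {..0}" by (rule summable_on_wt[OF s(1)])
  have "norm ((f \<star> r) l) \<le> (A * B * infsum (wt ?u) {..0}) * wt (1 / 2) l" if l: "l \<ge> 0" for l
  proof -
    have "norm ((f \<star> r) l) \<le> (\<Sum>\<^sub>\<infinity>k. (A * B * wt (1 / 2) l) * wt ?u (0 - int k))"
    proof (rule conv_norm_le_support_le[where m = 0])
      show "conv_abs f r l"
        using conv_bdd_abs[OF conv_bdd_dec[OF f r]] d s by simp
      show "(\<lambda>k. (A * B * wt (1 / 2) l) * wt ?u (0 - int k)) summable_on UNIV"
        by (rule summable_on_cmult_right) (use W in \<open>simp only: summable_on_int_le\<close>)
      fix k :: nat
      \<comment> \<open>Half a power is kept for the rate in \<open>l\<close>; the remaining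
        \<open>1 / 2 + d\<close> joins the rate of \<open>r\<close> to give a summable
        exponent.\<close>
      have "wt (1 + d) (l + int k) = wt (1 / 2) (l + int k) * wt (1 / 2 + d) (l + int k)"
        by (simp flip: wt_add)
      also have "\<dots> \<le> wt (1 / 2) l * wt (1 / 2 + d) (- int k)"
        using l d by (intro mult_mono wt_mono_abs) auto
      finally have w: "wt (1 + d) (l + int k) \<le> wt (1 / 2) l * wt (1 / 2 + d) (- int k)" .
      have "norm (f (l + int k)) * norm (r (- int k)) \<le> (A * wt (1 + d) (l + int k)) * (B * wt s (- int k))"
        using A B B(2)[of "- int k"] by (intro mult_mono) auto
      also have "\<dots> \<le> (A * (wt (1 / 2) l * wt (1 / 2 + d) (- int k))) * (B * wt s (- int k))"
        using A(1) B(1) w by (intro mult_right_mono mult_left_mono) auto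
      also have "\<dots> = (A * B * wt (1 / 2) l) * wt ?u (- int k)" unfolding wt_add by (simp add: mult_ac)
      finally show "norm (f (l - 0 + int k)) * norm (r (0 - int k)) \<le> (A * B * wt (1 / 2) l) * wt ?u (0 - int k)"
        by simp
    qed (use rs in auto)
    also have "\<dots> = (A * B * infsum (wt ?u) {..0}) * wt (1 / 2) l"
      by (simp add: infsum_cmult_right' infsum_int_le mult_ac)
    finally show ?thesis .
  qed
  then show ?thesis by blast
qed

section \<open>Toeplitz systems with two factorizations of the symbol\<close>

text \<open>In terms of generating series: \<open>c\<close> and \<open>e\<close> stand for the outer factors \<open>h\<close> and \<open>h\<^sub>\<sharp>\<close>, \<open>a\<close> and
  \<open>b\<close> for \<open>- 1 / h\<close> and \<open>- 1 / h\<^sub>\<sharp>\<close>, and \<open>a \<star> star e\<close> for the phase function \<open>- h\<^sup>-\<^sup>1 h\<^sub>\<sharp>\<^sup>*\<close>.\<close>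

locale toeplitz_factors =
  fixes d :: real and a b c e \<gamma> :: "int \<Rightarrow> 'a::cstar_algebra"
  assumes d: "0 < d" "d < 1 / 2"
    and causal: "\<And>k. k < 0 \<Longrightarrow> a k = 0" "\<And>k. k < 0 \<Longrightarrow> b k = 0"
      "\<And>k. k < 0 \<Longrightarrow> c k = 0" "\<And>k. k < 0 \<Longrightarrow> e k = 0"
    and decay: "dec (1 + d) a" "dec (1 + d) b" "dec (1 - d) c" "dec (1 - d) e"
    and inverse_ca: "c \<star> a = delta 0 (- 1)" and inverse_ac: "a \<star> c = delta 0 (- 1)"
    and inverse_eb: "e \<star> b = delta 0 (- 1)" and inverse_be: "b \<star> e = delta 0 (- 1)"
    and symbol_c: "\<gamma> = c \<star> star c" and symbol_e: "\<gamma> = star e \<star> e"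
    and phase: "\<exists>\<theta><1. \<exists>N. \<forall>j\<ge>N. pi * of_int j * norm ((a \<star> star e) j) \<le> \<theta>"
begin

lemma l1_ab: "l1 a" "l1 b"
  using decay d by (auto intro: l1_dec)

lemma bdd_ce: "bdd c" "bdd e"
  using decay d by (auto intro: bdd_dec)

lemma conv_bdd_cc: "conv_bdd c (star c)" and conv_bdd_ee: "conv_bdd (star e) e"
  using conv_bdd_dec[OF decay(3), of "1 - d" "star c"] conv_bdd_dec[of "1 - d" "star e", OF _ decay(4)] decay d
  by simp_all

lemma bdd_\<gamma>: "bdd \<gamma>"
  unfolding symbol_c by (rule bdd_conv[OF conv_bdd_cc])

lemma dec_\<gamma>:
  assumes "0 \<le> s" "s < 1 - 2 * d"
  shows "dec s \<gamma>"
  unfolding symbol_c by (rule dec_conv[of "1 - d" _ "1 - d"]) (use decay assms d in auto)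

lemma delta_0_conv:
  fixes f :: "int \<Rightarrow> 'a"
  shows "delta 0 (- 1) \<star> f = (\<lambda>k. - f k)" "f \<star> delta 0 (- 1) = (\<lambda>k. - f k)"
  by (simp_all add: fun_eq_iff conv_delta_left conv_delta_right)

lemma star_delta_0: "star (delta 0 (- 1)) = delta 0 (- 1 :: 'a)"
  by (auto simp: fun_eq_iff star_def delta_def)

lemma star_inverses:
  "star a \<star> star c = delta 0 (- 1)" "star c \<star> star a = delta 0 (- 1)"
  "star b \<star> star e = delta 0 (- 1)" "star e \<star> star b = delta 0 (- 1)"
  using star_conv[OF conv_bdd_abs[OF conv_bddI2[OF bdd_ce(1) l1_ab(1)]]] inverse_ca
    star_conv[OF conv_bdd_abs[OF conv_bddI1[OF l1_ab(1) bdd_ce(1)]]] inverse_ac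
    star_conv[OF conv_bdd_abs[OF conv_bddI2[OF bdd_ce(2) l1_ab(2)]]] inverse_eb
    star_conv[OF conv_bdd_abs[OF conv_bddI1[OF l1_ab(2) bdd_ce(2)]]] inverse_be
  by (simp_all add: star_delta_0 fun_eq_iff)

text \<open>With \<open>H\<close> for the adjoint of \<open>h\<close> on the circle this is
  \<open>- h^(-1) h H = - H\<close>. The next three identities cancel a factor likewise, at the
  other side or in the other factorization.\<close>

lemma a_\<gamma>: "a \<star> \<gamma> = (\<lambda>k. - star c k)"
proof
  fix i
  show "(a \<star> \<gamma>) i = - star c i"
    using conv_assoc[OF conv3_absI_left[OF l1_ab(1) conv_bdd_cc], of i]
    by (simp add: symbol_c inverse_ac delta_0_conv)
qed

lemma \<gamma>_star_a: "\<gamma> \<star> star a = (\<lambda>k. - c k)"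
proof
  fix i
  show "(\<gamma> \<star> star a) i = - c i"
    using conv_assoc[OF conv3_absI_right[OF conv_bdd_cc], of "star a" i] l1_ab
    by (simp add: symbol_c star_inverses delta_0_conv)
qed

lemma star_b_\<gamma>: "star b \<star> \<gamma> = (\<lambda>k. - e k)"
proof
  fix i
  show "(star b \<star> \<gamma>) i = - e i"
    using conv_assoc[OF conv3_absI_left[OF _ conv_bdd_ee], of "star b" i] l1_ab
    by (simp add: symbol_e star_inverses delta_0_conv)
qed

lemma \<gamma>_b: "\<gamma> \<star> b = (\<lambda>k. - star e k)"
proof
  fix i
  show "(\<gamma> \<star> b) i = - star e i"
    using conv_assoc[OF conv3_absI_right[OF conv_bdd_ee l1_ab(2)], of i]
    by (simp add: symbol_e inverse_eb delta_0_conv)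
qed

text \<open>Coefficients of the inverse symbol, hence of the inverse of the bi-infinite Toeplitz
  matrix; they are summable, which \<open>\<gamma>\<close> need not be.\<close>

definition \<omega> :: "int \<Rightarrow> 'a" where "\<omega> = star a \<star> a"

lemma l1_\<omega>: "l1 \<omega>"
  unfolding \<omega>_def by (rule l1_conv) (use l1_ab in auto)

lemma \<omega>_\<gamma>: "\<omega> \<star> \<gamma> = delta 0 1"
proof
  fix i
  have "(\<omega> \<star> \<gamma>) i = (star a \<star> (\<lambda>k. - star c k)) i"
    unfolding \<omega>_def a_\<gamma>[symmetric]
    by (rule conv_assoc[OF conv3_absI_left]) (use l1_ab conv_bddI1[OF l1_ab(1) bdd_\<gamma>] in auto)
  then show "(\<omega> \<star> \<gamma>) i = delta 0 1 i"
    by (simp add: conv_minus_right star_inverses delta_def)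
qed

text \<open>A left and a right inverse of \<open>\<gamma>\<close> coincide. Both factorizations of
  \<open>\<omega>\<close> are used later, one for each end of the interval.\<close>

lemma \<omega>_eq: "\<omega> = b \<star> star b"
proof
  fix i
  have 1: "\<gamma> \<star> (b \<star> star b) = delta 0 1"
  proof
    fix i
    have "(\<gamma> \<star> (b \<star> star b)) i = ((\<lambda>k. - star e k) \<star> star b) i"
      unfolding \<gamma>_b[symmetric]
      by (rule conv_assoc[OF conv3_absI_right, symmetric]) (use l1_ab conv_bddI2[OF bdd_\<gamma> l1_ab(2)] in auto)
    then show "(\<gamma> \<star> (b \<star> star b)) i = delta 0 1 i"
      by (simp add: conv_minus_left star_inverses delta_def)
  qed
  have l: "l1 (b \<star> star b)" by (rule l1_conv) (use l1_ab in auto)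
  have "(\<omega> \<star> \<gamma> \<star> (b \<star> star b)) i = (\<omega> \<star> (\<gamma> \<star> (b \<star> star b))) i"
    by (rule conv_assoc[OF conv3_absI_left[OF l1_\<omega> conv_bddI2[OF bdd_\<gamma> l]]])
  then show "\<omega> i = (b \<star> star b) i"
    by (simp add: 1 \<omega>_\<gamma> conv_delta_left conv_delta_right)
qed

definition \<beta> :: "int \<Rightarrow> 'a" where "\<beta> = a \<star> star e"

text \<open>A crude rate that secures convergence; the contraction rests on the sharper assumption
  \<open>phase\<close>.\<close>

lemma dec_\<beta>: "dec (1 - d) \<beta>"
  unfolding \<beta>_def by (rule dec_conv[of "1 + d" _ "1 - d"]) (use decay d in auto)

text \<open>Bracketing \<open>star b \<star> \<gamma> \<star> star a\<close> in two ways gives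
  \<open>e \<star> star a = star b \<star> c\<close>, so the phase function has one expression
  suited to each end of the interval.\<close>

lemma star_\<beta>: "star \<beta> = star b \<star> c"
proof
  fix i
  have 1: "star \<beta> i = (e \<star> star a) i"
    unfolding \<beta>_def using star_conv[OF conv_bdd_abs[OF conv_bddI1[OF l1_ab(1)]], of "star e" i] bdd_ce by simp
  have "(star b \<star> \<gamma> \<star> star a) i = (star b \<star> (\<gamma> \<star> star a)) i"
    by (rule conv_assoc[OF conv3_absI_left[OF _ conv_bddI2[OF bdd_\<gamma>]]]) (use l1_ab in auto)
  then show "star \<beta> i = (star b \<star> c) i"
    by (simp add: star_b_\<gamma> \<gamma>_star_a conv_minus_left conv_minus_right 1)
qed

text \<open>Blocks of the inverse of the semi-infinite Toeplitz matrix of \<open>\<gamma>\<close>: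
  the lower triangular Toeplitz matrix of \<open>b\<close> times its adjoint. By causality the sum
  may run up to \<open>s\<close> instead of the minimum of \<open>s\<close> and
  \<open>t\<close>.\<close>

definition X :: "int \<Rightarrow> int \<Rightarrow> 'a" where
  "X s t = (\<Sum>l\<in>{1..s}. b (s - l) * adj (b (t - l)))"

text \<open>The part of \<open>star b \<star> delta t \<eta>\<close> that the half line cuts off;
  \<open>b \<star> \<zeta> t \<eta>\<close> is the gap between the bi-infinite and the semi-infinite
  inverse.\<close>

definition \<zeta> :: "int \<Rightarrow> 'a \<Rightarrow> int \<Rightarrow> 'a" where
  "\<zeta> t \<eta> p = (if p \<le> 0 then adj (b (t - p)) * \<eta> else 0)"

lemma star_b_delta: "(star b \<star> delta t \<eta>) p = adj (b (t - p)) * \<eta>"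
  by (simp add: conv_delta_right star_def)

lemma dec_\<zeta>: "dec (1 + d) (\<zeta> t \<eta>)"
proof -
  have "dec (1 + d) (star b \<star> delta t \<eta>)"
    by (rule dec_conv[of "1 + d" _ "1 + d"]) (use decay d in \<open>auto intro!: dec_finite_support simp: delta_def\<close>)
  from dec_restrict[OF this, of "\<lambda>p. p \<le> 0"] show ?thesis
    unfolding \<zeta>_def[abs_def] star_b_delta .
qed

lemma \<omega>_split:
  assumes "s \<ge> 0"
  shows "\<omega> (s - t) * \<eta> = X s t * \<eta> + (b \<star> \<zeta> t \<eta>) s"
proof -
  define Z where "Z = (\<lambda>p. if p > 0 then adj (b (t - p)) * \<eta> else 0)"
  have ld: "l1 (star b \<star> delta t \<eta>)" by (intro l1_conv) (use l1_ab in auto)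
  have lz: "l1 (\<zeta> t \<eta>)" using l1_dec[OF dec_\<zeta>] d by simp
  have lZ: "l1 Z"
    unfolding l1_def
    by (rule summable_on_comparison_test[OF ld[unfolded l1_def]]) (auto simp: Z_def star_b_delta)
  have "\<omega> (s - t) * \<eta> = (\<omega> \<star> delta t \<eta>) s" by (simp add: conv_delta_right)
  also have "\<dots> = (b \<star> (star b \<star> delta t \<eta>)) s"
    unfolding \<omega>_eq by (rule conv_assoc[OF conv3_absI_left[OF l1_ab(2) conv_bddI1]])
      (use l1_ab l1_bdd[OF l1_delta] in auto)
  also have "star b \<star> delta t \<eta> = (\<lambda>p. Z p + \<zeta> t \<eta> p)"
    by (auto simp: fun_eq_iff star_b_delta Z_def \<zeta>_def)
  also have "(b \<star> (\<lambda>p. Z p + \<zeta> t \<eta> p)) s = (b \<star> Z) s + (b \<star> \<zeta> t \<eta>) s"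
    by (rule conv_add_right) (use conv_bdd_abs[OF conv_bddI1[OF l1_ab(2)]] l1_bdd[OF lZ] l1_bdd[OF lz] in auto)
  also have "(b \<star> Z) s = (\<Sum>l\<in>{0..s - 1}. b l * Z (s - l))"
  proof -
    have "(b \<star> Z) s = infsum (\<lambda>l. b l * Z (s - l)) {0..s - 1}"
      unfolding conv_def by (rule infsum_cong_neutral) (use causal(2) in \<open>force simp: Z_def\<close>)+
    then show ?thesis by simp
  qed
  also have "\<dots> = (\<Sum>l\<in>{1..s}. b (s - l) * (adj (b (t - l)) * \<eta>))"
    by (rule sum.reindex_bij_witness[where i = "\<lambda>l. s - l" and j = "\<lambda>l. s - l"]) (auto simp: Z_def)
  also have "\<dots> = X s t * \<eta>" by (simp add: X_def sum_distrib_right mult.assoc)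
  finally show ?thesis .
qed

lemma conv_eq_0: "(\<And>j. f j = 0 \<or> g (i - j) = 0) \<Longrightarrow> (f \<star> g) i = 0"
  unfolding conv_def by (rule infsum_0) (metis mult_zero_left mult_zero_right)

lemma finite_support_interval: "(\<And>k. k \<notin> {1..n::int} \<Longrightarrow> f k = 0) \<Longrightarrow> finite {k. f k \<noteq> 0}"
  by (rule finite_subset[of _ "{1..n}"]) (blast, simp)

proposition column_representation:
  fixes x :: "int \<Rightarrow> 'a" and n t :: int
  assumes n: "n \<ge> 0" and t: "1 \<le> t" "t \<le> n" and x: "\<And>k. k \<notin> {1..n} \<Longrightarrow> x k = 0"
    and eq: "\<And>s. s \<in> {1..n} \<Longrightarrow> (\<gamma> \<star> x) s = (if s = t then \<eta> else 0)"
  obtains \<phi> \<psi> where "\<And>l. l \<le> n \<Longrightarrow> \<phi> l = 0" "\<And>p. p > 0 \<Longrightarrow> \<psi> p = 0"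
    "dec (1 / 2) \<phi>" "dec (1 / 2) \<psi>"
    "\<And>l. l > n \<Longrightarrow> \<phi> l = - (a (l - t) * \<eta>) - (\<beta> \<star> \<zeta> t \<eta>) l + (\<beta> \<star> \<psi>) l"
    "\<And>p. p \<le> 0 \<Longrightarrow> \<psi> p = (star \<beta> \<star> \<phi>) p"
    "\<And>s. s \<ge> 1 \<Longrightarrow> x s = X s t * \<eta> + (star a \<star> \<phi>) s + (b \<star> \<psi>) s"
proof -
  define z where "z = \<gamma> \<star> x"
  define rm where "rm = (\<lambda>k. if k \<le> 0 then z k else 0)"
  define rp where "rp = (\<lambda>k. if k > n then z k else 0)"
  \<comment> \<open>The right remainder is divided by \<open>h\<close>, the left one by the adjoint
    of the other factor: each inverse is one-sided in the direction that preserves the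
    support.\<close>
  define \<phi> where "\<phi> = a \<star> rp"
  define \<psi>\<^sub>0 where "\<psi>\<^sub>0 = star b \<star> rm"
  \<comment> \<open>Adding \<open>\<zeta>\<close> makes the equation for \<open>\<psi>\<close>
    homogeneous, so that all source terms enter the equation for \<open>\<phi>\<close>; it also
    absorbs the gap between \<open>\<omega>\<close> and \<open>X\<close>.\<close>
  define \<psi> where "\<psi> = (\<lambda>p. \<psi>\<^sub>0 p + \<zeta> t \<eta> p)"
  have fx: "finite {k. x k \<noteq> 0}" using finite_support_interval[OF x] .
  then have lx: "l1 x" by (rule l1_finite_support)
  \<comment> \<open>\<open>\<gamma>\<close> has every rate below \<open>1 - 2 * d\<close>, and
    \<open>conv_separated_decay\<close> asks for more than half of that; three quarters lies in
    between.\<close>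
  define s\<^sub>0 where "s\<^sub>0 = 3 / 4 * (1 - 2 * d)"
  have s0: "0 \<le> s\<^sub>0" "s\<^sub>0 < 1 - 2 * d" "1 / 2 + d + s\<^sub>0 > 1" using d by (auto simp: s\<^sub>0_def field_simps)
  have dz: "dec s\<^sub>0 z"
    unfolding z_def
    by (rule dec_conv[of s\<^sub>0 _ 4]) (use s0 d dec_\<gamma> in \<open>auto intro: dec_finite_support[OF fx]\<close>)
  have drm: "dec s\<^sub>0 rm" and drp: "dec s\<^sub>0 rp"
    unfolding rm_def rp_def by (rule dec_restrict[OF dz])+
  have brm: "bdd rm" and brp: "bdd rp" using bdd_dec[OF drm s0(1)] bdd_dec[OF drp s0(1)] by auto
  have z_split: "z = (\<lambda>k. rm k + (delta t \<eta> k + rp k))"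
    using eq t by (auto simp: fun_eq_iff rm_def rp_def delta_def z_def)
  have bdrp: "bdd (\<lambda>k. delta t \<eta> k + rp k)"
    by (rule bdd_dec[OF dec_add[OF _ drp]]) (use s0 in \<open>auto intro: dec_finite_support simp: delta_def\<close>)
  have conv_z: "(f \<star> z) i = (f \<star> rm) i + f (i - t) * \<eta> + (f \<star> rp) i" if "l1 f" for f i
  proof -
    have "(f \<star> z) i = (f \<star> rm) i + (f \<star> (\<lambda>k. delta t \<eta> k + rp k)) i"
      unfolding z_split
      by (rule conv_add_right) (use conv_bdd_abs[OF conv_bddI1[OF that]] brm bdrp in auto)
    also have "(f \<star> (\<lambda>k. delta t \<eta> k + rp k)) i = f (i - t) * \<eta> + (f \<star> rp) i"
      by (subst conv_add_right) (use conv_bdd_abs[OF conv_bddI1[OF that]] brp l1_bdd[OF l1_delta] in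
          \<open>auto simp: conv_delta_right\<close>)
    finally show ?thesis by (simp add: add.assoc)
  qed
  have \<phi>_supp: "\<phi> l = 0" if "l \<le> n" for l
    unfolding \<phi>_def
  proof (rule conv_eq_0)
    show "a j = 0 \<or> rp (l - j) = 0" for j using causal(1)[of j] that by (cases "j < 0") (auto simp: rp_def)
  qed
  have \<psi>0_supp: "\<psi>\<^sub>0 p = 0" if "p > 0" for p
    unfolding \<psi>\<^sub>0_def
  proof (rule conv_eq_0)
    show "star b j = 0 \<or> rm (p - j) = 0" for j
      using causal(2)[of "- j"] that by (cases "j > 0") (auto simp: rm_def star_def)
  qed
  have \<phi>_eq: "\<phi> l = - (a (l - t) * \<eta>) - (a \<star> rm) l" if l: "l > n" for l
  proof -
    have "(a \<star> z) l = (a \<star> \<gamma> \<star> x) l"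
      unfolding z_def by (rule conv_assoc[OF conv3_absI_left[OF l1_ab(1) conv_bddI2[OF bdd_\<gamma> lx]], symmetric])
    also have "\<dots> = - (star c \<star> x) l" by (simp add: a_\<gamma> conv_minus_left)
    \<comment> \<open>\<open>star c\<close> lives on nonpositive indices, so the value at
      \<open>l\<close> involves \<open>x\<close> only at indices at least
      \<open>l > n\<close>.\<close>
    also have "(star c \<star> x) l = 0"
    proof (rule conv_eq_0)
      show "star c j = 0 \<or> x (l - j) = 0" for j
        using causal(3)[of "- j"] l x[of "l - j"] by (cases "j > 0") (auto simp: star_def)
    qed
    finally have "(a \<star> z) l = 0" by simp
    then show ?thesis unfolding conv_z[OF l1_ab(1)] \<phi>_def by (simp add: algebra_simps eq_neg_iff_add_eq_0)
  qed
  have \<psi>_eq: "\<psi> p = - (star b \<star> rp) p" if p: "p \<le> 0" for p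
  proof -
    have "(star b \<star> z) p = (star b \<star> \<gamma> \<star> x) p"
      unfolding z_def
      by (rule conv_assoc[OF conv3_absI_left[OF _ conv_bddI2[OF bdd_\<gamma> lx]], symmetric]) (use l1_ab in simp)
    also have "\<dots> = - (e \<star> x) p" by (simp add: star_b_\<gamma> conv_minus_left)
    also have "(e \<star> x) p = 0"
    proof (rule conv_eq_0)
      show "e j = 0 \<or> x (p - j) = 0" for j
        using causal(4)[of j] p x[of "p - j"] by (cases "j < 0") auto
    qed
    finally have "(star b \<star> z) p = 0" by simp
    moreover have "l1 (star b)" using l1_ab by simp
    ultimately show ?thesis
      using p unfolding \<psi>_def \<psi>\<^sub>0_def \<zeta>_def by (simp add: conv_z star_def eq_neg_iff_add_eq_0)
  qed
  have \<psi>_supp: "\<psi> p = 0" if "p > 0" for p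
    using that \<psi>0_supp by (simp add: \<psi>_def \<zeta>_def)
  \<comment> \<open>The definition of \<open>\<phi>\<close> would give only the rate
    \<open>s\<^sub>0\<close> of \<open>rp\<close>, possibly below \<open>1 / 2\<close>. In
    \<open>\<phi>_eq\<close> the support of \<open>rm\<close> is separated from
    \<open>l > n\<close>, which improves the rate.\<close>
  have d\<phi>: "dec (1 / 2) \<phi>"
  proof -
    obtain C where C: "\<And>l. l \<ge> 0 \<Longrightarrow> norm ((a \<star> rm) l) \<le> C * wt (1 / 2) l"
      using conv_separated_decay[OF decay(1) drm d(1) s0(3) s0(1)] by (auto simp: rm_def)
    have "dec (1 / 2) (a \<star> delta t \<eta>)"
      by (rule dec_mono[of "1 + d"], rule dec_conv[of "1 + d" _ "1 + d"])
        (use decay d in \<open>auto intro!: dec_finite_support simp: delta_def\<close>)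
    then obtain D where D: "D > 0" "\<And>l. norm (a (l - t) * \<eta>) \<le> D * wt (1 / 2) l"
      using decE[of "1 / 2" "a \<star> delta t \<eta>"] unfolding conv_delta_right by metis
    have C0: "C \<ge> 0" using C[of 0] order_trans[OF norm_ge_zero] by fastforce
    have "norm (\<phi> l) \<le> (D + C) * wt (1 / 2) l" for l
    proof (cases "l > n")
      case True
      have "norm (\<phi> l) \<le> norm (a (l - t) * \<eta>) + norm ((a \<star> rm) l)"
        unfolding \<phi>_eq[OF True] by (rule order_trans[OF norm_triangle_ineq4]) simp
      also have "\<dots> \<le> (D + C) * wt (1 / 2) l"
        using D(2)[of l] C[of l] True n by (simp add: distrib_right)
      finally show ?thesis .
    qed (use \<phi>_supp D C0 in auto)
    then show ?thesis by (auto simp: dec_def)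
  qed
  have d\<psi>: "dec (1 / 2) \<psi>"
  proof -
    have "dec (1 + d) (\<lambda>k. star b (- k))" "dec s\<^sub>0 (\<lambda>k. rp (- k))"
      unfolding dec_reflect using decay drp by simp_all
    from conv_separated_decay[OF this d(1) s0(3) s0(1)]
    obtain C where C: "\<And>l. l \<ge> 0 \<Longrightarrow> norm (((\<lambda>k. star b (- k)) \<star> (\<lambda>k. rp (- k))) l) \<le> C * wt (1 / 2) l"
      using n by (auto simp: rp_def)
    have C0: "C \<ge> 0" using C[of 0] order_trans[OF norm_ge_zero] by fastforce
    have "norm (\<psi> p) \<le> C * wt (1 / 2) p" for p
    proof (cases "p \<le> 0")
      case True
      then show ?thesis using C[of "- p"] \<psi>_eq[OF True] by (simp add: conv_reflect)
    qed (use \<psi>_supp C0 in auto)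
    then show ?thesis by (auto simp: dec_def)
  qed
  have d\<zeta>: "dec (1 / 2) (\<zeta> t \<eta>)" by (rule dec_mono[OF dec_\<zeta>]) (use d in simp)
  have d\<psi>0: "dec (1 / 2) \<psi>\<^sub>0"
  proof -
    have "\<psi>\<^sub>0 = (\<lambda>p. \<psi> p + - \<zeta> t \<eta> p)" by (simp add: \<psi>_def)
    then show ?thesis using dec_add[OF d\<psi>, of "\<lambda>p. - \<zeta> t \<eta> p"] d\<zeta> by simp
  qed
  \<comment> \<open>Multiplying back by the outer factor recovers the remainder. All three sequences
    live on nonpositive indices, so the triple sums are finite.\<close>
  have rm_eq: "rm = (\<lambda>k. - (star e \<star> \<psi>\<^sub>0) k)"
  proof
    fix i
    have "(star e \<star> star b \<star> rm) i = (star e \<star> \<psi>\<^sub>0) i"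
      unfolding \<psi>\<^sub>0_def
    proof (rule conv_assoc[OF conv3_absI_finite])
      show "finite ({i..0} \<times> {i..0})" by simp
      fix j k assume "(j, k) \<notin> {i..0} \<times> {i..0}"
      then show "star e j = 0 \<or> star b k = 0 \<or> rm (i - j - k) = 0"
        using causal(4)[of "- j"] causal(2)[of "- k"]
        by (cases "j > 0"; cases "k > 0") (auto simp: star_def rm_def)
    qed
    then have "- rm i = (star e \<star> \<psi>\<^sub>0) i" by (simp add: star_inverses delta_0_conv)
    then show "rm i = - (star e \<star> \<psi>\<^sub>0) i" by (metis minus_minus)
  qed
  have rp_eq: "rp = (\<lambda>k. - (c \<star> \<phi>) k)"
  proof
    fix i
    have "(c \<star> a \<star> rp) i = (c \<star> \<phi>) i"
      unfolding \<phi>_def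
    proof (rule conv_assoc[OF conv3_absI_finite])
      show "finite ({0..i} \<times> {0..i})" by simp
      fix j k assume "(j, k) \<notin> {0..i} \<times> {0..i}"
      then show "c j = 0 \<or> a k = 0 \<or> rp (i - j - k) = 0"
        using causal(3)[of j] causal(1)[of k] n
        by (cases "j < 0"; cases "k < 0") (auto simp: rp_def)
    qed
    then have "- rp i = (c \<star> \<phi>) i" by (simp add: inverse_ca delta_0_conv)
    then show "rp i = - (c \<star> \<phi>) i" by (metis minus_minus)
  qed
  show thesis
  proof (rule that[of \<phi> \<psi>])
    fix l assume l: "l > n"
    \<comment> \<open>Two of these sequences need not be summable; the brackets can be moved because
      \<open>l\<close> lies to the right of their supports.\<close>
    have "conv3_abs a (star e) \<psi>\<^sub>0 l"
      by (rule conv3_abs_dec[where d = d])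
        (use decay d d\<psi>0 l n \<psi>0_supp causal(4) in \<open>auto simp: star_def[of e]\<close>)
    then have "(a \<star> rm) l = - (\<beta> \<star> \<psi>\<^sub>0) l"
      unfolding rm_eq \<beta>_def by (simp add: conv_minus_right conv_assoc)
    moreover have "(\<beta> \<star> \<psi>) l = (\<beta> \<star> \<psi>\<^sub>0) l + (\<beta> \<star> \<zeta> t \<eta>) l"
      unfolding \<psi>_def
      by (rule conv_add_right; rule conv_bdd_abs[OF conv_bdd_dec[OF dec_\<beta>]]) (use d\<psi>0 d\<zeta> d in auto)
    ultimately show "\<phi> l = - (a (l - t) * \<eta>) - (\<beta> \<star> \<zeta> t \<eta>) l + (\<beta> \<star> \<psi>) l"
      using \<phi>_eq[OF l] by simp
  next
    fix p :: int assume p: "p \<le> 0"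
    have "conv3_abs (\<lambda>k. star b (- k)) (\<lambda>k. c (- k)) (\<lambda>k. \<phi> (- k)) (- p)"
      by (rule conv3_abs_dec[where d = d])
        (use decay d d\<phi> p n \<phi>_supp causal(3) in \<open>auto simp: dec_reflect\<close>)
    then have "conv3_abs (star b) c \<phi> p" by (simp add: conv3_abs_reflect)
    then show "\<psi> p = (star \<beta> \<star> \<phi>) p"
      using \<psi>_eq[OF p] unfolding rp_eq star_\<beta> by (simp add: conv_minus_right conv_assoc)
  next
    fix s :: int assume s: "s \<ge> 1"
    have "x s = (\<omega> \<star> \<gamma> \<star> x) s" by (simp add: \<omega>_\<gamma> conv_delta_left)
    also have "\<dots> = (\<omega> \<star> z) s"
      unfolding z_def by (rule conv_assoc[OF conv3_absI_left[OF l1_\<omega> conv_bddI2[OF bdd_\<gamma> lx]]])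
    also have "\<dots> = (\<omega> \<star> rm) s + \<omega> (s - t) * \<eta> + (\<omega> \<star> rp) s" by (rule conv_z[OF l1_\<omega>])
    \<comment> \<open>For each remainder that factorization of \<open>\<omega>\<close> is taken
      whose right factor turns it into \<open>\<psi>\<^sub>0\<close> or
      \<open>\<phi>\<close>.\<close>
    also have "(\<omega> \<star> rm) s = (b \<star> \<psi>\<^sub>0) s"
      unfolding \<omega>_eq \<psi>\<^sub>0_def
      by (rule conv_assoc[OF conv3_absI_left[OF l1_ab(2) conv_bddI1]]) (use l1_ab brm in auto)
    also have "(\<omega> \<star> rp) s = (star a \<star> \<phi>) s"
      unfolding \<omega>_def \<phi>_def
      by (rule conv_assoc[OF conv3_absI_left[OF _ conv_bddI1]]) (use l1_ab brp in auto)
    also have "\<omega> (s - t) * \<eta> = X s t * \<eta> + (b \<star> \<zeta> t \<eta>) s" by (rule \<omega>_split) (use s in simp)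
    also have "(b \<star> \<psi>\<^sub>0) s + (X s t * \<eta> + (b \<star> \<zeta> t \<eta>) s) + (star a \<star> \<phi>) s
        = X s t * \<eta> + (star a \<star> \<phi>) s + ((b \<star> \<psi>\<^sub>0) s + (b \<star> \<zeta> t \<eta>) s)" by (simp add: algebra_simps)
    also have "(b \<star> \<psi>\<^sub>0) s + (b \<star> \<zeta> t \<eta>) s = (b \<star> \<psi>) s"
      unfolding \<psi>_def
      by (rule conv_add_right[symmetric]; rule conv_bdd_abs[OF conv_bddI1[OF l1_ab(2)]])
        (use bdd_dec[OF d\<psi>0] bdd_dec[OF d\<zeta>] in auto)
    finally show "x s = X s t * \<eta> + (star a \<star> \<phi>) s + (b \<star> \<psi>) s" .
  qed (use \<phi>_supp \<psi>_supp d\<phi> d\<psi> in auto)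
qed

end

section \<open>Uniform estimate of a single column\<close>

context toeplitz_factors
begin

text \<open>Reversing the order of \<open>1, ..., n\<close> replaces \<open>\<gamma> k\<close> by
  \<open>\<gamma> (- k)\<close> and exchanges the two factorizations, with adjoint coefficients. The
  phase coefficients keep their norms, so the same contraction serves the other end.\<close>

lemma toeplitz_factors_dual:
  "toeplitz_factors d (\<lambda>k. adj (b k)) (\<lambda>k. adj (a k)) (\<lambda>k. adj (e k)) (\<lambda>k. adj (c k)) (\<lambda>k. \<gamma> (- k))"
proof -
  have e1: "star (\<lambda>k. adj (f k)) = (\<lambda>k. f (- k))" for f :: "int \<Rightarrow> 'a"
    by (simp add: fun_eq_iff star_def)
  have e2: "(\<lambda>k. adj (f k)) = (\<lambda>k. star f (- k))" for f :: "int \<Rightarrow> 'a"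
    by (simp add: fun_eq_iff star_def)
  have adj_conv: "((\<lambda>k. adj (f k)) \<star> (\<lambda>k. adj (g k))) = (\<lambda>i. (star f \<star> star g) (- i))" for f g :: "int \<Rightarrow> 'a"
    unfolding e2 by (rule ext) (rule conv_reflect)
  have adj_conv_star: "((\<lambda>k. adj (f k)) \<star> star (\<lambda>k. adj (g k))) = (\<lambda>i. (star f \<star> g) (- i))" for f g :: "int \<Rightarrow> 'a"
    unfolding e1 unfolding e2 by (rule ext) (rule conv_reflect)
  have star_conv_adj: "(star (\<lambda>k. adj (f k)) \<star> (\<lambda>k. adj (g k))) = (\<lambda>i. (f \<star> star g) (- i))" for f g :: "int \<Rightarrow> 'a"
    unfolding e1 unfolding e2 by (rule ext) (rule conv_reflect)
  have delta_neg: "(\<lambda>i. delta 0 (- 1) (- i)) = (delta 0 (- 1) :: int \<Rightarrow> 'a)" by (auto simp: delta_def fun_eq_iff)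
  have ph: "norm ((star b \<star> c) (- j)) = norm ((a \<star> star e) j)" for j
    unfolding star_\<beta>[symmetric] \<beta>_def[symmetric] by (simp add: norm_star)
  show ?thesis
    by unfold_locales
      (use d causal decay phase in \<open>simp_all add: ph adj_conv adj_conv_star star_conv_adj star_inverses delta_neg
        symbol_c[symmetric] symbol_e[symmetric] dec_def\<close>)
qed

text \<open>The gap is the sum over \<open>k \<ge> 0\<close> of
  \<open>b (s + k) * adj (b (t + k))\<close>. Either factor can supply the decay while the other
  makes the sum converge, hence two bounds.\<close>

lemma X_near_\<omega>:
  "\<exists>K. \<forall>s\<ge>1. \<forall>t\<ge>1. norm (\<omega> (s - t) - X s t) \<le> K * wt (1 + d) s \<and> norm (\<omega> (s - t) - X s t) \<le> K * wt (1 + d) t"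
proof -
  obtain B where B: "B > 0" "\<And>k. norm (b k) \<le> B * wt (1 + d) k" using decE[OF decay(2)] by blast
  have S: "(\<lambda>k. wt (1 + d) (int k)) summable_on UNIV"
    using summable_on_wt[of "1 + d" "{0..}"] d by (simp add: summable_on_int_ge)
  define W where "W = (\<Sum>\<^sub>\<infinity>k. wt (1 + d) (int k))"
  have mono: "wt (1 + d) (s + int k) \<le> wt (1 + d) s" "wt (1 + d) (s + int k) \<le> wt (1 + d) (int k)" if "s \<ge> 1" for s k
    using that d by (auto intro!: wt_mono_abs)
  have main: "norm (\<omega> (s - t) - X s t) \<le> (B * B * W) * w"
    if st: "s \<ge> 1" "t \<ge> 1" and w: "\<And>k. wt (1 + d) (s + int k) * wt (1 + d) (t + int k) \<le> w * wt (1 + d) (int k)" for s t w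
  proof -
    have "\<omega> (s - t) - X s t = (b \<star> \<zeta> t 1) s"
      using \<omega>_split[of s t 1] st by simp
    also have "norm \<dots> \<le> (\<Sum>\<^sub>\<infinity>k. (B * B * w) * wt (1 + d) (int k))"
    proof (rule conv_norm_le_support_le[where m = 0])
      show "conv_abs b (\<zeta> t 1) s"
        by (rule conv_bdd_abs[OF conv_bddI1[OF l1_ab(2) bdd_dec[OF dec_\<zeta>]]]) (use d in simp)
      show "(\<lambda>k. (B * B * w) * wt (1 + d) (int k)) summable_on UNIV"
        by (rule summable_on_cmult_right[OF S])
      fix k :: nat
      have "norm (b (s - 0 + int k)) * norm (\<zeta> t 1 (0 - int k)) = norm (b (s + int k)) * norm (b (t + int k))"
        by (simp add: \<zeta>_def)
      also have "\<dots> \<le> (B * wt (1 + d) (s + int k)) * (B * wt (1 + d) (t + int k))"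
        using B by (intro mult_mono) auto
      also have "\<dots> = B * B * (wt (1 + d) (s + int k) * wt (1 + d) (t + int k))" by simp
      also have "\<dots> \<le> B * B * (w * wt (1 + d) (int k))" using w B(1) by (intro mult_left_mono) auto
      finally show "norm (b (s - 0 + int k)) * norm (\<zeta> t 1 (0 - int k)) \<le> B * B * w * wt (1 + d) (int k)"
        by (simp add: mult_ac)
    qed (auto simp: \<zeta>_def)
    also have "\<dots> = (B * B * W) * w" by (simp add: infsum_cmult_right' W_def)
    finally show ?thesis .
  qed
  have "norm (\<omega> (s - t) - X s t) \<le> (B * B * W) * wt (1 + d) s \<and> norm (\<omega> (s - t) - X s t) \<le> (B * B * W) * wt (1 + d) t"
    if st: "s \<ge> 1" "t \<ge> 1" for s t
  proof (intro conjI main st)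
    show "wt (1 + d) (s + int k) * wt (1 + d) (t + int k) \<le> wt (1 + d) s * wt (1 + d) (int k)" for k
      using mono st by (intro mult_mono) auto
    have "wt (1 + d) (t + int k) * wt (1 + d) (s + int k) \<le> wt (1 + d) t * wt (1 + d) (int k)" for k
      using mono st by (intro mult_mono) auto
    then show "wt (1 + d) (s + int k) * wt (1 + d) (t + int k) \<le> wt (1 + d) t * wt (1 + d) (int k)" for k
      by (simp add: mult.commute)
  qed
  then show ?thesis by blast
qed

lemma sum_int_powr_le:
  "(\<Sum>s\<in>{1..int n}. of_int s powr (- d)) \<le> real n powr (1 - d) / (1 - d)"
proof -
  have "(\<Sum>s\<in>{1..int n}. real_of_int s powr (- d)) = (\<Sum>u=1..n. real u powr (- d))"
    by (rule sum.reindex_bij_witness[where i = int and j = nat]) auto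
  then show ?thesis using sum_powr_le[of d n] d by simp
qed

proposition column_estimate:
  assumes \<delta>: "0 < \<delta>" "\<delta> \<le> 1"
  shows "\<exists>C N. \<forall>n\<ge>N. \<forall>t x \<eta>. 1 \<le> t \<longrightarrow> t \<le> int n \<longrightarrow> \<delta> * real n \<le> of_int (int n - t + 1) \<longrightarrow>
    (\<forall>k. k \<notin> {1..int n} \<longrightarrow> x k = 0) \<longrightarrow>
    (\<forall>s\<in>{1..int n}. (\<gamma> \<star> x) s = (if s = t then \<eta> else 0)) \<longrightarrow>
    (\<Sum>s\<in>{1..int n}. norm (x s - X s t * \<eta>)) \<le> C * real n powr (- d) * norm \<eta>"
proof -
  obtain \<theta>' N\<^sub>0 where \<theta>': "\<theta>' < 1" "\<And>j. j \<ge> N\<^sub>0 \<Longrightarrow> pi * of_int j * norm (\<beta> j) \<le> \<theta>'"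
    using phase unfolding \<beta>_def by blast
  define \<theta> where "\<theta> = max \<theta>' 0"
  have \<theta>: "0 \<le> \<theta>" "\<theta> < 1" "\<And>j. j \<ge> N\<^sub>0 \<Longrightarrow> pi * of_int j * norm (\<beta> j) \<le> \<theta>"
    using \<theta>' by (force simp: \<theta>_def)+
  obtain A where A: "A > 0" "\<And>k. norm (a k) \<le> A * wt (1 + d) k" using decE[OF decay(1)] by blast
  obtain B where B: "B > 0" "\<And>k. norm (b k) \<le> B * wt (1 + d) k" using decE[OF decay(2)] by blast
  have S: "(\<lambda>k. wt (1 + d) (m + int k)) summable_on UNIV" for m
    using summable_on_wt[of "1 + d" "{m..}"] d by (simp add: summable_on_int_ge)
  define L where "L = B * (\<Sum>\<^sub>\<infinity>k. wt (1 + d) (int k))"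
  have L0: "L \<ge> 0" unfolding L_def using B(1) by (intro mult_nonneg_nonneg infsum_nonneg) auto
  \<comment> \<open>The two source terms of the equation for \<open>\<phi>\<close>:
    \<open>A / \<delta>\<close> stems from \<open>a (l - t)\<close>, \<open>L\<close> from
    \<open>\<beta> \<star> \<zeta> t \<eta>\<close>.\<close>
  define K where "K = A / \<delta> + L"
  have K0: "K > 0" using A(1) \<delta> L0 by (simp add: K_def add_pos_nonneg)
  \<comment> \<open>\<open>1 - \<theta>\<close> comes from the absorption, \<open>d\<close> and
    \<open>1 - d\<close> from summing the tails and then the rows, \<open>sqrt 2\<close> from
    \<open>sqrt n * sqrt (n / 2)\<close>.\<close>
  define C where "C = (A + B) * K * sqrt 2 / ((1 - \<theta>) * d * (1 - d))"
  \<comment> \<open>\<open>n \<ge> 3\<close> ensures \<open>n / 2 > 1\<close> for the Hilbert sums;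
    \<open>n \<ge> N\<^sub>0\<close> makes the asymptotic bound on \<open>\<beta>\<close> valid at
    all indices that occur, since these are at least \<open>n\<close>.\<close>
  have "(\<Sum>s\<in>{1..int n}. norm (x s - X s t * \<eta>)) \<le> C * real n powr (- d) * norm \<eta>"
    if n: "n \<ge> max 3 (nat N\<^sub>0)" and t: "1 \<le> t" "t \<le> int n" "\<delta> * real n \<le> of_int (int n - t + 1)"
      and x: "\<And>k. k \<notin> {1..int n} \<Longrightarrow> x k = 0"
      and eq: "\<And>s. s \<in> {1..int n} \<Longrightarrow> (\<gamma> \<star> x) s = (if s = t then \<eta> else 0)" for n t x \<eta>
  proof -
    obtain \<phi> \<psi> where \<phi>_supp: "\<And>l. l \<le> int n \<Longrightarrow> \<phi> l = 0" and \<psi>_supp: "\<And>p. p > 0 \<Longrightarrow> \<psi> p = 0"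
      and d\<phi>: "dec (1 / 2) \<phi>" and d\<psi>: "dec (1 / 2) \<psi>"
      and \<phi>_eq: "\<And>l. l > int n \<Longrightarrow> \<phi> l = - (a (l - t) * \<eta>) - (\<beta> \<star> \<zeta> t \<eta>) l + (\<beta> \<star> \<psi>) l"
      and \<psi>_eq: "\<And>p. p \<le> 0 \<Longrightarrow> \<psi> p = (star \<beta> \<star> \<phi>) p"
      and x_eq: "\<And>s. s \<ge> 1 \<Longrightarrow> x s = X s t * \<eta> + (star a \<star> \<phi>) s + (b \<star> \<psi>) s"
      by (rule column_representation[of "int n" t x \<eta>, OF _ t(1,2) x eq]) (simp, assumption, assumption, blast)
    have n3: "real n \<ge> 3" using n by simp
    have \<beta>_le: "norm (\<beta> j) \<le> \<theta> / pi * (1 / of_int j)" if "j \<ge> int n" for j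
    proof -
      have "N\<^sub>0 \<le> j" using that n by (simp add: nat_le_iff)
      then have "pi * of_int j * norm (\<beta> j) \<le> \<theta>" by (rule \<theta>(3))
      moreover have "real_of_int j > 0" using that n by simp
      ultimately show ?thesis by (simp add: field_simps)
    qed
    \<comment> \<open>For \<open>l > n\<close> and \<open>p \<le> 0\<close> both summands of
      \<open>l - p = (l - y) + (y - p)\<close> are at least \<open>y\<close>, which gives the
      Hilbert kernel with positive arguments.\<close>
    define y where "y = real n / 2"
    have y: "y > 1" using n3 by (simp add: y_def)
    \<comment> \<open>Finite because \<open>\<phi>\<close> has rate \<open>1 / 2\<close>; only then
      can \<open>\<theta> * M\<close> be absorbed below.\<close>
    define M where "M = (SUP l\<in>{int n + 1..}. sqrt (of_int l - y) * norm (\<phi> l))"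
    have bdd_M: "bdd_above ((\<lambda>l. sqrt (of_int l - y) * norm (\<phi> l)) ` {int n + 1..})"
    proof -
      obtain D where D: "D > 0" "\<And>l. norm (\<phi> l) \<le> D * wt (1 / 2) l" using decE[OF d\<phi>] by blast
      have "sqrt (of_int l - y) * norm (\<phi> l) \<le> D" if "l \<ge> int n + 1" for l
      proof -
        have l: "real_of_int l \<ge> 0" using that by simp
        have "sqrt (of_int l - y) * norm (\<phi> l) \<le> sqrt (1 + of_int l) * (D * wt (1 / 2) l)"
          using D y l by (intro mult_mono) auto
        also have "wt (1 / 2) l = 1 / sqrt (1 + of_int l)"
          using l by (simp add: wt_def powr_minus_divide powr_half_sqrt)
        also have "sqrt (1 + of_int l) * (D * (1 / sqrt (1 + of_int l))) = D"
          using l by (simp add: add_nonneg_eq_0_iff)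
        finally show ?thesis .
      qed
      then show ?thesis by (intro bdd_aboveI[of _ D]) auto
    qed
    have \<phi>_le': "sqrt (of_int l - y) * norm (\<phi> l) \<le> M" if "l > int n" for l
      unfolding M_def by (rule cSUP_upper[OF _ bdd_M]) (use that in simp)
    have lpos: "of_int l - y \<ge> y + 1" if "l > int n" for l
    proof -
      have "real_of_int l \<ge> real n + 1" using that by linarith
      then show ?thesis by (simp add: y_def)
    qed
    have M0: "M \<ge> 0"
      by (rule order_trans[OF _ \<phi>_le'[of "int n + 1"]]) (use lpos[of "int n + 1"] y in auto)
    have \<phi>_le: "norm (\<phi> l) \<le> M * (1 / sqrt (of_int l - y))" if "l > int n" for l
      using \<phi>_le'[OF that] lpos[OF that] y by (simp add: field_simps)
    have \<psi>_le: "norm (\<psi> p) \<le> \<theta> * M * (1 / sqrt (y - of_int p))" if p: "p \<le> 0" for p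
    proof -
      \<comment> \<open>The product of the bounds on \<open>\<beta>\<close> and
        \<open>\<phi>\<close>: the Hilbert kernel times its eigenweight, with sum at most
        \<open>\<theta> * M\<close> times the weight at \<open>p\<close>.\<close>
      define u where "u = (\<lambda>k. \<theta> / pi * M * (1 / ((y - of_int p + (y + 1 + real k)) * sqrt (y + 1 + real k))))"
      have py: "y - of_int p > 0" using p y by (simp add: less_le_trans[of 0 y])
      have "norm ((star \<beta> \<star> \<phi>) p) \<le> infsum u UNIV"
      proof (rule conv_norm_le_support_ge[where m = "int n + 1"])
        show "conv_abs (star \<beta>) \<phi> p"
          by (rule conv_bdd_abs[OF conv_bdd_dec[of "1 - d" _ "1 / 2"]]) (use dec_\<beta> d\<phi> d in auto)
        show "u summable_on UNIV"
          unfolding u_def by (intro summable_on_cmult_right hilbert_kernel_sum) (use py y in auto)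
        fix k :: nat
        let ?l = "int n + 1 + int k"
        have "norm (star \<beta> (p - (int n + 1) - int k)) * norm (\<phi> ?l) = norm (\<beta> (?l - p)) * norm (\<phi> ?l)"
          by (simp add: norm_star algebra_simps)
        also have "\<dots> \<le> (\<theta> / pi * (1 / of_int (?l - p))) * (M * (1 / sqrt (of_int ?l - y)))"
          using p \<theta>(1) by (intro mult_mono \<beta>_le \<phi>_le) auto
        also have "\<dots> = u k"
        proof -
          have "real_of_int (?l - p) = y - of_int p + (y + 1 + real k)" "real_of_int ?l - y = y + 1 + real k"
            by (simp_all add: y_def)
          then show ?thesis unfolding u_def by (simp only: times_divide_times_eq) (simp only: mult_ac divide_inverse inverse_mult_distrib)
        qed
        finally show "norm (star \<beta> (p - (int n + 1) - int k)) * norm (\<phi> (int n + 1 + int k)) \<le> u k" by simp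
      qed (use \<phi>_supp in auto)
      also have "infsum u UNIV \<le> \<theta> / pi * M * (pi / sqrt (y - of_int p))"
        unfolding u_def infsum_cmult_right'
        by (rule mult_left_mono[OF hilbert_kernel_sum(2)]) (use py y \<theta>(1) M0 in auto)
      also have "\<dots> = \<theta> * M * (1 / sqrt (y - of_int p))" by simp
      finally show ?thesis using \<psi>_eq[OF p] by simp
    qed
    \<comment> \<open>One passage from \<open>\<phi>\<close> to \<open>\<psi>\<close> and one back
      contribute the square of \<open>\<theta>\<close>, which is weakened to
      \<open>\<theta>\<close>.\<close>
    have "M \<le> K * norm \<eta> / sqrt (real n) + \<theta> * M"
      unfolding M_def
    proof (rule cSUP_least, unfold M_def[symmetric])
      fix l assume "l \<in> {int n + 1..}"
      then have l: "l > int n" by simp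
      have l1: "real_of_int l \<ge> real n" using l by linarith
      have l0: "real_of_int l > 0" using l1 n3 by linarith
      have 1: "norm (a (l - t) * \<eta>) \<le> A / \<delta> * norm \<eta> / of_int l"
      proof -
        \<comment> \<open>The distance from \<open>t\<close> to \<open>l\<close> is comparable with
          \<open>l\<close>: up to \<open>n\<close> by the hypothesis on \<open>t\<close>, beyond
          \<open>n\<close> because \<open>\<delta> \<le> 1\<close>.\<close>
        have "\<delta> * of_int l = \<delta> * (of_int l - real n) + \<delta> * real n" by (simp add: algebra_simps)
        also have "\<delta> * (of_int l - real n) \<le> of_int l - real n" using l1 \<delta> by (simp add: mult_left_le_one_le)
        finally have *: "\<delta> * of_int l \<le> 1 + of_int (l - t)" using t(3) by simp
        have lt: "l - t \<ge> 0" using l t by simp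
        have "wt (1 + d) (l - t) \<le> wt 1 (l - t)" by (rule wt_antimono) (use d in simp)
        also have "\<dots> = 1 / (1 + of_int (l - t))" using lt by (simp add: wt_def powr_minus_divide)
        also have "\<dots> \<le> 1 / (\<delta> * of_int l)" using * \<delta> l0 by (intro frac_le) auto
        finally have w: "wt (1 + d) (l - t) \<le> 1 / (\<delta> * of_int l)" .
        have "norm (a (l - t) * \<eta>) \<le> norm (a (l - t)) * norm \<eta>" by (rule norm_mult_ineq)
        also have "\<dots> \<le> (A * (1 / (\<delta> * of_int l))) * norm \<eta>"
          using A w by (intro mult_right_mono order_trans[OF A(2)] mult_left_mono) auto
        finally show ?thesis using \<delta> l0 by (simp add: field_simps)
      qed
      have 2: "norm ((\<beta> \<star> \<zeta> t \<eta>) l) \<le> L * norm \<eta> / of_int l"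
      proof -
        have "norm ((\<beta> \<star> \<zeta> t \<eta>) l) \<le> (\<Sum>\<^sub>\<infinity>k. (B * norm \<eta> / of_int l) * wt (1 + d) (int k))"
        proof (rule conv_norm_le_support_le[where m = 0])
          show "conv_abs \<beta> (\<zeta> t \<eta>) l"
            by (rule conv_bdd_abs[OF conv_bdd_dec[OF dec_\<beta> dec_\<zeta>]]) (use d in auto)
          show "(\<lambda>k. (B * norm \<eta> / of_int l) * wt (1 + d) (int k)) summable_on UNIV"
            by (rule summable_on_cmult_right) (use S[of 0] in simp)
          fix k :: nat
          have "norm (\<beta> (l + int k)) \<le> \<theta> / pi * (1 / of_int (l + int k))" using l by (intro \<beta>_le) simp
          also have "\<dots> \<le> 1 * (1 / of_int l)"
            using \<theta>(1,2) l0 pi_gt3 by (intro mult_mono divide_left_mono mult_pos_pos) auto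
          finally have b1: "norm (\<beta> (l + int k)) \<le> 1 / of_int l" by simp
          have "norm (\<zeta> t \<eta> (- int k)) \<le> norm (b (t + int k)) * norm \<eta>"
            using norm_mult_ineq[of "adj (b (t + int k))" \<eta>] by (simp add: \<zeta>_def)
          also have "\<dots> \<le> (B * wt (1 + d) (t + int k)) * norm \<eta>" by (intro mult_right_mono B) auto
          also have "\<dots> \<le> (B * wt (1 + d) (int k)) * norm \<eta>"
            using B(1) t(1) d by (intro mult_right_mono mult_left_mono wt_mono_abs) auto
          finally have "norm (\<zeta> t \<eta> (- int k)) \<le> B * wt (1 + d) (int k) * norm \<eta>" .
          then have "norm (\<beta> (l + int k)) * norm (\<zeta> t \<eta> (- int k)) \<le> 1 / of_int l * (B * wt (1 + d) (int k) * norm \<eta>)"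
            using l0 by (intro mult_mono b1) auto
          then show "norm (\<beta> (l - 0 + int k)) * norm (\<zeta> t \<eta> (0 - int k)) \<le> (B * norm \<eta> / of_int l) * wt (1 + d) (int k)"
            by (simp add: mult_ac)
        qed (auto simp: \<zeta>_def)
        also have "\<dots> = (B * norm \<eta> / of_int l) * (\<Sum>\<^sub>\<infinity>k. wt (1 + d) (int k))"
          by (rule infsum_cmult_right')
        finally show ?thesis by (simp add: L_def mult_ac)
      qed
      have 3: "norm ((\<beta> \<star> \<psi>) l) \<le> \<theta> * (\<theta> * M) * (1 / sqrt (of_int l - y))"
      proof -
        define u where "u = (\<lambda>k. \<theta> / pi * (\<theta> * M) * (1 / ((of_int l - y + (y + real k)) * sqrt (y + real k))))"
        have ly: "of_int l - y > 0" using lpos[OF l] y by simp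
        have "norm ((\<beta> \<star> \<psi>) l) \<le> infsum u UNIV"
        proof (rule conv_norm_le_support_le[where m = 0])
          show "conv_abs \<beta> \<psi> l"
            by (rule conv_bdd_abs[OF conv_bdd_dec[of "1 - d" _ "1 / 2"]]) (use dec_\<beta> d\<psi> d in auto)
          show "u summable_on UNIV"
            unfolding u_def by (intro summable_on_cmult_right hilbert_kernel_sum) (use ly y in auto)
          fix k :: nat
          have "norm (\<beta> (l + int k)) * norm (\<psi> (- int k))
              \<le> (\<theta> / pi * (1 / of_int (l + int k))) * (\<theta> * M * (1 / sqrt (y - of_int (- int k))))"
            using l \<theta>(1) l0 by (intro mult_mono \<beta>_le \<psi>_le) auto
          then show "norm (\<beta> (l - 0 + int k)) * norm (\<psi> (0 - int k)) \<le> u k"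
            unfolding u_def by simp
        qed (use \<psi>_supp in auto)
        also have "infsum u UNIV \<le> \<theta> / pi * (\<theta> * M) * (pi / sqrt (of_int l - y))"
          unfolding u_def infsum_cmult_right'
          by (rule mult_left_mono[OF hilbert_kernel_sum(2)]) (use ly y \<theta>(1) M0 in auto)
        finally show ?thesis by simp
      qed
      have "norm (\<phi> l) \<le> norm (a (l - t) * \<eta>) + norm ((\<beta> \<star> \<zeta> t \<eta>) l) + norm ((\<beta> \<star> \<psi>) l)"
        unfolding \<phi>_eq[OF l]
        using norm_triangle_ineq[of "- (a (l - t) * \<eta>) - (\<beta> \<star> \<zeta> t \<eta>) l" "(\<beta> \<star> \<psi>) l"]
          norm_triangle_ineq4[of "- (a (l - t) * \<eta>)" "(\<beta> \<star> \<zeta> t \<eta>) l"] by simp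
      also have "\<dots> \<le> K * norm \<eta> / of_int l + \<theta> * (\<theta> * M) * (1 / sqrt (of_int l - y))"
        using 1 2 3 by (simp add: K_def distrib_right add_divide_distrib)
      finally have "sqrt (of_int l - y) * norm (\<phi> l)
          \<le> sqrt (of_int l - y) * (K * norm \<eta> / of_int l + \<theta> * (\<theta> * M) * (1 / sqrt (of_int l - y)))"
        using lpos[OF l] y by (intro mult_left_mono) auto
      also have "\<dots> = sqrt (of_int l - y) * (K * norm \<eta> / of_int l) + \<theta> * (\<theta> * M)"
        using lpos[OF l] y by (simp add: distrib_left)
      also have "\<dots> \<le> K * norm \<eta> / sqrt (real n) + \<theta> * M"
      proof (rule add_mono)
        have "sqrt (of_int l - y) * (K * norm \<eta> / of_int l) \<le> sqrt (of_int l) * (K * norm \<eta> / of_int l)"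
          using y l0 K0 by (intro mult_right_mono) auto
        also have "\<dots> = K * norm \<eta> / sqrt (of_int l)"
          using l0 real_sqrt_mult_self[of "of_int l"] by (simp add: field_simps)
        also have "\<dots> \<le> K * norm \<eta> / sqrt (real n)"
          using l1 n3 K0 l0 by (intro divide_left_mono mult_pos_pos) auto
        finally show "sqrt (of_int l - y) * (K * norm \<eta> / of_int l) \<le> K * norm \<eta> / sqrt (real n)" .
        have "\<theta> * M \<le> 1 * M" using \<theta> M0 by (intro mult_right_mono) auto
        then show "\<theta> * (\<theta> * M) \<le> \<theta> * M" using \<theta>(1) by (intro mult_left_mono) auto
      qed
      finally show "sqrt (of_int l - y) * norm (\<phi> l) \<le> K * norm \<eta> / sqrt (real n) + \<theta> * M" .
    qed simp
    then have "(1 - \<theta>) * M \<le> K * norm \<eta> / sqrt (real n)" by (simp add: algebra_simps)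
    then have M_le: "M \<le> K * norm \<eta> / sqrt (real n) / (1 - \<theta>)"
      using \<theta>(2) by (subst pos_le_divide_eq) (simp_all add: mult.commute)
    \<comment> \<open>The weight is bounded by \<open>1 / sqrt y\<close>; what remains is a tail of
      \<open>a\<close> starting at the distance from \<open>s\<close> to
      \<open>n + 1\<close>.\<close>
    have sum1: "norm ((star a \<star> \<phi>) s) \<le> A * M / sqrt y * (of_int (int n + 1 - s) powr (- d) / d)" if s: "s \<in> {1..int n}" for s
    proof -
      have "norm ((star a \<star> \<phi>) s) \<le> (\<Sum>\<^sub>\<infinity>k. (A * M / sqrt y) * wt (1 + d) (int n + 1 - s + int k))"
      proof (rule conv_norm_le_support_ge[where m = "int n + 1"])
        show "conv_abs (star a) \<phi> s"
          by (rule conv_bdd_abs[OF conv_bddI1]) (use l1_ab bdd_dec[OF d\<phi>] in auto)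
        show "(\<lambda>k. (A * M / sqrt y) * wt (1 + d) (int n + 1 - s + int k)) summable_on UNIV"
          by (rule summable_on_cmult_right[OF S])
        fix k :: nat
        let ?l = "int n + 1 + int k"
        have "norm (\<phi> ?l) \<le> M * (1 / sqrt (of_int ?l - y))" by (rule \<phi>_le) simp
        also have "\<dots> \<le> M * (1 / sqrt y)"
          using lpos[of ?l] y M0 by (intro mult_left_mono divide_left_mono mult_pos_pos) auto
        finally have "norm (\<phi> ?l) \<le> M * (1 / sqrt y)" .
        then have "norm (a (int n + 1 - s + int k)) * norm (\<phi> ?l)
            \<le> (A * wt (1 + d) (int n + 1 - s + int k)) * (M * (1 / sqrt y))"
          using A by (intro mult_mono A(2)) auto
        then show "norm (star a (s - (int n + 1) - int k)) * norm (\<phi> (int n + 1 + int k))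
            \<le> (A * M / sqrt y) * wt (1 + d) (int n + 1 - s + int k)"
          by (simp add: norm_star algebra_simps)
      qed (use \<phi>_supp in auto)
      also have "\<dots> = A * M / sqrt y * (\<Sum>\<^sub>\<infinity>k\<in>{int n + 1 - s..}. wt (1 + d) k)"
        by (simp only: infsum_cmult_right' infsum_int_ge)
      also have "\<dots> \<le> A * M / sqrt y * (of_int (int n + 1 - s) powr (- d) / d)"
        using s A(1) M0 y d by (intro mult_left_mono infsum_wt_tail) auto
      finally show ?thesis .
    qed
    have sum2: "norm ((b \<star> \<psi>) s) \<le> B * M / sqrt y * (of_int s powr (- d) / d)" if s: "s \<in> {1..int n}" for s
    proof -
      have "norm ((b \<star> \<psi>) s) \<le> (\<Sum>\<^sub>\<infinity>k. (B * M / sqrt y) * wt (1 + d) (s + int k))"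
      proof (rule conv_norm_le_support_le[where m = 0])
        show "conv_abs b \<psi> s"
          by (rule conv_bdd_abs[OF conv_bddI1]) (use l1_ab bdd_dec[OF d\<psi>] in auto)
        show "(\<lambda>k. (B * M / sqrt y) * wt (1 + d) (s + int k)) summable_on UNIV"
          by (rule summable_on_cmult_right[OF S])
        fix k :: nat
        have "norm (\<psi> (- int k)) \<le> \<theta> * M * (1 / sqrt (y - of_int (- int k)))" by (rule \<psi>_le) simp
        also have "\<dots> \<le> M * (1 / sqrt y)"
          using y M0 \<theta> by (intro mult_mono divide_left_mono mult_pos_pos mult_left_le_one_le) auto
        finally have "norm (\<psi> (- int k)) \<le> M * (1 / sqrt y)" .
        then have "norm (b (s + int k)) * norm (\<psi> (- int k)) \<le> (B * wt (1 + d) (s + int k)) * (M * (1 / sqrt y))"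
          using B by (intro mult_mono B(2)) auto
        then show "norm (b (s - 0 + int k)) * norm (\<psi> (0 - int k)) \<le> (B * M / sqrt y) * wt (1 + d) (s + int k)"
          by (simp add: algebra_simps)
      qed (use \<psi>_supp in auto)
      also have "\<dots> = B * M / sqrt y * (\<Sum>\<^sub>\<infinity>k\<in>{s..}. wt (1 + d) k)"
        by (simp only: infsum_cmult_right' infsum_int_ge)
      also have "\<dots> \<le> B * M / sqrt y * (of_int s powr (- d) / d)"
        using s B(1) M0 y d by (intro mult_left_mono infsum_wt_tail) auto
      finally show ?thesis .
    qed
    have "(\<Sum>s\<in>{1..int n}. norm (x s - X s t * \<eta>))
        \<le> (\<Sum>s\<in>{1..int n}. A * M / sqrt y / d * of_int (int n + 1 - s) powr (- d) + B * M / sqrt y / d * of_int s powr (- d))"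
    proof (rule sum_mono)
      fix s assume s: "s \<in> {1..int n}"
      have "x s - X s t * \<eta> = (star a \<star> \<phi>) s + (b \<star> \<psi>) s" using x_eq[of s] s by simp
      then show "norm (x s - X s t * \<eta>)
          \<le> A * M / sqrt y / d * of_int (int n + 1 - s) powr (- d) + B * M / sqrt y / d * of_int s powr (- d)"
        using norm_triangle_ineq[of "(star a \<star> \<phi>) s" "(b \<star> \<psi>) s"] sum1[OF s] sum2[OF s] by simp
    qed
    also have "\<dots> = A * M / sqrt y / d * (\<Sum>s\<in>{1..int n}. of_int (int n + 1 - s) powr (- d))
        + B * M / sqrt y / d * (\<Sum>s\<in>{1..int n}. of_int s powr (- d))"
      by (simp only: sum.distrib sum_distrib_left)
    also have "(\<Sum>s\<in>{1..int n}. real_of_int (int n + 1 - s) powr (- d)) = (\<Sum>s\<in>{1..int n}. of_int s powr (- d))"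
      by (rule sum.reindex_bij_witness[where i = "\<lambda>s. int n + 1 - s" and j = "\<lambda>s. int n + 1 - s"]) auto
    also have "A * M / sqrt y / d * (\<Sum>s\<in>{1..int n}. of_int s powr (- d))
        + B * M / sqrt y / d * (\<Sum>s\<in>{1..int n}. of_int s powr (- d))
        = (A + B) * M / sqrt y / d * (\<Sum>s\<in>{1..int n}. of_int s powr (- d))"
      by (simp add: distrib_right add_divide_distrib)
    also have "\<dots> \<le> (A + B) * (K * norm \<eta> / sqrt (real n) / (1 - \<theta>)) / sqrt y / d * (real n powr (1 - d) / (1 - d))"
      using A(1) B(1) M0 y d M_le K0 \<theta>(2)
      by (intro mult_mono divide_right_mono mult_left_mono sum_int_powr_le)
        (auto intro!: sum_nonneg divide_nonneg_nonneg mult_nonneg_nonneg)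
    also have "\<dots> = C * real n powr (- d) * norm \<eta>"
    proof -
      have "sqrt (real n) * sqrt y = real n / sqrt 2"
        using n3 unfolding y_def by (simp add: real_sqrt_divide)
      moreover have npow: "real n powr (1 - d) = real n * real n powr (- d)"
        using n3 powr_add[of "real n" 1 "- d"] by simp
      moreover have "real n / (real n / sqrt 2) = sqrt 2" using n3 by simp
      ultimately have "C * real n powr (- d) * norm \<eta> = (A + B) * K * (real n / (sqrt (real n) * sqrt y))
          / ((1 - \<theta>) * d * (1 - d)) * real n powr (- d) * norm \<eta>"
        unfolding C_def by simp
      then show ?thesis
        unfolding npow
        by (auto simp add: divide_inverse mult_ac)
    qed
    finally show ?thesis .
  qed
  then show ?thesis by blast
qed

end

section \<open>The binomial series\<close>

text \<open>Coefficients of \<open>(1 - z)^r\<close>, extended by \<open>0\<close> to negative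
  indices.\<close>

definition bcoef :: "real \<Rightarrow> int \<Rightarrow> real" where
  "bcoef r k = (if k < 0 then 0 else (- 1) ^ nat k * (r gchoose nat k))"

lemma bcoef_neg [simp]: "k < 0 \<Longrightarrow> bcoef r k = 0"
  by (simp add: bcoef_def)

lemma bcoef_0 [simp]: "bcoef r 0 = 1"
  by (simp add: bcoef_def)

text \<open>Stated for all integers, as \<open>cross_rec\<close> needs it with an arbitrary shift:
  at \<open>k = - 1\<close> the factor on the left vanishes, and below that both coefficients
  do.\<close>

lemma bcoef_rec: "of_int (k + 1) * bcoef r (k + 1) = (of_int k - r) * bcoef r k"
proof (cases "k \<ge> 0")
  case True
  then obtain m where m: "k = int m" using nonneg_int_cases by blast
  have "real (Suc m) * (r gchoose Suc m) = (r - real m) * (r gchoose m)"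
    unfolding gbinomial_absorption gbinomial_absorb_comp ..
  then have "(- 1) ^ Suc m * (real (Suc m) * (r gchoose Suc m)) = (- 1) ^ Suc m * ((r - real m) * (r gchoose m))"
    by simp
  moreover have "nat (k + 1) = Suc m" using m by simp
  ultimately show ?thesis using m by (simp add: bcoef_def algebra_simps)
next
  case False
  then show ?thesis by (cases "k = - 1") (auto simp: bcoef_def)
qed

lemma bcoef_Suc: "bcoef r (int (Suc m)) = (real m - r) / (real m + 1) * bcoef r (int m)"
  using bcoef_rec[of "int m" r] by (simp add: field_simps)

lemma one_minus_le_powr:
  fixes m s :: real
  assumes "m > 0" "s \<ge> 0"
  shows "1 - s / m \<le> (m / (m + 1)) powr s"
proof -
  have "ln ((m + 1) / m) \<le> (m + 1) / m - 1" by (rule ln_le_minus_one) (use assms in simp)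
  also have "(m + 1) / m - 1 = 1 / m" using assms by (simp add: field_simps)
  finally have "- (1 / m) \<le> ln (m / (m + 1))" using assms by (simp add: ln_div)
  then have "s * (- (1 / m)) \<le> s * ln (m / (m + 1))" by (rule mult_left_mono[OF _ assms(2)])
  have "1 - s / m \<le> exp (- (s / m))" using exp_ge_add_one_self[of "- (s / m)"] by simp
  also have "\<dots> \<le> exp (s * ln (m / (m + 1)))" using \<open>s * (- (1 / m)) \<le> _\<close> by simp
  also have "\<dots> = (m / (m + 1)) powr s" using assms by (simp add: powr_def)
  finally show ?thesis .
qed

text \<open>The ratio of consecutive coefficients is \<open>1 - (1 + r) / (m + 1)\<close>, at most
  the ratio of consecutive weights by \<open>one_minus_le_powr\<close>; so the exact rate
  \<open>1 + r\<close> is inductive.\<close>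

lemma bcoef_step:
  fixes B :: real
  assumes "m \<ge> 1" "r \<ge> - 1" "r < real m" "\<bar>bcoef r (int m)\<bar> \<le> B * wt (1 + r) (int m)"
  shows "\<bar>bcoef r (int (Suc m))\<bar> \<le> B * wt (1 + r) (int (Suc m))"
proof -
  let ?m = "real m + 1"
  have "\<bar>bcoef r (int (Suc m))\<bar> = (1 - (1 + r) / ?m) * \<bar>bcoef r (int m)\<bar>"
    using assms unfolding bcoef_Suc abs_mult by (simp add: field_simps)
  also have "\<dots> \<le> (?m / (?m + 1)) powr (1 + r) * (B * wt (1 + r) (int m))"
    using assms one_minus_le_powr[of ?m "1 + r"] by (intro mult_mono) auto
  also have "\<dots> = B * wt (1 + r) (int (Suc m))"
  proof -
    have "(?m / (?m + 1)) powr (1 + r) * ?m powr (- (1 + r)) = (?m + 1) powr (- (1 + r))"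
      unfolding powr_divide powr_minus_divide by simp
    then show ?thesis by (simp add: wt_def algebra_simps)
  qed
  finally show ?thesis .
qed

lemma dec_bcoef:
  assumes "- 1 \<le> r" "r < 1"
  shows "dec (1 + r) (bcoef r)"
proof -
  \<comment> \<open>Chosen so that \<open>B * wt (1 + r) 1 = 1\<close>, which covers the coefficient
    \<open>- r\<close> at index \<open>1\<close>.\<close>
  define B where "B = 2 powr (1 + r)"
  have B1: "B \<ge> 1" unfolding B_def by (rule ge_one_powr_ge_zero) (use assms in auto)
  have "\<bar>bcoef r (int (Suc m))\<bar> \<le> B * wt (1 + r) (int (Suc m))" for m
  proof (induction m)
    case 0
    have "\<bar>bcoef r (int (Suc 0))\<bar> = \<bar>r\<bar>" unfolding bcoef_Suc by simp
    moreover have "B * wt (1 + r) (int (Suc 0)) = 1"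
      by (simp add: B_def wt_def flip: powr_add)
    ultimately show ?case using assms by simp
  next
    case (Suc m)
    show ?case by (rule bcoef_step[of "Suc m"]) (use assms Suc.IH in auto)
  qed
  then have nat: "\<bar>bcoef r (int m)\<bar> \<le> B * wt (1 + r) (int m)" for m
    using B1 by (cases m) auto
  have "\<bar>bcoef r k\<bar> \<le> B * wt (1 + r) k" for k
    using nat[of "nat k"] B1 by (cases "k \<ge> 0") auto
  then show ?thesis by (auto simp: dec_def)
qed

lemma conv_causal:
  fixes f g :: "int \<Rightarrow> 'a::real_normed_algebra"
  assumes "\<And>k. k < 0 \<Longrightarrow> f k = 0" "\<And>k. k < 0 \<Longrightarrow> g k = 0"
  shows "(f \<star> g) i = (\<Sum>j\<in>{0..i}. f j * g (i - j))"
proof -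
  have "(f \<star> g) i = (\<Sum>\<^sub>\<infinity>j\<in>{0..i}. f j * g (i - j))"
    unfolding conv_def
  proof (rule infsum_cong_neutral)
    fix j assume "j \<in> UNIV - {0..i}"
    then show "f j * g (i - j) = 0" using assms(1)[of j] assms(2)[of "i - j"] by (cases "j < 0") auto
  qed auto
  then show ?thesis by simp
qed

text \<open>Vandermonde's convolution for \<open>r + (- r) = 0\<close>.\<close>

lemma bcoef_inverse: "bcoef r \<star> bcoef (- r) = delta 0 1"
proof
  fix i
  have "(bcoef r \<star> bcoef (- r)) i = (\<Sum>j\<in>{0..i}. bcoef r j * bcoef (- r) (i - j))"
    by (rule conv_causal) auto
  also have "\<dots> = delta 0 1 i"
  proof (cases "i < 0")
    case False
    then obtain n where n: "i = int n" using nonneg_int_cases[of i] by auto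
    have "(\<Sum>j\<in>{0..i}. bcoef r j * bcoef (- r) (i - j)) = (\<Sum>k\<in>{0..n}. bcoef r (int k) * bcoef (- r) (i - int k))"
      by (rule sum.reindex_bij_witness[where i = int and j = nat]) (auto simp: n)
    also have "\<dots> = (\<Sum>k\<in>{0..n}. (- 1) ^ n * ((r gchoose k) * (- r gchoose (n - k))))"
    proof (rule sum.cong[OF refl])
      fix k assume k: "k \<in> {0..n}"
      then have "i - int k = int (n - k)" "(- 1 :: real) ^ n = (- 1) ^ k * (- 1) ^ (n - k)"
        using n by (auto simp flip: power_add)
      then show "bcoef r (int k) * bcoef (- r) (i - int k) = (- 1) ^ n * ((r gchoose k) * (- r gchoose (n - k)))"
        by (simp add: bcoef_def)
    qed
    also have "\<dots> = (- 1) ^ n * (0 gchoose n)"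
      unfolding sum_distrib_left[symmetric] gbinomial_Vandermonde by simp
    finally show ?thesis by (simp add: gbinomial_0_left delta_def n)
  qed (auto simp: delta_def)
  finally show "(bcoef r \<star> bcoef (- r)) i = delta 0 1 i" .
qed

lemma bcoef_sums:
  assumes "norm (z :: complex) < 1"
  shows "(\<lambda>k. of_real (bcoef r (int k)) * z ^ k) sums (1 - z) powr of_real r"
proof -
  have "(\<lambda>n. (of_real r gchoose n) * (- z) ^ n) sums (1 + - z) powr of_real r"
    by (rule gen_binomial_complex) (use assms in simp)
  moreover have "(of_real r gchoose n) * (- z) ^ n = of_real (bcoef r (int n)) * z ^ n" for n
  proof -
    have "(of_real r gchoose n :: complex) = of_real (r gchoose n)"
      by (simp add: gbinomial_prod_rev)
    then show ?thesis by (simp add: bcoef_def power_minus[of z])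
  qed
  ultimately show ?thesis by simp
qed

text \<open>Fourier coefficients of the scalar phase \<open>(1 - z)^d (1 - 1/z)^(-d)\<close> on the
  unit circle, as a correlation of two binomial sequences.\<close>

definition cross :: "real \<Rightarrow> int \<Rightarrow> real" where
  "cross d = bcoef d \<star> (\<lambda>k. bcoef (- d) (- k))"

lemma dec_bcoef_d:
  assumes "0 < d" "d < 1 / 2"
  shows "dec (1 + d) (bcoef d)" "dec (1 - d) (bcoef (- d))" "dec (1 - d) (\<lambda>k. bcoef (- d) (- k))"
  using dec_bcoef[of d] dec_bcoef[of "- d"] dec_reflect[of "1 - d" "bcoef (- d)"] assms by simp_all

lemma cross_sums:
  assumes "0 < d" "d < 1 / 2"
  shows "(\<lambda>m. bcoef d (j + int m) * bcoef (- d) (int m)) sums cross d j"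
proof -
  have "conv_abs (bcoef d) (\<lambda>k. bcoef (- d) (- k)) j"
    by (rule conv_bdd_abs[OF conv_bdd_dec[OF dec_bcoef_d(1,3)]]) (use assms in auto)
  from conv_abs_summable[OF this]
  have s: "(\<lambda>i. bcoef d i * bcoef (- d) (- (j - i))) summable_on UNIV" .
  have "(\<Sum>\<^sub>\<infinity>i. bcoef d i * bcoef (- d) (- (j - i))) = (\<Sum>\<^sub>\<infinity>i\<in>{j..}. bcoef d i * bcoef (- d) (- (j - i)))"
    by (rule infsum_cong_neutral) auto
  also have "\<dots> = (\<Sum>\<^sub>\<infinity>m. bcoef d (j + int m) * bcoef (- d) (int m))"
    by (simp add: infsum_int_ge)
  finally have I: "cross d j = (\<Sum>\<^sub>\<infinity>m. bcoef d (j + int m) * bcoef (- d) (int m))"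
    by (simp add: cross_def conv_def)
  have "(\<lambda>i. bcoef d i * bcoef (- d) (- (j - i))) summable_on {j..}"
    by (rule summable_on_subset_banach[OF s]) auto
  then have "(\<lambda>m. bcoef d (j + int m) * bcoef (- d) (int m)) summable_on UNIV"
    by (simp add: summable_on_int_ge)
  then show ?thesis unfolding I by (intro has_sum_imp_sums has_sum_infsum)
qed

text \<open>Gosper's telescoping certificate is \<open>m * bcoef (- d) m * bcoef d (j + m)\<close>.\<close>

lemma cross_rec:
  assumes "0 < d" "d < 1 / 2"
  shows "(of_int (j + 1) - d) * cross d (j + 1) = (of_int j - d) * cross d j"
proof -
  define G where "G = (\<lambda>m::nat. real m * bcoef (- d) (int m) * bcoef d (j + int m))"
  obtain A where A: "A > 0" "\<And>k. norm (bcoef d k) \<le> A * wt (1 + d) k"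
    using decE[OF dec_bcoef_d(1)[OF assms]] by blast
  obtain B where B: "B > 0" "\<And>k. norm (bcoef (- d) k) \<le> B * wt (1 - d) k"
    using decE[OF dec_bcoef_d(2)[OF assms]] by blast
  define D where "D = B * (A * wt (- (1 + d)) j)"
  \<comment> \<open>The certificate tends to \<open>0\<close>: the rates \<open>1 - d\<close> and
    \<open>1 + d\<close> add up to 2 and beat the factor \<open>m\<close>. Peetre's inequality
    removes the shift by \<open>j\<close>.\<close>
  have "norm (G m) \<le> D * (1 / real (Suc m))" for m
  proof -
    have "norm (G m) \<le> (1 + real m) * (B * wt (1 - d) (int m)) * (A * (wt (1 + d) (int m) * wt (- (1 + d)) (- j)))"
    proof -
      have "norm (bcoef d (j + int m)) \<le> A * (wt (1 + d) (int m) * wt (- (1 + d)) (- j))"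
        using A(2)[of "j + int m"] wt_peetre[of "1 + d" "int m" "- j"] assms A(1)
        by (intro order_trans[OF A(2)] mult_left_mono) (auto simp: add.commute)
      then show ?thesis
        unfolding G_def norm_mult using B by (intro mult_mono) (auto intro: mult_nonneg_nonneg)
    qed
    also have "\<dots> = D * ((1 + real m) * (wt (1 - d) (int m) * wt (1 + d) (int m)))"
      by (simp add: D_def mult_ac)
    also have "wt (1 - d) (int m) * wt (1 + d) (int m) = wt 2 (int m)" by (simp flip: wt_add)
    also have "(1 + real m) * wt 2 (int m) = 1 / real (Suc m)"
      by (simp add: wt_def powr_minus_divide power2_eq_square)
    finally show ?thesis .
  qed
  moreover have "(\<lambda>m. D * (1 / real (Suc m))) \<longlonglongrightarrow> D * 0"
    by (intro tendsto_mult tendsto_const LIMSEQ_Suc[OF lim_1_over_n])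
  ultimately have "G \<longlonglongrightarrow> 0"
    by (intro Lim_null_comparison[of G "\<lambda>m. D * (1 / real (Suc m))"]) auto
  from telescope_sums[OF this] have T: "(\<lambda>m. G (Suc m) - G m) sums 0" by (simp add: G_def)
  have eq: "G (Suc m) - G m = (of_int j - d) * (bcoef d (j + int m) * bcoef (- d) (int m))
      - (of_int (j + 1) - d) * (bcoef d (j + 1 + int m) * bcoef (- d) (int m))" for m
  proof -
    have 1: "real (Suc m) * bcoef (- d) (int (Suc m)) = (real m + d) * bcoef (- d) (int m)"
      using bcoef_rec[of "int m" "- d"] by (simp add: algebra_simps)
    have 2: "(of_int (j + int m) + 1) * bcoef d (j + int m + 1) = (of_int (j + int m) - d) * bcoef d (j + int m)"
      using bcoef_rec[of "j + int m" d] by simp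
    have i: "j + int (Suc m) = j + int m + 1" "j + 1 + int m = j + int m + 1" by simp_all
    have "G (Suc m) = (real m + d) * bcoef (- d) (int m) * bcoef d (j + int m + 1)"
      unfolding G_def 1 i ..
    also have "\<dots> = bcoef (- d) (int m) * ((of_int (j + int m) + 1) * bcoef d (j + int m + 1))
        - (of_int (j + 1) - d) * (bcoef d (j + int m + 1) * bcoef (- d) (int m))"
      by (simp add: algebra_simps)
    finally show ?thesis unfolding 2 i G_def by (simp add: algebra_simps)
  qed
  have "(\<lambda>m. G (Suc m) - G m) sums ((of_int j - d) * cross d j - (of_int (j + 1) - d) * cross d (j + 1))"
    unfolding eq by (intro sums_diff sums_mult cross_sums assms)
  with T have "(of_int j - d) * cross d j - (of_int (j + 1) - d) * cross d (j + 1) = 0"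
    using sums_unique2 by blast
  then show ?thesis by simp
qed

text \<open>The partial sums are the partial products of Euler's product for the sine. The second
  conjunct of the induction is the next summand, which produces the next factor.\<close>

lemma cross_0:
  assumes "0 < d" "d < 1 / 2"
  shows "cross d 0 = sin (pi * d) / (pi * d)"
proof -
  have "(\<Sum>m<Suc M. bcoef d (0 + int m) * bcoef (- d) (int m)) = (\<Prod>k=1..M. 1 - d^2 / of_nat k^2)
     \<and> bcoef d (int (Suc M)) * bcoef (- d) (int (Suc M)) = - (d\<^sup>2 / (real (Suc M))\<^sup>2) * (\<Prod>k=1..M. 1 - d^2 / of_nat k^2)" for M
  proof (induction M)
    case 0
    show ?case unfolding bcoef_Suc by (simp add: power2_eq_square)
  next
    case (Suc M)
    let ?P = "\<Prod>k=1..M. 1 - d^2 / of_nat k^2"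
    have 1: "(\<Sum>m<Suc (Suc M). bcoef d (0 + int m) * bcoef (- d) (int m)) = (\<Prod>k=1..Suc M. 1 - d^2 / of_nat k^2)"
      unfolding sum.lessThan_Suc[of _ "Suc M"] using Suc.IH by (simp add: algebra_simps)
    have "bcoef d (int (Suc (Suc M))) * bcoef (- d) (int (Suc (Suc M)))
        = ((real (Suc M) - d) * (real (Suc M) + d)) / (real (Suc M) + 1)^2 * (bcoef d (int (Suc M)) * bcoef (- d) (int (Suc M)))"
      unfolding bcoef_Suc[of _ "Suc M"] by (simp add: power2_eq_square)
    also have "\<dots> = ((real (Suc M) - d) * (real (Suc M) + d)) / (real (Suc M) + 1)^2 * (- (d\<^sup>2 / (real (Suc M))\<^sup>2) * ?P)"
      using Suc.IH by simp
    also have "\<dots> = - (d\<^sup>2 / (real (Suc (Suc M)))\<^sup>2) * (?P * (1 - d^2 / of_nat (Suc M)^2))"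
    proof -
      define x where "x = real (Suc M)"
      have x: "x > 0" "real (Suc (Suc M)) = x + 1" by (simp_all add: x_def)
      have "(1 - d\<^sup>2 / x\<^sup>2) = ((x - d) * (x + d)) / x\<^sup>2"
        using x(1) by (simp add: field_simps power2_eq_square)
      then show ?thesis unfolding x(2) x_def[symmetric] by simp
    qed
    finally show ?case using 1 by simp
  qed
  then have "(\<lambda>M. \<Sum>m<Suc M. bcoef d (0 + int m) * bcoef (- d) (int m)) \<longlonglongrightarrow> sin (pi * d) / (pi * d)"
    using sin_product_formula_real'[of d] assms by simp
  moreover have "(\<lambda>M. \<Sum>m<Suc M. bcoef d (0 + int m) * bcoef (- d) (int m)) \<longlonglongrightarrow> cross d 0"
    using LIMSEQ_Suc[OF cross_sums[OF assms, of 0, unfolded sums_def]] .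
  ultimately show ?thesis using LIMSEQ_unique by blast
qed

text \<open>By \<open>cross_rec\<close> the quantity \<open>(j - d) * cross d j\<close> does not
  depend on \<open>j\<close>, its value at \<open>0\<close> is known, and \<open>j - d\<close> never
  vanishes.\<close>

lemma cross_eq:
  assumes "0 < d" "d < 1 / 2"
  shows "cross d j = sin (pi * d) / pi / (d - of_int j)"
proof -
  have ne: "of_int i - d \<noteq> 0" for i :: int
  proof
    assume "of_int i - d = 0"
    then have "0 < real_of_int i" "real_of_int i < 1" using assms by linarith+
    then show False by simp
  qed
  have "(of_int j - d) * cross d j = (of_int 0 - d) * cross d 0"
  proof (induction j rule: int_induct[where k = 0])
    case (step1 i)
    then show ?case using cross_rec[OF assms, of i] by simp
  next
    case (step2 i)
    then show ?case using cross_rec[OF assms, of "i - 1"] by simp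
  qed simp
  also have "\<dots> = - (sin (pi * d) / pi)" using assms by (simp add: cross_0)
  finally have "cross d j = - (sin (pi * d) / pi) / (of_int j - d)" using ne[of j] by (simp add: field_simps)
  moreover have "d - of_int j = - (of_int j - d)" by simp
  ultimately show ?thesis by (simp only: divide_minus_right minus_divide_left)
qed

section \<open>Asymptotics of the phase coefficients\<close>

definition emb :: "(int \<Rightarrow> real) \<Rightarrow> int \<Rightarrow> 'a::real_algebra_1" where
  "emb f k = of_real (f k)"

lemma dec_emb [simp]: "dec s (emb f :: int \<Rightarrow> 'a::real_normed_algebra_1) \<longleftrightarrow> dec s f"
  by (simp add: dec_def emb_def)

lemma star_emb: "star (emb f) = emb (\<lambda>k. f (- k))"
  by (simp add: fun_eq_iff star_def emb_def)

lemma emb_conv: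
  fixes f g :: "int \<Rightarrow> real"
  assumes "conv_abs f g i"
  shows "((emb f :: int \<Rightarrow> 'a::real_normed_algebra_1) \<star> emb g) i = emb (f \<star> g) i"
proof -
  have "((\<lambda>j. of_real (f j * g (i - j)) :: 'a) has_sum of_real (infsum (\<lambda>j. f j * g (i - j)) UNIV)) UNIV"
    by (rule has_sum_bounded_linear[OF bounded_linear_of_real has_sum_infsum[OF conv_abs_summable[OF assms]]])
  then show ?thesis by (simp add: conv_def emb_def infsumI)
qed

text \<open>Real multiples of \<open>1\<close> are central, so the two sums agree term by term after
  \<open>j \<mapsto> i - j\<close>, convergent or not.\<close>

lemma emb_commute: "emb f \<star> G = G \<star> (emb f :: int \<Rightarrow> 'a::real_normed_algebra_1)"
proof
  fix i
  have "(\<Sum>\<^sub>\<infinity>j. emb f j * G (i - j)) = (\<Sum>\<^sub>\<infinity>j. G j * emb f (i - j))"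
    by (subst infsum_reindex_bij_betw[OF bij_diff_int[of i], symmetric])
      (simp add: emb_def of_real_def)
  then show "(emb f \<star> G) i = (G \<star> emb f) i" by (simp add: conv_def)
qed

lemma cross_pole_bound:
  assumes "0 < d" "d < (1 / 2 :: real)"
  shows "1 / \<bar>of_int m - d\<bar> \<le> 2 / d * wt 1 m"
proof -
  have "d / 2 * (1 + \<bar>of_int m\<bar>) \<le> \<bar>of_int m - d\<bar>"
  proof (cases m "0 :: int" rule: linorder_cases)
    case greater
    then have m: "1 \<le> real_of_int m" by simp
    have "d * (1 + real_of_int m) \<le> 1 / 2 * (1 + of_int m)" using assms m by (intro mult_right_mono) auto
    then show ?thesis using assms m by (simp add: field_simps)
  next
    case less
    then have m: "real_of_int m \<le> - 1" by simp
    have "d * (1 - real_of_int m) \<le> 1 / 2 * (1 - of_int m)" using assms m by (intro mult_right_mono) auto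
    then show ?thesis using assms m by (simp add: field_simps)
  qed (use assms in auto)
  moreover have "d / 2 * (1 + \<bar>of_int m\<bar>) > 0" using assms by (intro mult_pos_pos) auto
  ultimately have "1 / \<bar>of_int m - d\<bar> \<le> 1 / (d / 2 * (1 + \<bar>of_int m\<bar>))"
    by (intro frac_le) auto
  then show ?thesis by (simp add: wt_def powr_minus_divide)
qed

text \<open>Up to sign the phase function is a smooth \<open>V\<close> times the scalar phase.
  Convolving \<open>sin (pi d) / (pi (d - j))\<close> with a fast decaying \<open>V\<close> leaves
  \<open>- sin (pi d) / (pi j)\<close> times the sum of \<open>V\<close>, up to
  \<open>O(1 / j^2)\<close>; that sum is the value of \<open>V\<close> at \<open>1\<close>, of norm
  at most 1.\<close>

lemma phase_bound:
  fixes G H :: "int \<Rightarrow> 'a::cstar_algebra"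
  assumes d: "0 < d" "d < 1 / 2" and G: "dec 4 G" and H: "dec 4 H"
    and unit: "norm (infsum G UNIV * infsum (star H) UNIV) \<le> 1"
  shows "\<exists>\<theta><1. \<exists>N. \<forall>j\<ge>N. pi * of_int j *
    norm (((\<lambda>k. - (emb (bcoef d) \<star> G) k) \<star> star (emb (bcoef (- d)) \<star> H)) j) \<le> \<theta>"
proof -
  let ?\<alpha> = "emb (bcoef d) :: int \<Rightarrow> 'a" and ?c = "emb (bcoef (- d)) :: int \<Rightarrow> 'a"
  have lG: "l1 G" and lH: "l1 (star H)" and l\<alpha>: "l1 ?\<alpha>" and bc: "bdd (star ?c)"
    using l1_dec[OF G] l1_dec[of 4 "star H"] H l1_dec[of "1 + d" ?\<alpha>] bdd_dec[of "1 - d" "star ?c"] dec_bcoef_d[OF d] d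
    by simp_all
  define V where "V = G \<star> star H"
  have dV: "dec 4 V" unfolding V_def by (rule dec_conv[OF G, of 4]) (use H in auto)
  have \<alpha>c: "?\<alpha> \<star> star ?c = emb (cross d)"
    using emb_conv[where 'a = 'a, OF conv_bdd_abs[OF conv_bdd_dec[OF dec_bcoef_d(1)[OF d] dec_bcoef_d(3)[OF d]]]] d
    by (simp add: fun_eq_iff star_emb cross_def)
  \<comment> \<open>Real scalar sequences commute with all others, so the two binomial factors can
    be brought together and replaced by \<open>cross d\<close>.\<close>
  have main: "((?\<alpha> \<star> G) \<star> star (?c \<star> H)) j = (V \<star> emb (cross d)) j" for j
  proof -
    have st: "star (?c \<star> H) = star H \<star> star ?c"
      by (rule ext, rule star_conv[OF conv_bdd_abs[OF conv_bddI2]]) (use bc lH in auto)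
    have b1: "bdd (star H \<star> star ?c)" by (rule bdd_conv[OF conv_bddI1[OF lH bc]])
    have b2: "bdd (?\<alpha> \<star> star ?c)" by (rule bdd_conv[OF conv_bddI1[OF l\<alpha> bc]])
    have "(?\<alpha> \<star> G \<star> (star H \<star> star ?c)) j = (G \<star> ?\<alpha> \<star> (star H \<star> star ?c)) j"
      by (simp only: emb_commute)
    also have "\<dots> = (G \<star> (?\<alpha> \<star> (star H \<star> star ?c))) j"
      by (rule conv_assoc[OF conv3_absI_left[OF lG conv_bddI1[OF l\<alpha> b1]]])
    also have "?\<alpha> \<star> (star H \<star> star ?c) = star H \<star> (?\<alpha> \<star> star ?c)"
    proof
      fix i
      have "(?\<alpha> \<star> (star H \<star> star ?c)) i = (?\<alpha> \<star> star H \<star> star ?c) i"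
        by (rule conv_assoc[OF conv3_absI_left[OF l\<alpha> conv_bddI1[OF lH bc]], symmetric])
      also have "\<dots> = (star H \<star> ?\<alpha> \<star> star ?c) i" by (simp only: emb_commute)
      also have "\<dots> = (star H \<star> (?\<alpha> \<star> star ?c)) i"
        by (rule conv_assoc[OF conv3_absI_left[OF lH conv_bddI1[OF l\<alpha> bc]]])
      finally show "(?\<alpha> \<star> (star H \<star> star ?c)) i = (star H \<star> (?\<alpha> \<star> star ?c)) i" .
    qed
    also have "(G \<star> (star H \<star> (?\<alpha> \<star> star ?c))) j = (V \<star> (?\<alpha> \<star> star ?c)) j"
      unfolding V_def by (rule conv_assoc[OF conv3_absI_left[OF lG conv_bddI1[OF lH b2]], symmetric])
    finally show ?thesis by (simp add: \<alpha>c st)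
  qed
  have conv_const: "(f \<star> (\<lambda>_. x)) i = infsum f UNIV * x" if "l1 f" for f :: "int \<Rightarrow> 'a" and x i
    unfolding conv_def using abs_summable_summable[of f UNIV] that by (simp add: infsum_cmult_left l1_def)
  \<comment> \<open>Convolution with the constant sequence \<open>1\<close> evaluates a generating
    series at \<open>1\<close>; associativity makes this multiplicative.\<close>
  have sumV: "infsum V UNIV = infsum G UNIV * infsum (star H) UNIV"
  proof -
    have "(V \<star> (\<lambda>_. 1)) 0 = (G \<star> (star H \<star> (\<lambda>_. 1))) 0"
      unfolding V_def
      by (rule conv_assoc[OF conv3_absI_left[OF lG conv_bddI1[OF lH]]]) (auto simp: bdd_def)
    moreover have "star H \<star> (\<lambda>_. 1) = (\<lambda>_. infsum (star H) UNIV)"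
      using conv_const[OF lH, of 1] by (simp add: fun_eq_iff)
    moreover have "l1 V" using l1_dec[OF dV] by simp
    ultimately show ?thesis by (simp add: conv_const lG)
  qed
  define \<sigma> where "\<sigma> = sin (pi * d)"
  have \<sigma>: "0 \<le> \<sigma>" "\<sigma> < 1"
  proof -
    show "0 \<le> \<sigma>" unfolding \<sigma>_def by (rule sin_ge_zero) (use d in auto)
    have "sin (pi * d) < sin (pi / 2)" by (rule sin_monotone_2pi) (use d pi_gt_zero in \<open>auto simp: field_simps intro: order_trans[of _ 0]\<close>)
    then show "\<sigma> < 1" by (simp add: \<sigma>_def)
  qed
  obtain D where D: "D > 0" "\<And>k. norm (V k) \<le> D * wt 4 k" using decE[OF dV] by blast
  define W where "W = infsum (wt 2) UNIV"
  have W: "wt 2 summable_on UNIV" by (rule summable_on_wt) simp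
  have W0: "W \<ge> 0" unfolding W_def by (rule infsum_nonneg) simp
  define E where "E = \<sigma> * (D * (2 / d))"
  have bound: "pi * of_int j * norm ((V \<star> emb (cross d)) j) \<le> \<sigma> + E * W * wt 1 j" if j: "j \<ge> 1" for j
  proof -
    have ca: "conv_abs V (emb (cross d)) j"
    proof -
      have "dec (1 - d) (cross d)"
        unfolding cross_def by (rule dec_conv[OF dec_bcoef_d(1,3)[OF d]]) (use d in auto)
      then show ?thesis by (intro conv_bdd_abs[OF conv_bddI1[OF l1_dec[OF dV]]] bdd_dec[of "1 - d"]) (use d in auto)
    qed
    \<comment> \<open>A term of \<open>pi * j\<close> times the convolution minus its limit
      \<open>- \<sigma> * V k\<close>; the difference has an extra factor of order
      \<open>1 / j\<close>.\<close>
    define T where "T = (\<lambda>k. (pi * of_int j) *\<^sub>R (V k * emb (cross d) (j - k)) + \<sigma> *\<^sub>R V k)"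
    have sV: "V summable_on UNIV" using abs_summable_summable[of V UNIV] l1_dec[OF dV] by (simp add: l1_def)
    have "infsum T UNIV = (pi * of_int j) *\<^sub>R (V \<star> emb (cross d)) j + \<sigma> *\<^sub>R infsum V UNIV"
      unfolding T_def conv_def
      by (subst infsum_add) (auto intro!: summable_on_scaleR_right conv_abs_summable[OF ca] sV simp: infsum_scaleR_right)
    moreover have "norm (infsum T UNIV) \<le> (\<Sum>\<^sub>\<infinity>k. (E * wt 1 j) * wt 2 k)"
    proof (rule norm_infsum_le)
      show "(T has_sum infsum T UNIV) UNIV"
        unfolding T_def by (intro has_sum_infsum summable_on_add summable_on_scaleR_right conv_abs_summable[OF ca] sV)
      show "((\<lambda>k. (E * wt 1 j) * wt 2 k) has_sum (\<Sum>\<^sub>\<infinity>k. (E * wt 1 j) * wt 2 k)) UNIV"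
        by (intro has_sum_infsum summable_on_cmult_right W)
      fix k
      have ne: "of_int (j - k) - d \<noteq> 0"
      proof
        assume "of_int (j - k) - d = 0"
        then have "0 < real_of_int (j - k)" "real_of_int (j - k) < 1" using d by linarith+
        then have "0 < j - k" "j - k < 1" by (simp_all only: of_int_0_less_iff of_int_less_1_iff)
        then show False by simp
      qed
      have "T k = ((pi * of_int j) * cross d (j - k) + \<sigma>) *\<^sub>R V k"
        by (simp add: T_def emb_def scaleR_add_left of_real_def)
      also have "(pi * of_int j) * cross d (j - k) + \<sigma> = - \<sigma> * (of_int k + d) / (of_int (j - k) - d)"
        using ne unfolding cross_eq[OF d] \<sigma>_def[symmetric]
        by (simp add: divide_simps) (simp add: algebra_simps)
      finally have "norm (T k) = \<sigma> * \<bar>of_int k + d\<bar> * (1 / \<bar>of_int (j - k) - d\<bar>) * norm (V k)"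
        using \<sigma>(1) by (simp add: abs_mult)
      also have "\<dots> \<le> \<sigma> * wt (- 1) k * (2 / d * (wt 1 j * wt (- 1) k)) * (D * wt 4 k)"
      proof -
        have "\<bar>of_int k + d\<bar> \<le> wt (- 1) k" using d by (simp add: wt_def) 
        moreover have "1 / \<bar>of_int (j - k) - d\<bar> \<le> 2 / d * (wt 1 j * wt (- 1) k)"
          by (rule order_trans[OF cross_pole_bound[OF d] mult_left_mono[OF wt_peetre]]) (use d in auto)
        ultimately show ?thesis using \<sigma>(1) D d by (intro mult_mono) auto
      qed
      \<comment> \<open>The rate 4 of \<open>V\<close> pays one power for \<open>k + d\<close> and
        one for Peetre's inequality, and leaves the summable exponent 2.\<close>
      also have "\<dots> = E * wt 1 j * wt (- 1 + (- 1 + 4)) k"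
        unfolding wt_add E_def by (simp add: mult_ac)
      finally show "norm (T k) \<le> (E * wt 1 j) * wt 2 k" by simp
    qed
    ultimately have "norm ((pi * of_int j) *\<^sub>R (V \<star> emb (cross d)) j + \<sigma> *\<^sub>R infsum V UNIV) \<le> E * wt 1 j * W"
      by (simp add: infsum_cmult_right' W_def)
    moreover have "norm (\<sigma> *\<^sub>R infsum V UNIV) \<le> \<sigma>"
      using unit \<sigma>(1) by (simp add: sumV mult_left_le)
    moreover have "norm ((pi * of_int j) *\<^sub>R (V \<star> emb (cross d)) j)
        \<le> norm ((pi * of_int j) *\<^sub>R (V \<star> emb (cross d)) j + \<sigma> *\<^sub>R infsum V UNIV) + norm (\<sigma> *\<^sub>R infsum V UNIV)"
      using norm_triangle_ineq4[of "(pi * of_int j) *\<^sub>R (V \<star> emb (cross d)) j + \<sigma> *\<^sub>R infsum V UNIV" "\<sigma> *\<^sub>R infsum V UNIV"] by simp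
    ultimately show ?thesis using j by (simp add: abs_mult mult_ac)
  qed
  \<comment> \<open>The midpoint of \<open>\<sigma>\<close> and 1: half of the gap is reserved for
    the error term.\<close>
  define \<theta> where "\<theta> = (1 + \<sigma>) / 2"
  have "\<exists>N\<ge>1. \<forall>j\<ge>N. E * W * wt 1 j \<le> (1 - \<sigma>) / 2"
  proof (intro exI conjI allI impI)
    let ?N = "max 1 \<lceil>E * W * 2 / (1 - \<sigma>)\<rceil>"
    show "1 \<le> ?N" by simp
    fix j assume j: "?N \<le> j"
    have "E * W * 2 / (1 - \<sigma>) \<le> of_int j" using j by linarith
    then have "E * W * 2 \<le> (1 + of_int j) * (1 - \<sigma>)" using \<sigma> by (simp add: field_simps)
    moreover have "real_of_int j \<ge> 1" using j by simp
    ultimately show "E * W * wt 1 j \<le> (1 - \<sigma>) / 2"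
      by (simp add: wt_def powr_minus_divide field_simps)
  qed
  then obtain N where N: "N \<ge> 1" "\<And>j. j \<ge> N \<Longrightarrow> E * W * wt 1 j \<le> (1 - \<sigma>) / 2" by blast
  have "pi * of_int j * norm (((\<lambda>k. - (?\<alpha> \<star> G) k) \<star> star (?c \<star> H)) j) \<le> \<theta>" if "j \<ge> N" for j
  proof -
    have "norm (((\<lambda>k. - (?\<alpha> \<star> G) k) \<star> star (?c \<star> H)) j) = norm ((V \<star> emb (cross d)) j)"
      unfolding conv_minus_left norm_minus_cancel main ..
    then have "pi * of_int j * norm (((\<lambda>k. - (?\<alpha> \<star> G) k) \<star> star (?c \<star> H)) j) \<le> \<sigma> + E * W * wt 1 j"
      using bound[of j] N(1) that by simp
    also have "\<dots> \<le> \<sigma> + (1 - \<sigma>) / 2" using N(2)[OF that] by simp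
    also have "\<dots> = \<theta>" by (simp add: \<theta>_def field_simps)
    finally show ?thesis .
  qed
  moreover have "\<theta> < 1" using \<sigma> by (simp add: \<theta>_def)
  ultimately show ?thesis by blast
qed

section \<open>The \<open>C\<^sup>*\<close>-algebra of complex matrices\<close>

lemma bounded_linear_matrix_vector_mult: "bounded_linear (\<lambda>v. (A :: complex^'q::finite^'q) *v v)"
  unfolding linear_conv_bounded_linear[symmetric]
  by (rule linearI) (simp_all add: vec_eq_iff matrix_vector_mult_def sum.distrib algebra_simps scaleR_sum_right)

lemma norm_matrix_vector_le: "norm (A *v v) \<le> spectral_norm A * norm v"
  unfolding spectral_norm_def by (rule onorm[OF bounded_linear_matrix_vector_mult])

lemma spectral_norm_leI: "(\<And>v. norm (A *v v) \<le> b * norm v) \<Longrightarrow> spectral_norm A \<le> b"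
  unfolding spectral_norm_def by (rule onorm_le)

lemma spectral_norm_nonneg: "spectral_norm A \<ge> 0"
  unfolding spectral_norm_def by (rule onorm_pos_le[OF bounded_linear_matrix_vector_mult])

lemma norm_entry_le: "norm (A $ i $ j) \<le> spectral_norm A"
proof -
  have "norm (A $ i $ j) = norm ((A *v axis j 1) $ i)"
    by (simp add: matrix_vector_mult_def axis_def if_distrib[of "\<lambda>x. A $ i $ _ * x"] cong: if_cong)
  also have "\<dots> \<le> norm (A *v axis j 1)" by (rule Finite_Cartesian_Product.norm_nth_le)
  also have "\<dots> \<le> spectral_norm A * norm (axis j 1 :: complex^'a)" by (rule norm_matrix_vector_le)
  finally show ?thesis by (simp add: norm_axis_1)
qed

text \<open>Together with \<open>norm_entry_le\<close> it makes convergence in the spectral norm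
  entrywise, from which completeness follows.\<close>

lemma spectral_norm_le_entries: "spectral_norm A \<le> (\<Sum>i\<in>UNIV. \<Sum>j\<in>UNIV. norm (A $ i $ j))"
proof (rule spectral_norm_leI)
  fix v
  have "norm (A *v v) \<le> (\<Sum>i\<in>UNIV. norm ((A *v v) $ i))"
    unfolding norm_vec_def by (rule L2_set_le_sum) simp
  also have "\<dots> \<le> (\<Sum>i\<in>UNIV. \<Sum>j\<in>UNIV. norm (A $ i $ j) * norm v)"
  proof (rule sum_mono)
    fix i
    have "norm ((A *v v) $ i) \<le> (\<Sum>j\<in>UNIV. norm (A $ i $ j * v $ j))"
      unfolding matrix_vector_mult_def by (simp add: norm_sum)
    also have "\<dots> \<le> (\<Sum>j\<in>UNIV. norm (A $ i $ j) * norm v)"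
      by (rule sum_mono) (auto simp: norm_mult intro!: mult_left_mono Finite_Cartesian_Product.norm_nth_le)
    finally show "norm ((A *v v) $ i) \<le> (\<Sum>j\<in>UNIV. norm (A $ i $ j) * norm v)" .
  qed
  finally show "norm (A *v v) \<le> (\<Sum>i\<in>UNIV. \<Sum>j\<in>UNIV. norm (A $ i $ j)) * norm v"
    by (simp add: sum_distrib_right)
qed

lemma hconj_nth: "hconj A $ i $ j = cnj (A $ j $ i)"
  by (simp add: hconj_def map_matrix_def transpose_def)

text \<open>This inner product is the real part of the Hermitian one; it induces the same norm, and
  \<open>hconj\<close> is still the adjoint.\<close>

lemma inner_matrix_vector: "inner (A *v x) y = inner x (hconj A *v y)"
proof -
  have inner_complex: "inner u v = Re (cnj u * v)" for u v :: complex
    by (simp add: inner_complex_def)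
  have "inner (A *v x) y = Re (\<Sum>i\<in>UNIV. \<Sum>j\<in>UNIV. cnj (A $ i $ j) * cnj (x $ j) * y $ i)"
    unfolding inner_vec_def inner_complex by (simp add: matrix_vector_mult_def sum_distrib_right)
  also have "(\<Sum>i\<in>UNIV. \<Sum>j\<in>UNIV. cnj (A $ i $ j) * cnj (x $ j) * y $ i)
      = (\<Sum>j\<in>UNIV. \<Sum>i\<in>UNIV. cnj (A $ i $ j) * cnj (x $ j) * y $ i)" by (rule sum.swap)
  also have "Re \<dots> = inner x (hconj A *v y)"
    unfolding inner_vec_def inner_complex
    by (simp add: matrix_vector_mult_def hconj_nth sum_distrib_left mult_ac)
  finally show ?thesis .
qed

lemma hconj_mult: "hconj (A ** B) = hconj B ** hconj A"
  by (simp add: vec_eq_iff hconj_nth matrix_matrix_mult_def mult.commute)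

lemma hconj_hconj [simp]: "hconj (hconj A) = A"
  by (simp add: vec_eq_iff hconj_nth)

lemma spectral_norm_mult_le: "spectral_norm (A ** B) \<le> spectral_norm A * spectral_norm B"
proof (rule spectral_norm_leI)
  fix v
  have "norm (A *v (B *v v)) \<le> spectral_norm A * (spectral_norm B * norm v)"
    by (rule order_trans[OF norm_matrix_vector_le mult_left_mono[OF norm_matrix_vector_le spectral_norm_nonneg]])
  then show "norm (A ** B *v v) \<le> spectral_norm A * spectral_norm B * norm v"
    by (simp add: matrix_vector_mul_assoc mult.assoc)
qed

text \<open>Cauchy-Schwarz in \<open>|A v|^2 = inner v (hconj A A v)\<close> bounds the square of
  the norm of \<open>A\<close> by the left side. This implies that \<open>A\<close> and
  \<open>hconj A\<close> have the same norm, and then submultiplicativity gives the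
  converse.\<close>

lemma spectral_norm_hconj_mult: "spectral_norm (hconj A ** A) = (spectral_norm A)\<^sup>2"
proof -
  have *: "(spectral_norm A)\<^sup>2 \<le> spectral_norm (hconj A ** A)" for A :: "complex^'a^'a"
  proof -
    have "norm (A *v v) \<le> sqrt (spectral_norm (hconj A ** A)) * norm v" for v
    proof -
      have "(norm (A *v v))\<^sup>2 = inner v (hconj A ** A *v v)"
        by (simp add: power2_norm_eq_inner inner_matrix_vector matrix_vector_mul_assoc)
      also have "\<dots> \<le> norm v * norm (hconj A ** A *v v)" by (rule norm_cauchy_schwarz)
      also have "\<dots> \<le> norm v * (spectral_norm (hconj A ** A) * norm v)"
        by (intro mult_left_mono norm_matrix_vector_le) simp
      also have "\<dots> = (sqrt (spectral_norm (hconj A ** A)) * norm v)\<^sup>2"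
        by (simp add: power_mult_distrib spectral_norm_nonneg power2_eq_square)
      finally show ?thesis
        by (rule power2_le_imp_le) (simp add: spectral_norm_nonneg)
    qed
    then have "spectral_norm A \<le> sqrt (spectral_norm (hconj A ** A))" by (rule spectral_norm_leI)
    from power_mono[OF this spectral_norm_nonneg, of 2] show ?thesis by (simp add: spectral_norm_nonneg)
  qed
  have le: "spectral_norm A \<le> spectral_norm (hconj A)" for A :: "complex^'a^'a"
  proof (cases "spectral_norm A = 0")
    case False
    have "spectral_norm A * spectral_norm A \<le> spectral_norm (hconj A) * spectral_norm A"
      using order_trans[OF *[of A] spectral_norm_mult_le] by (simp add: power2_eq_square)
    with False show ?thesis using spectral_norm_nonneg[of A] by simp
  qed (simp add: spectral_norm_nonneg)
  have "spectral_norm (hconj A ** A) \<le> spectral_norm (hconj A) * spectral_norm A"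
    by (rule spectral_norm_mult_le)
  also have "\<dots> \<le> (spectral_norm A)\<^sup>2"
    using le[of "hconj A"] by (simp add: power2_eq_square mult_right_mono spectral_norm_nonneg)
  finally show ?thesis using *[of A] by simp
qed

text \<open>A type of its own, because \<open>complex^'q^'q\<close> already carries the Frobenius
  norm and the componentwise product.\<close>

typedef 'q cmat = "UNIV :: (complex^'q^'q) set"
  morphisms mat_of Cmat by simp

setup_lifting type_definition_cmat

instantiation cmat :: (finite) real_normed_algebra_1
begin

lift_definition zero_cmat :: "'a cmat" is 0 .
lift_definition one_cmat :: "'a cmat" is "mat 1" .
lift_definition plus_cmat :: "'a cmat \<Rightarrow> 'a cmat \<Rightarrow> 'a cmat" is "(+)" .
lift_definition minus_cmat :: "'a cmat \<Rightarrow> 'a cmat \<Rightarrow> 'a cmat" is "(-)" .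
lift_definition uminus_cmat :: "'a cmat \<Rightarrow> 'a cmat" is "uminus" .
lift_definition times_cmat :: "'a cmat \<Rightarrow> 'a cmat \<Rightarrow> 'a cmat" is "(**)" .
lift_definition scaleR_cmat :: "real \<Rightarrow> 'a cmat \<Rightarrow> 'a cmat" is "(*\<^sub>R)" .
lift_definition norm_cmat :: "'a cmat \<Rightarrow> real" is spectral_norm .

definition dist_cmat :: "'a cmat \<Rightarrow> 'a cmat \<Rightarrow> real" where "dist_cmat x y = norm (x - y)"
definition sgn_cmat :: "'a cmat \<Rightarrow> 'a cmat" where "sgn_cmat x = inverse (norm x) *\<^sub>R x"
definition uniformity_cmat :: "('a cmat \<times> 'a cmat) filter" where
  "uniformity_cmat = (INF e\<in>{0<..}. principal {(x, y). dist x y < e})"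
definition open_cmat :: "'a cmat set \<Rightarrow> bool" where
  "open_cmat U \<longleftrightarrow> (\<forall>x\<in>U. \<forall>\<^sub>F (x', y) in uniformity. x' = x \<longrightarrow> y \<in> U)"

instance
proof
  fix x y z :: "'a cmat" and r s :: real and U :: "'a cmat set"
  show "x + y + z = x + (y + z)" "x + y = y + x" "0 + x = x" "- x + x = 0" "x - y = x + - y"
    by (transfer; simp add: algebra_simps)+
  show "r *\<^sub>R (x + y) = r *\<^sub>R x + r *\<^sub>R y" "(r + s) *\<^sub>R x = r *\<^sub>R x + s *\<^sub>R x"
    "r *\<^sub>R s *\<^sub>R x = (r * s) *\<^sub>R x" "1 *\<^sub>R x = x"
    by (transfer; simp add: algebra_simps)+
  show "(x + y) * z = x * z + y * z" "x * (y + z) = x * y + x * z"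
    by (transfer; simp add: vec_eq_iff matrix_matrix_mult_def distrib_left distrib_right sum.distrib)+
  show "x * y * z = x * (y * z)" "1 * x = x" "x * 1 = x"
    by (transfer; simp add: matrix_mul_assoc)+
  show "r *\<^sub>R x * y = r *\<^sub>R (x * y)" "x * r *\<^sub>R y = r *\<^sub>R (x * y)"
    by (transfer; simp add: scalar_matrix_assoc matrix_scalar_ac vec_eq_iff matrix_matrix_mult_def scaleR_sum_right)+
  show "(0 :: 'a cmat) \<noteq> 1"
    by transfer (auto simp: vec_eq_iff mat_def)
  show "dist x y = norm (x - y)" by (rule dist_cmat_def)
  show "sgn x = inverse (norm x) *\<^sub>R x" by (rule sgn_cmat_def)
  show "uniformity = (INF e\<in>{0<..}. principal {(x, y :: 'a cmat). dist x y < e})" by (rule uniformity_cmat_def)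
  show "open U = (\<forall>x\<in>U. \<forall>\<^sub>F (x', y) in uniformity. x' = x \<longrightarrow> y \<in> U)" by (rule open_cmat_def)
  show "(norm x = 0) = (x = 0)"
  proof transfer
    fix A :: "complex^'a^'a"
    have "A = 0" if "spectral_norm A = 0"
      using norm_entry_le[of A] that by (simp add: vec_eq_iff)
    moreover have "spectral_norm (0 :: complex^'a^'a) = 0"
      using spectral_norm_le_entries[of "0 :: complex^'a^'a"] spectral_norm_nonneg[of "0 :: complex^'a^'a"] by simp
    ultimately show "(spectral_norm A = 0) = (A = 0)" by auto
  qed
  show "norm (x + y) \<le> norm x + norm y"
  proof transfer
    fix A B :: "complex^'a^'a"
    show "spectral_norm (A + B) \<le> spectral_norm A + spectral_norm B"
      unfolding spectral_norm_def matrix_vector_mult_add_rdistrib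
      by (rule onorm_triangle[OF bounded_linear_matrix_vector_mult bounded_linear_matrix_vector_mult])
  qed
  show "norm (r *\<^sub>R x) = \<bar>r\<bar> * norm x"
  proof transfer
    fix r and A :: "complex^'a^'a"
    have "(\<lambda>v. (r *\<^sub>R A) *v v) = (\<lambda>v. r *\<^sub>R (A *v v))"
      by (simp add: fun_eq_iff vec_eq_iff matrix_vector_mult_def scaleR_sum_right)
    then show "spectral_norm (r *\<^sub>R A) = \<bar>r\<bar> * spectral_norm A"
      unfolding spectral_norm_def by (simp add: onorm_scaleR[OF bounded_linear_matrix_vector_mult])
  qed
  show "norm (x * y) \<le> norm x * norm y" by transfer (rule spectral_norm_mult_le)
  show "norm (1 :: 'a cmat) = 1"
    by transfer (simp add: spectral_norm_def onorm_id)
qed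

end

lemma mat_of_simps [simp]:
  "mat_of 0 = 0" "mat_of 1 = mat 1" "mat_of (x + y) = mat_of x + mat_of y" "mat_of (x - y) = mat_of x - mat_of y"
  "mat_of (- x) = - mat_of x" "mat_of (x * y) = mat_of x ** mat_of y" "mat_of (r *\<^sub>R x) = r *\<^sub>R mat_of x"
  by (transfer; simp)+

lemma mat_of_eq_iff: "x = y \<longleftrightarrow> mat_of x = mat_of y"
  by (simp add: mat_of_inject)

lemma mat_of_Cmat [simp]: "mat_of (Cmat A) = A"
  by (simp add: Cmat_inverse)

lemma Cmat_mat_of [simp]: "Cmat (mat_of x) = x"
  by (rule mat_of_inverse)

lemma norm_cmat_eq: "norm x = spectral_norm (mat_of x)"
  by transfer simp

lemma bounded_linear_mat_of_nth: "bounded_linear (\<lambda>x :: 'q::finite cmat. mat_of x $ i $ j)"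
  by (rule bounded_linear_intro[where K = 1]) (auto simp: norm_cmat_eq norm_entry_le)

lemma norm_cmat_le_entries: "norm x \<le> (\<Sum>i\<in>UNIV. \<Sum>j\<in>UNIV. norm (mat_of x $ i $ j))"
  unfolding norm_cmat_eq by (rule spectral_norm_le_entries)

lemma tendsto_cmatI:
  fixes f :: "'a \<Rightarrow> 'q::finite cmat"
  assumes "\<And>i j. ((\<lambda>x. mat_of (f x) $ i $ j) \<longlongrightarrow> mat_of l $ i $ j) F"
  shows "(f \<longlongrightarrow> l) F"
proof (rule Lim_null[THEN iffD2], rule tendsto_norm_zero_cancel, rule Lim_null_comparison)
  show "\<forall>\<^sub>F x in F. norm (norm (f x - l)) \<le> (\<Sum>i\<in>UNIV. \<Sum>j\<in>UNIV. norm (mat_of (f x) $ i $ j - mat_of l $ i $ j))"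
    using norm_cmat_le_entries[of "f _ - l"] by simp
  have "((\<lambda>x. \<Sum>i\<in>UNIV. \<Sum>j\<in>UNIV. norm (mat_of (f x) $ i $ j - mat_of l $ i $ j)) \<longlongrightarrow> (\<Sum>i\<in>(UNIV::'q set). \<Sum>j\<in>(UNIV::'q set). 0)) F"
  proof (intro tendsto_sum)
    fix i j
    show "((\<lambda>x. norm (mat_of (f x) $ i $ j - mat_of l $ i $ j)) \<longlongrightarrow> 0) F"
      by (rule tendsto_norm_zero, rule Lim_null[THEN iffD1], rule assms)
  qed
  then show "((\<lambda>x. \<Sum>i\<in>UNIV. \<Sum>j\<in>UNIV. norm (mat_of (f x) $ i $ j - mat_of l $ i $ j)) \<longlongrightarrow> 0) F"
    by simp
qed

instantiation cmat :: (finite) cstar_algebra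
begin

lift_definition adj_cmat :: "'a cmat \<Rightarrow> 'a cmat" is hconj .

instance
proof
  fix X :: "nat \<Rightarrow> 'a cmat"
  assume X: "Cauchy X"
  have "\<exists>l. (\<lambda>n. mat_of (X n) $ i $ j) \<longlonglongrightarrow> l" for i j
    using bounded_linear.Cauchy[OF bounded_linear_mat_of_nth X] by (simp add: Cauchy_convergent_iff convergent_def)
  then obtain L where L: "\<And>i j. (\<lambda>n. mat_of (X n) $ i $ j) \<longlonglongrightarrow> L i j" by metis
  have "X \<longlonglongrightarrow> Cmat (\<chi> i j. L i j)"
    by (rule tendsto_cmatI) (simp add: L)
  then show "convergent X" by (auto simp: convergent_def)
next
  fix x y :: "'a cmat" and r :: real
  show "adj (x + y) = adj x + adj y" "adj (r *\<^sub>R x) = r *\<^sub>R adj x"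
    by (transfer; simp add: vec_eq_iff hconj_nth)+
  show "adj (x * y) = adj y * adj x" by transfer (rule hconj_mult)
  show "adj (adj x) = x" by transfer simp
  show "norm (adj x * x) = (norm x)\<^sup>2" by transfer (rule spectral_norm_hconj_mult)
qed

end

lemma mat_of_adj [simp]: "mat_of (adj x) = hconj (mat_of x)"
  by transfer simp

lemma mat_of_sum: "mat_of (sum f A) = (\<Sum>x\<in>A. mat_of (f x))"
  by (induction A rule: infinite_finite_induct) auto

lemma sums_cmatI: "(\<And>i j. (\<lambda>k. mat_of (f k) $ i $ j) sums (mat_of S $ i $ j)) \<Longrightarrow> f sums S"
  unfolding sums_def by (rule tendsto_cmatI) (simp add: mat_of_sum)

no_notation fps_nth (infixl \<open>$\<close> 75)

section \<open>Power series of regular rational matrix functions\<close>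

lemma ball_in_open_superset_cball:
  fixes S :: "complex set"
  assumes "open S" "cball 0 1 \<subseteq> S"
  obtains R where "R > 1" "ball 0 R \<subseteq> S"
proof -
  obtain \<epsilon> where \<epsilon>: "\<epsilon> > 0" "{x. infdist x (cball 0 1) \<le> \<epsilon>} \<subseteq> S"
    using compact_in_open_separated[of "cball 0 1" S] assms by auto
  have "infdist z (cball 0 1) \<le> \<epsilon>" if z: "norm z < 1 + \<epsilon>" for z :: complex
  proof (cases "norm z \<le> 1")
    case False
    then have n: "norm z > 0" by linarith
    define y where "y = z / of_real (norm z)"
    have "norm y = 1" using n by (simp add: y_def norm_divide)
    then have "infdist z (cball 0 1) \<le> dist z y" by (intro infdist_le) simp
    also have "z - y = of_real (norm z - 1) * y" using n by (simp add: y_def field_simps)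
    then have "dist z y = \<bar>norm z - 1\<bar> * norm y" by (simp only: dist_norm norm_mult norm_of_real)
    then have "dist z y = norm z - 1" using False \<open>norm y = 1\<close> by simp
    finally show ?thesis using z by simp
  qed (use \<epsilon> in simp)
  with \<epsilon> show thesis by (intro that[of "1 + \<epsilon>"]) auto
qed

text \<open>Room beyond the closed disk makes quotients holomorphic on a larger disk, so that their
  coefficients decay geometrically.\<close>

lemma nonzero_on_larger_ball:
  assumes "F holomorphic_on ball 0 R" "R > 1" "\<And>z. z \<in> cball 0 1 \<Longrightarrow> F z \<noteq> 0"
  obtains R' where "R' > 1" "R' \<le> R" "\<And>z. z \<in> ball 0 R' \<Longrightarrow> F z \<noteq> 0"
proof -
  have "open (ball 0 R \<inter> F -` (- {0}))"
    by (rule continuous_open_preimage[OF holomorphic_on_imp_continuous_on[OF assms(1)]]) auto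
  moreover have "cball 0 1 \<subseteq> ball 0 R \<inter> F -` (- {0})" using assms by auto
  ultimately obtain R' where "R' > 1" "ball 0 R' \<subseteq> ball 0 R \<inter> F -` (- {0})"
    by (rule ball_in_open_superset_cball)
  then show thesis using assms(2) by (intro that[of "min R R'"]) auto
qed

lemma holomorphic_on_det:
  assumes "\<And>i j. F i j holomorphic_on S"
  shows "(\<lambda>z. det ((\<chi> i j. F i j z) :: complex^'q::finite^'q)) holomorphic_on S"
  unfolding det_def by (auto intro!: holomorphic_intros assms)

lemma mult_matrix_inv:
  fixes A :: "complex^'q::finite^'q"
  assumes "det A \<noteq> 0"
  shows "A ** matrix_inv A = mat 1" "matrix_inv A ** A = mat 1"
proof -
  have "\<exists>B. A ** B = mat 1 \<and> B ** A = mat 1"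
    using assms unfolding invertible_det_nz[symmetric] invertible_def .
  from someI_ex[OF this] show "A ** matrix_inv A = mat 1" "matrix_inv A ** A = mat 1"
    by (simp_all add: matrix_inv_def)
qed

lemma matrix_inv_unique:
  fixes A :: "complex^'q::finite^'q"
  assumes "A ** B = mat 1"
  shows "matrix_inv A = B"
proof -
  have "det A * det B = 1" using assms by (metis det_I det_mul)
  then have "det A \<noteq> 0" by auto
  then show ?thesis using assms mult_matrix_inv by (metis matrix_mul_assoc matrix_mul_lid matrix_mul_rid)
qed

text \<open>Cramer's rule, which exhibits the entries of the inverse as quotients of determinants
  and hence as holomorphic functions.\<close>

lemma matrix_inv_nth:
  fixes A :: "complex^'q::finite^'q"
  assumes "det A \<noteq> 0"
  shows "matrix_inv A $ i $ j = det (\<chi> k l. if l = i then axis j 1 $ k else A $ k $ l) / det A"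
proof -
  have "A *v (matrix_inv A *v axis j 1) = axis j 1"
    by (simp add: matrix_vector_mul_assoc mult_matrix_inv[OF assms])
  then have "matrix_inv A *v axis j 1 = (\<chi> k. det (\<chi> i l. if l = k then axis j 1 $ i else A $ i $ l) / det A)"
    by (rule cramer[OF assms, THEN iffD1])
  moreover have "(matrix_inv A *v axis j 1) $ i = matrix_inv A $ i $ j"
    by (simp add: matrix_vector_mult_def axis_def if_distrib[of "\<lambda>x. matrix_inv A $ i $ _ * x"] cong: if_cong)
  ultimately show ?thesis by simp
qed

text \<open>Convergence at a point \<open>\<rho> > 1\<close> gives geometric decay, weakened here to
  the rate 4 that the phase estimate consumes.\<close>

lemma holomorphic_coefficients:
  assumes F: "F holomorphic_on ball 0 R" and R: "R > 1"
  obtains u where "\<And>z. z \<in> cball 0 1 \<Longrightarrow> (\<lambda>k. u k * z ^ k) sums F z" "\<exists>C. \<forall>k. norm (u k) \<le> C * wt 4 (int k)"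
proof -
  define u where "u = (\<lambda>k. (deriv ^^ k) F 0 / fact k)"
  have s: "(\<lambda>k. u k * z ^ k) sums F z" if "norm z < R" for z
    using holomorphic_power_series[OF F, of z] that by (simp add: u_def)
  define \<rho> where "\<rho> = (1 + R) / 2"
  have \<rho>: "1 < \<rho>" "\<rho> < R" using R by (auto simp: \<rho>_def)
  have "(\<lambda>k. u k * of_real \<rho> ^ k) \<longlonglongrightarrow> 0"
    using s[of "of_real \<rho>"] \<rho> by (intro summable_LIMSEQ_zero) (auto simp: sums_iff)
  then have "Bseq (\<lambda>k. u k * of_real \<rho> ^ k)" by (intro convergent_imp_Bseq convergentI)
  then obtain B where B: "B > 0" "\<And>k. norm (u k * of_real \<rho> ^ k) \<le> B" by (auto elim: BseqE)
  \<comment> \<open>By Bernoulli's inequality powers of the fourth root \<open>s\<close> dominate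
    \<open>m * (1 + k)\<close>; fourth powers then compare \<open>\<rho> ^ k\<close> with
    \<open>(1 + k) ^ 4\<close>.\<close>
  define s m where "s = root 4 \<rho>" and "m = min 1 (s - 1)"
  have sm: "s ^ 4 = \<rho>" "m > 0" using \<rho>(1) by (auto simp: s_def m_def)
  define D where "D = 1 / m ^ 4"
  have D: "norm ((1 + real k) ^ 4 / \<rho> ^ k) \<le> D" for k
  proof -
    have "m * (1 + real k) = m + real k * m" by (simp add: algebra_simps)
    also have "\<dots> \<le> 1 + real k * (s - 1)" by (intro add_mono mult_left_mono) (auto simp: m_def)
    also have "\<dots> \<le> (1 + (s - 1)) ^ k" by (rule Bernoulli_inequality) (use sm in \<open>simp add: m_def\<close>)
    finally have "(m * (1 + real k)) ^ 4 \<le> (s ^ k) ^ 4" using sm by (intro power_mono) auto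
    also have "(s ^ k) ^ 4 = \<rho> ^ k" unfolding sm(1)[symmetric] by (simp flip: power_mult add: mult.commute)
    finally have "m ^ 4 * (1 + real k) ^ 4 \<le> \<rho> ^ k" by (simp only: power_mult_distrib)
    then have "(1 + real k) ^ 4 / \<rho> ^ k \<le> D" using \<rho>(1) sm(2) by (simp add: D_def divide_simps mult.commute)
    then show ?thesis using \<rho>(1) by simp
  qed
  have "norm (u k) \<le> (B * D) * wt 4 (int k)" for k
  proof -
    have "norm (u k) = norm (u k * of_real \<rho> ^ k) * ((1 + real k) ^ 4 / \<rho> ^ k) * (1 / (1 + real k) ^ 4)"
      using \<rho>(1) by (simp add: norm_mult norm_power add_nonneg_eq_0_iff)
    also have "\<dots> \<le> B * D * (1 / (1 + real k) ^ 4)"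
      using B D[of k] \<rho>(1) by (intro mult_right_mono mult_mono) auto
    also have "1 / (1 + real k) ^ 4 = wt 4 (int k)"
      by (simp add: wt_def powr_minus_divide add_pos_nonneg)
    finally show ?thesis .
  qed
  then show thesis using s R by (intro that[of u]) auto
qed

lemma regular_rational_holomorphic:
  assumes "regular_rational (g :: complex \<Rightarrow> complex^'q::finite^'q)"
  obtains R F E where "R > 1" "\<And>i j. F i j holomorphic_on ball 0 R" "\<And>i j. E i j holomorphic_on ball 0 R"
    "\<And>z i j. z \<in> cball 0 1 \<Longrightarrow> g z $ i $ j = F i j z" "\<And>z i j. z \<in> cball 0 1 \<Longrightarrow> matrix_inv (g z) $ i $ j = E i j z"
proof -
  have ex: "\<exists>R>1. \<exists>f. f holomorphic_on ball 0 R \<and> (\<forall>z\<in>cball 0 1. g z $ i $ j = f z)" for i j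
  proof -
    obtain p r where pr: "\<And>z. z \<in> cball 0 1 \<Longrightarrow> poly r z \<noteq> 0 \<and> g z $ i $ j = poly p z / poly r z"
      using assms unfolding regular_rational_def by blast
    have h: "poly r holomorphic_on ball 0 2" by (auto intro: holomorphic_intros)
    obtain R where "R > 1" "R \<le> 2" "\<And>z. z \<in> ball 0 R \<Longrightarrow> poly r z \<noteq> 0"
      by (rule nonzero_on_larger_ball[OF h]) (use pr in auto)
    then show ?thesis
      using pr by (intro exI[of _ R] conjI exI[of _ "\<lambda>z. poly p z / poly r z"]) (auto intro!: holomorphic_intros)
  qed
  obtain S f where Sf: "\<And>i j. S i j > 1" "\<And>i j. f i j holomorphic_on ball 0 (S i j)"
    "\<And>i j z. z \<in> cball 0 1 \<Longrightarrow> g z $ i $ j = f i j z"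
    using ex by metis
  define R\<^sub>0 where "R\<^sub>0 = Min (range (\<lambda>(i, j). S i j))"
  have R0: "R\<^sub>0 > 1" using Sf(1) by (auto simp: R\<^sub>0_def)
  have R0_le: "R\<^sub>0 \<le> S i j" for i j
    unfolding R\<^sub>0_def by (rule Min_le, simp, rule range_eqI[of _ _ "(i, j)"]) simp
  have hol: "f i j holomorphic_on ball 0 R\<^sub>0" for i j
    by (rule holomorphic_on_subset[OF Sf(2)]) (use R0_le[of i j] in auto)
  have g_eq: "g z = (\<chi> i j. f i j z)" if "z \<in> cball 0 1" for z
    using Sf(3)[OF that] by (simp add: vec_eq_iff)
  let ?D = "\<lambda>z. det (\<chi> i j. f i j z)"
  have "?D z \<noteq> 0" if "z \<in> cball 0 1" for z
    using g_eq[OF that] assms that unfolding regular_rational_def by metis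
  then obtain R where R: "R > 1" "R \<le> R\<^sub>0" "\<And>z. z \<in> ball 0 R \<Longrightarrow> ?D z \<noteq> 0"
    by (rule nonzero_on_larger_ball[OF holomorphic_on_det[OF hol] R0]) auto
  have holR: "f i j holomorphic_on ball 0 R" for i j
    by (rule holomorphic_on_subset[OF hol]) (use R in auto)
  show thesis
  proof (rule that[OF R(1) holR])
    define E where "E = (\<lambda>i j z. det (\<chi> k l. if l = i then axis j 1 $ k else f k l z) / ?D z)"
    show "E i j holomorphic_on ball 0 R" for i j
      unfolding E_def
    proof (intro holomorphic_on_divide holomorphic_on_det holR)
      show "(\<lambda>z. if l = i then axis j 1 $ k else f k l z) holomorphic_on ball 0 R" for k l
        using holR by (cases "l = i") auto
    qed (use R(3) in auto)
    show "matrix_inv (g z) $ i $ j = E i j z" if z: "z \<in> cball 0 1" for z i j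
    proof -
      have "det (g z) \<noteq> 0" using assms z by (simp add: regular_rational_def)
      from matrix_inv_nth[OF this, of i j] show ?thesis
        unfolding E_def g_eq[OF z] by (simp cong: if_cong)
    qed
  qed (use Sf(3) in auto)
qed

lemma coefficient_sequence:
  assumes "R > 1" "\<And>i j. F i j holomorphic_on ball 0 R"
  obtains G :: "int \<Rightarrow> 'q::finite cmat" where "\<And>k. k < 0 \<Longrightarrow> G k = 0" "dec 4 G"
    "\<And>z i j. z \<in> cball 0 1 \<Longrightarrow> (\<lambda>k. mat_of (G (int k)) $ i $ j * z ^ k) sums F i j z"
proof -
  have "\<exists>u. (\<forall>z\<in>cball 0 1. (\<lambda>k. u k * z ^ k) sums F i j z) \<and> (\<exists>C. \<forall>k. norm (u k) \<le> C * wt 4 (int k))" for i j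
    using holomorphic_coefficients[OF assms(2)[of i j] assms(1)] by metis
  then obtain u where u: "\<And>i j z. z \<in> cball 0 1 \<Longrightarrow> (\<lambda>k. u i j k * z ^ k) sums F i j z"
    "\<And>i j. \<exists>C. \<forall>k. norm (u i j k) \<le> C * wt 4 (int k)" by metis
  then obtain C where C: "\<And>i j k. norm (u i j k) \<le> C i j * wt 4 (int k)" by metis
  define G :: "int \<Rightarrow> 'q cmat" where "G = (\<lambda>k. if k < 0 then 0 else Cmat (\<chi> i j. u i j (nat k)))"
  have C0: "C i j \<ge> 0" for i j using C[of i j 0] order_trans[OF norm_ge_zero] by fastforce
  have "norm (G k) \<le> (\<Sum>i\<in>UNIV. \<Sum>j\<in>UNIV. C i j) * wt 4 k" for k
  proof (cases "k < 0")
    case False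
    have "norm (G k) \<le> (\<Sum>i\<in>UNIV. \<Sum>j\<in>UNIV. norm (u i j (nat k)))"
      using norm_cmat_le_entries[of "G k"] False by (simp add: G_def)
    also have "\<dots> \<le> (\<Sum>i\<in>UNIV. \<Sum>j\<in>UNIV. C i j * wt 4 k)"
      using C[of _ _ "nat k"] False by (intro sum_mono) simp
    finally show ?thesis by (simp add: sum_distrib_right)
  qed (auto simp: G_def intro!: mult_nonneg_nonneg sum_nonneg C0)
  then have "dec 4 G" by (auto simp: dec_def)
  then show thesis using u(1) by (intro that[of G]) (auto simp: G_def)
qed

text \<open>Once the earlier coefficients vanish, dividing by \<open>x ^ k\<close> and letting
  \<open>x\<close> tend to \<open>0\<close> isolates \<open>f k\<close>. Real arguments keep the
  statement meaningful in any real Banach space.\<close>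

lemma powser_unique_aux:
  fixes f :: "nat \<Rightarrow> 'a::banach"
  assumes f: "\<And>x. 0 < x \<Longrightarrow> x < 1 \<Longrightarrow> (\<lambda>k. x ^ k *\<^sub>R f k) sums 0"
  shows "f k = 0"
proof (induction k rule: less_induct)
  case (less k)
  have "(\<lambda>k. (1 / 2 :: real) ^ k *\<^sub>R f k) \<longlonglongrightarrow> 0"
    using f[of "1 / 2"] by (intro summable_LIMSEQ_zero) (auto simp: sums_iff)
  then have "Bseq (\<lambda>k. (1 / 2 :: real) ^ k *\<^sub>R f k)" by (intro convergent_imp_Bseq convergentI)
  then obtain B where B: "B > 0" "\<And>k. norm ((1 / 2 :: real) ^ k *\<^sub>R f k) \<le> B" by (auto elim: BseqE)
  have fB: "norm (f m) \<le> B * 2 ^ m" for m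
    using B(2)[of m] by (simp add: field_simps power_divide)
  \<comment> \<open>Convergence at \<open>1 / 2\<close> bounds \<open>f m\<close> by
    \<open>B * 2 ^ m\<close>; with \<open>x < 1 / 4\<close> the remainder is dominated by a
    geometric series of ratio \<open>1 / 2\<close>.\<close>
  have le: "norm (f k) \<le> x * (B * 2 ^ (k + 2))" if x: "0 < x" "x < 1 / 4" for x :: real
  proof -
    have "(\<lambda>m. x ^ (m + k) *\<^sub>R f (m + k)) sums (0 - (\<Sum>i<k. x ^ i *\<^sub>R f i))"
      using f[of x] x by (intro sums_split_initial_segment) auto
    moreover have "(\<Sum>i<k. x ^ i *\<^sub>R f i) = 0" using less.IH by (intro sum.neutral) auto
    ultimately have "(\<lambda>m. inverse (x ^ k) *\<^sub>R (x ^ (m + k) *\<^sub>R f (m + k))) sums (inverse (x ^ k) *\<^sub>R 0)"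
      by (intro sums_scaleR_right) simp
    moreover have "(\<lambda>m. inverse (x ^ k) *\<^sub>R (x ^ (m + k) *\<^sub>R f (m + k))) = (\<lambda>m. x ^ m *\<^sub>R f (m + k))"
      using x by (simp add: power_add fun_eq_iff)
    ultimately have s: "(\<lambda>m. x ^ m *\<^sub>R f (m + k)) sums 0" by (simp only: scaleR_zero_right)
    then have "(\<lambda>m. x ^ Suc m *\<^sub>R f (Suc m + k)) sums (0 - f k)"
      using sums_Suc_iff[of "\<lambda>m. x ^ m *\<^sub>R f (m + k)" "- f k"] by simp
    then have "norm (f k) = norm (\<Sum>m. x ^ Suc m *\<^sub>R f (Suc m + k))" by (simp add: sums_iff)
    also have "\<dots> \<le> (\<Sum>m. (x * (B * 2 ^ (k + 1))) * (1 / 2) ^ m)"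
    proof (rule norm_suminf_le)
      show "summable (\<lambda>m. (x * (B * 2 ^ (k + 1))) * (1 / 2 :: real) ^ m)"
        by (intro summable_mult summable_geometric) simp
      fix m
      have "norm (x ^ Suc m *\<^sub>R f (Suc m + k)) \<le> x ^ Suc m * (B * 2 ^ (Suc m + k))"
        using x fB[of "Suc m + k"] by simp
      also have "\<dots> = (x * (B * 2 ^ (k + 1))) * (x * 2) ^ m"
        by (simp add: power_add power_mult_distrib)
      also have "\<dots> \<le> (x * (B * 2 ^ (k + 1))) * (1 / 2) ^ m"
        using x B(1) by (intro mult_left_mono power_mono) auto
      finally show "norm (x ^ Suc m *\<^sub>R f (Suc m + k)) \<le> (x * (B * 2 ^ (k + 1))) * (1 / 2) ^ m" .
    qed
    also have "\<dots> = x * (B * 2 ^ (k + 2))"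
      by (subst suminf_mult) (auto simp: suminf_geometric summable_geometric)
    finally show ?thesis .
  qed
  have "((\<lambda>x. x * (B * 2 ^ (k + 2))) \<longlongrightarrow> 0 * (B * 2 ^ (k + 2))) (at_right (0 :: real))"
    by (intro tendsto_intros)
  moreover have "\<forall>\<^sub>F x in at_right (0 :: real). norm (f k) \<le> x * (B * 2 ^ (k + 2))"
    using le eventually_at_right[of "0 :: real" "1 / 4"] by (auto intro!: exI[of _ "1 / 4 :: real"])
  ultimately have "norm (f k) \<le> 0"
    using tendsto_lowerbound[of "\<lambda>x. x * (B * 2 ^ (k + 2))" 0 "at_right (0 :: real)" "norm (f k)"] by simp
  then show ?case by simp
qed

lemma powser_unique:
  fixes f g :: "nat \<Rightarrow> 'a::banach"
  assumes "\<And>x. 0 < x \<Longrightarrow> x < 1 \<Longrightarrow> (\<lambda>k. x ^ k *\<^sub>R f k) sums s x"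
    and "\<And>x. 0 < x \<Longrightarrow> x < 1 \<Longrightarrow> (\<lambda>k. x ^ k *\<^sub>R g k) sums s x"
  shows "f = g"
proof
  fix k
  have "(\<lambda>k. x ^ k *\<^sub>R (f k - g k)) sums 0" if "0 < x" "x < 1" for x
    using sums_diff[OF assms[OF that]] by (simp add: scaleR_diff_right)
  from powser_unique_aux[OF this] show "f k = g k" by simp
qed

lemma conv_causal_nat:
  fixes f g :: "int \<Rightarrow> 'a::real_normed_algebra"
  assumes "\<And>k. k < 0 \<Longrightarrow> f k = 0" "\<And>k. k < 0 \<Longrightarrow> g k = 0"
  shows "(f \<star> g) (int k) = (\<Sum>l\<le>k. f (int l) * g (int (k - l)))"
proof -
  have "(f \<star> g) (int k) = (\<Sum>j\<in>{0..int k}. f j * g (int k - j))" by (rule conv_causal) (use assms in auto)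
  also have "\<dots> = (\<Sum>l\<le>k. f (int l) * g (int (k - l)))"
    by (rule sum.reindex_bij_witness[where i = int and j = nat]) (auto simp: of_nat_diff)
  finally show ?thesis .
qed

lemma causal_conv:
  fixes f g :: "int \<Rightarrow> 'a::real_normed_algebra"
  assumes "\<And>k. k < 0 \<Longrightarrow> f k = 0" "\<And>k. k < 0 \<Longrightarrow> g k = 0" "i < 0"
  shows "(f \<star> g) i = 0"
  using assms(3) by (simp add: conv_causal[OF assms(1,2)])

lemma conv_assoc_causal:
  fixes f g h :: "int \<Rightarrow> 'a::{real_normed_algebra, banach}"
  assumes "\<And>k. k < 0 \<Longrightarrow> f k = 0" "\<And>k. k < 0 \<Longrightarrow> g k = 0" "\<And>k. k < 0 \<Longrightarrow> h k = 0"
  shows "f \<star> g \<star> h = f \<star> (g \<star> h)"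
proof
  fix i
  show "(f \<star> g \<star> h) i = (f \<star> (g \<star> h)) i"
  proof (rule conv_assoc[OF conv3_absI_finite])
    show "finite ({0..i} \<times> {0..i})" by simp
    fix j k assume "(j, k) \<notin> {0..i} \<times> {0..i}"
    then show "f j = 0 \<or> g k = 0 \<or> h (i - j - k) = 0"
      using assms(1)[of j] assms(2)[of k] assms(3)[of "i - j - k"]
      by (cases "j < 0"; cases "k < 0") auto
  qed
qed

lemma summable_powser_bdd:
  fixes u :: "nat \<Rightarrow> complex"
  assumes "\<And>k. norm (u k) \<le> C" "norm z < 1"
  shows "summable (\<lambda>k. norm (u k * z ^ k))"
proof (rule summable_comparison_test')
  show "summable (\<lambda>k. C * norm z ^ k)" using assms(2) by (intro summable_mult summable_geometric) simp
  show "norm (norm (u k * z ^ k)) \<le> C * norm z ^ k" for k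
    using assms by (simp add: norm_mult norm_power mult_right_mono)
qed

lemma emb_conv_sums:
  fixes G :: "int \<Rightarrow> 'q::finite cmat"
  assumes r: "- 1 \<le> r" "r < 1" and G: "\<And>k. k < 0 \<Longrightarrow> G k = 0" "dec 4 G" and z: "norm z < 1"
    and M: "(\<lambda>k. mat_of (G (int k)) $ i $ j * z ^ k) sums M"
  shows "(\<lambda>k. mat_of ((emb (bcoef r) \<star> G) (int k)) $ i $ j * z ^ k) sums ((1 - z) powr of_real r * M)"
proof -
  obtain B where B: "\<And>k. norm (bcoef r k) \<le> B"
    using bddE[OF bdd_dec[OF dec_bcoef[OF r]]] r by auto
  obtain D where D: "\<And>k. norm (G k) \<le> D"
    using bddE[OF bdd_dec[OF G(2)]] by auto
  have 1: "summable (\<lambda>k. norm (of_real (bcoef r (int k)) * z ^ k))"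
    by (rule summable_powser_bdd[OF _ z, of _ B]) (use B in simp)
  have 2: "summable (\<lambda>k. norm (mat_of (G (int k)) $ i $ j * z ^ k))"
    by (rule summable_powser_bdd[OF _ z, of _ D])
      (use D norm_entry_le[of "mat_of (G _)" i j] in \<open>auto simp: norm_cmat_eq intro: order_trans\<close>)
  have eq: "(\<Sum>l\<le>k. (of_real (bcoef r (int l)) * z ^ l) * (mat_of (G (int (k - l))) $ i $ j * z ^ (k - l)))
      = mat_of ((emb (bcoef r) \<star> G) (int k)) $ i $ j * z ^ k" for k
  proof -
    have "(emb (bcoef r) \<star> G) (int k) = (\<Sum>l\<le>k. bcoef r (int l) *\<^sub>R G (int (k - l)))"
      by (subst conv_causal_nat) (auto simp: emb_def G(1) of_real_def)
    then have "mat_of ((emb (bcoef r) \<star> G) (int k)) $ i $ j * z ^ k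
        = (\<Sum>l\<le>k. of_real (bcoef r (int l)) * mat_of (G (int (k - l))) $ i $ j * z ^ k)"
      by (simp add: mat_of_sum sum_component sum_distrib_right scaleR_conv_of_real[where 'a = complex])
    also have "\<dots> = (\<Sum>l\<le>k. (of_real (bcoef r (int l)) * z ^ l) * (mat_of (G (int (k - l))) $ i $ j * z ^ (k - l)))"
    proof (rule sum.cong[OF refl])
      fix l assume "l \<in> {..k}"
      then have "z ^ k = z ^ l * z ^ (k - l)" by (simp flip: power_add)
      then show "of_real (bcoef r (int l)) * mat_of (G (int (k - l))) $ i $ j * z ^ k
          = (of_real (bcoef r (int l)) * z ^ l) * (mat_of (G (int (k - l))) $ i $ j * z ^ (k - l))"
        by (simp add: mult_ac)
    qed
    finally show ?thesis by simp
  qed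
  have "(\<lambda>k. mat_of ((emb (bcoef r) \<star> G) (int k)) $ i $ j * z ^ k) sums
      ((\<Sum>k. of_real (bcoef r (int k)) * z ^ k) * (\<Sum>k. mat_of (G (int k)) $ i $ j * z ^ k))"
    using Cauchy_product_sums[OF 1 2] unfolding eq .
  then show ?thesis
    using M bcoef_sums[OF z, of r] by (simp add: sums_iff)
qed

text \<open>The last two facts are the values at the boundary point \<open>1\<close>, from which the
  constant in the phase asymptotics is read off.\<close>

proposition regular_rational_series:
  fixes g :: "complex \<Rightarrow> complex^'q::finite^'q"
  assumes "regular_rational g"
  obtains G Gi :: "int \<Rightarrow> 'q cmat" where
    "\<And>k. k < 0 \<Longrightarrow> G k = 0" "\<And>k. k < 0 \<Longrightarrow> Gi k = 0" "dec 4 G" "dec 4 Gi"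
    "\<And>z i j. z \<in> cball 0 1 \<Longrightarrow> (\<lambda>k. mat_of (G (int k)) $ i $ j * z ^ k) sums (g z $ i $ j)"
    "\<And>z i j. z \<in> cball 0 1 \<Longrightarrow> (\<lambda>k. mat_of (Gi (int k)) $ i $ j * z ^ k) sums (matrix_inv (g z) $ i $ j)"
    "G \<star> Gi = delta 0 1" "Gi \<star> G = delta 0 1"
    "infsum G UNIV = Cmat (g 1)" "infsum Gi UNIV = Cmat (matrix_inv (g 1))"
proof -
  obtain R F E where FE: "R > 1" "\<And>i j. F i j holomorphic_on ball 0 R" "\<And>i j. E i j holomorphic_on ball 0 R"
    "\<And>z i j. z \<in> cball 0 1 \<Longrightarrow> g z $ i $ j = F i j z" "\<And>z i j. z \<in> cball 0 1 \<Longrightarrow> matrix_inv (g z) $ i $ j = E i j z"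
    using regular_rational_holomorphic[OF assms] by blast
  obtain G :: "int \<Rightarrow> 'q cmat" where G12: "\<And>k. k < 0 \<Longrightarrow> G k = 0" "dec 4 G"
    and G3: "\<And>z i j. z \<in> cball 0 1 \<Longrightarrow> (\<lambda>k. mat_of (G (int k)) $ i $ j * z ^ k) sums F i j z"
    by (rule coefficient_sequence[of R F, OF FE(1) FE(2)]) (rule that)
  obtain Gi :: "int \<Rightarrow> 'q cmat" where Gi12: "\<And>k. k < 0 \<Longrightarrow> Gi k = 0" "dec 4 Gi"
    and Gi3: "\<And>z i j. z \<in> cball 0 1 \<Longrightarrow> (\<lambda>k. mat_of (Gi (int k)) $ i $ j * z ^ k) sums E i j z"
    by (rule coefficient_sequence[of R E, OF FE(1) FE(3)]) (rule that)
  have G: "\<And>k. k < 0 \<Longrightarrow> G k = 0" "dec 4 G"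
    "\<And>z i j. z \<in> cball 0 1 \<Longrightarrow> (\<lambda>k. mat_of (G (int k)) $ i $ j * z ^ k) sums (g z $ i $ j)"
    by (fact G12(1), fact G12(2), simp only: FE(4) G3)
  have Gi: "\<And>k. k < 0 \<Longrightarrow> Gi k = 0" "dec 4 Gi"
    "\<And>z i j. z \<in> cball 0 1 \<Longrightarrow> (\<lambda>k. mat_of (Gi (int k)) $ i $ j * z ^ k) sums (matrix_inv (g z) $ i $ j)"
    by (fact Gi12(1), fact Gi12(2), simp only: FE(5) Gi3)
  have real_sums: "(\<lambda>k. x ^ k *\<^sub>R H (int k)) sums Cmat M"
    if "\<And>i j. (\<lambda>k. mat_of (H (int k)) $ i $ j * of_real x ^ k) sums (M $ i $ j)" for H :: "int \<Rightarrow> 'q cmat" and M x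
    by (rule sums_cmatI) (use that in \<open>simp add: scaleR_conv_of_real[where 'a = complex] mult.commute\<close>)
  have abs: "summable (\<lambda>k. norm (x ^ k *\<^sub>R H (int k)))" if Hx: "dec 4 H" "0 < x" "x < 1" for H :: "int \<Rightarrow> 'q cmat" and x :: real
  proof -
    obtain D where D: "\<And>k. norm (H k) \<le> D"
      using bddE[OF bdd_dec[OF Hx(1)]] by auto
    show ?thesis
    proof (rule summable_comparison_test')
      show "summable (\<lambda>k. D * x ^ k)" using Hx by (intro summable_mult summable_geometric) simp
      show "norm (norm (x ^ k *\<^sub>R H (int k))) \<le> D * x ^ k" for k
        using D[of "int k"] Hx by (simp add: mult.commute[of D] mult_left_mono)
    qed
  qed
  \<comment> \<open>The Cauchy product at real \<open>x\<close> in \<open>(0, 1)\<close> equals the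
    identity matrix; uniqueness of coefficients does the rest.\<close>
  have product: "H \<star> K = delta 0 1"
    if H: "\<And>k. k < 0 \<Longrightarrow> H k = 0" "dec 4 H" "\<And>x. 0 < x \<Longrightarrow> x < 1 \<Longrightarrow> (\<lambda>k. x ^ k *\<^sub>R H (int k)) sums Cmat (M x)"
      and K: "\<And>k. k < 0 \<Longrightarrow> K k = 0" "dec 4 K" "\<And>x. 0 < x \<Longrightarrow> x < 1 \<Longrightarrow> (\<lambda>k. x ^ k *\<^sub>R K (int k)) sums Cmat (L x)"
      and inv: "\<And>x. 0 < x \<Longrightarrow> x < 1 \<Longrightarrow> M x ** L x = mat 1"
    for H K :: "int \<Rightarrow> 'q cmat" and M L :: "real \<Rightarrow> complex^'q^'q"
  proof -
    have nat: "(\<lambda>k. (H \<star> K) (int k)) = (\<lambda>k. delta 0 1 (int k))"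
    proof (rule powser_unique)
      fix x :: real assume x: "0 < x" "x < 1"
      have eq: "(\<Sum>l\<le>k. (x ^ l *\<^sub>R H (int l)) * (x ^ (k - l) *\<^sub>R K (int (k - l)))) = x ^ k *\<^sub>R (H \<star> K) (int k)" for k
      proof -
        have "(H \<star> K) (int k) = (\<Sum>l\<le>k. H (int l) * K (int (k - l)))"
          by (rule conv_causal_nat) (use H(1) K(1) in auto)
        then show ?thesis
          unfolding scaleR_sum_right by (simp add: scaleR_sum_right flip: power_add)
      qed
      have "(\<lambda>k. x ^ k *\<^sub>R (H \<star> K) (int k)) sums (Cmat (M x) * Cmat (L x))"
        using Cauchy_product_sums[OF abs[OF H(2) x] abs[OF K(2) x]] H(3)[OF x] K(3)[OF x]
        unfolding eq by (simp add: sums_iff)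
      moreover have "Cmat (M x) * Cmat (L x) = 1" by (simp add: mat_of_eq_iff inv[OF x])
      ultimately show "(\<lambda>k. x ^ k *\<^sub>R (H \<star> K) (int k)) sums 1" by simp
      have "(\<lambda>k. x ^ k *\<^sub>R (delta 0 1 (int k) :: 'q cmat)) sums (\<Sum>k\<in>{0}. x ^ k *\<^sub>R delta 0 1 (int k))"
        by (rule sums_finite) (auto simp: delta_def)
      then show "(\<lambda>k. x ^ k *\<^sub>R (delta 0 1 (int k) :: 'q cmat)) sums 1" by (simp add: delta_def)
    qed
    have "(H \<star> K) k = delta 0 1 k" for k
    proof (cases "k < 0")
      case True
      have "(H \<star> K) k = 0" by (rule causal_conv[OF _ _ True]) (use H(1) K(1) in auto)
      with True show ?thesis by (simp add: delta_def)
    next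
      case False
      then show ?thesis using fun_cong[OF nat, of "nat k"] by simp
    qed
    then show ?thesis by blast
  qed
  have dz: "det (g z) \<noteq> 0" if "z \<in> cball 0 1" for z using assms that by (simp add: regular_rational_def)
  have g1: "(\<lambda>k. x ^ k *\<^sub>R G (int k)) sums Cmat (g (of_real x))" if "0 < x" "x < 1" for x
    by (rule real_sums, rule G(3)) (use that in simp)
  have g2: "(\<lambda>k. x ^ k *\<^sub>R Gi (int k)) sums Cmat (matrix_inv (g (of_real x)))" if "0 < x" "x < 1" for x
    by (rule real_sums, rule Gi(3)) (use that in simp)
  have total: "infsum H UNIV = Cmat M" if H: "\<And>k. k < 0 \<Longrightarrow> H k = 0" "dec 4 H"
    "\<And>i j. (\<lambda>k. mat_of (H (int k)) $ i $ j * 1 ^ k) sums (M $ i $ j)" for H :: "int \<Rightarrow> 'q cmat" and M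
  proof -
    have s: "H summable_on UNIV" using abs_summable_summable[of H UNIV] l1_dec[OF H(2)] by (simp add: l1_def)
    have "infsum H UNIV = infsum H {0..}"
      by (rule infsum_cong_neutral) (use H(1) in auto)
    also have "\<dots> = (\<Sum>\<^sub>\<infinity>k. H (int k))" by (simp add: infsum_int_ge)
    finally have I: "infsum H UNIV = (\<Sum>\<^sub>\<infinity>k. H (int k))" .
    have "H summable_on {0..}" by (rule summable_on_subset_banach[OF s]) auto
    then have "(\<lambda>k. H (int k)) sums infsum H UNIV"
      unfolding I summable_on_int_ge by (intro has_sum_imp_sums has_sum_infsum) simp
    moreover have "(\<lambda>k. H (int k)) sums Cmat M" by (rule sums_cmatI) (use H(3) in simp)
    ultimately show ?thesis by (rule sums_unique2)
  qed
  show thesis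
  proof (rule that[of G Gi])
    show "G \<star> Gi = delta 0 1"
      by (rule product[OF G(1,2) g1 Gi(1,2) g2]) (auto intro!: mult_matrix_inv dz)
    show "Gi \<star> G = delta 0 1"
      by (rule product[OF Gi(1,2) g2 G(1,2) g1]) (auto intro!: mult_matrix_inv dz)
    show "infsum G UNIV = Cmat (g 1)" by (rule total) (use G(1,2) G(3)[of 1] in auto)
    show "infsum Gi UNIV = Cmat (matrix_inv (g 1))" by (rule total) (use Gi(1,2) Gi(3)[of 1] in auto)
  qed (use G Gi in auto)
qed

section \<open>Fourier coefficients of the symbol\<close>

lemma integral_cis_eq:
  "(LINT \<theta>:{-pi..pi}|lborel. cis (of_int m * \<theta>)) = (if m = 0 then 2 * of_real pi else 0)"
proof -
  have c: "continuous_on {-pi..pi} (\<lambda>\<theta>. cis (of_int m * \<theta>))"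
    by (intro continuous_intros)
  have i: "(LINT \<theta>:{-pi..pi}|lborel. cis (of_int m * \<theta>)) = integral {-pi..pi} (\<lambda>\<theta>. cis (of_int m * \<theta>))"
    by (rule set_borel_integral_eq_integral(2)[OF borel_integrable_atLeastAtMost'[OF c]])
  show ?thesis
  proof (cases "m = 0")
    case True
    then show ?thesis unfolding i by (simp add: scaleR_conv_of_real)
  next
    case False
    let ?c = "\<i> * of_int m"
    have "((\<lambda>\<theta>. cis (of_int m * \<theta>)) has_integral exp (?c * of_real pi) / ?c - exp (?c * of_real (- pi)) / ?c) {-pi..pi}"
    proof (rule fundamental_theorem_of_calculus)
      fix \<theta> :: real
      have "((\<lambda>z. exp (?c * z) / ?c) has_field_derivative cis (of_int m * \<theta>)) (at (of_real \<theta>))"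
        using False by (auto intro!: derivative_eq_intros simp: cis_conv_exp mult_ac)
      then show "((\<lambda>\<theta>. exp (?c * of_real \<theta>) / ?c) has_vector_derivative cis (of_int m * \<theta>)) (at \<theta> within {-pi..pi})"
        by (rule has_vector_derivative_real_field)
    qed simp
    moreover have "exp (?c * of_real pi) = exp (?c * of_real (- pi))"
    proof -
      have "exp (?c * of_real pi) = exp (?c * of_real (- pi) + of_int m * (2 * of_real pi * \<i>))"
        by (simp add: algebra_simps)
      also have "\<dots> = exp (?c * of_real (- pi)) * exp (of_int m * (2 * of_real pi * \<i>))"
        by (rule exp_add)
      also have "exp (of_int m * (2 * of_real pi * \<i>)) = 1"
        using exp_integer_2pi[of "of_int m"] by (simp add: mult_ac)
      finally show ?thesis by simp
    qed
    ultimately have "((\<lambda>\<theta>. cis (of_int m * \<theta>)) has_integral 0) {-pi..pi}" by simp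
    then show ?thesis using False by (simp add: i integral_unique)
  qed
qed

lemma integral_trig_series:
  fixes u :: "real \<Rightarrow> complex" and v :: "nat \<Rightarrow> complex"
  assumes u: "continuous_on {-pi..pi} u" and v: "summable (\<lambda>n. norm (v n))"
  shows "(\<lambda>n. v n * (LINT \<theta>:{-pi..pi}|lborel. u \<theta> * cis (real n * \<theta>))) sums
    (LINT \<theta>:{-pi..pi}|lborel. u \<theta> * (\<Sum>n. v n * cis (real n * \<theta>)))"
proof -
  define f where "f = (\<lambda>n \<theta>. indicator {-pi..pi} \<theta> *\<^sub>R (v n * (u \<theta> * cis (real n * \<theta>))))"
  have int: "integrable lborel (f n)" for n
    unfolding f_def
    by (rule borel_integrable_atLeastAtMost'[unfolded set_integrable_def]) (intro continuous_intros u)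
  have "compact (u ` {-pi..pi})" by (rule compact_continuous_image[OF u]) simp
  then obtain B where B: "B > 0" "\<And>\<theta>. \<theta> \<in> {-pi..pi} \<Longrightarrow> norm (u \<theta>) \<le> B"
    using compact_imp_bounded bounded_pos by (metis imageI)
  have bound: "norm (f n \<theta>) \<le> norm (v n) * (B * indicator {-pi..pi} \<theta>)" for n \<theta>
    using B by (auto simp: f_def norm_mult indicator_def intro!: mult_left_mono)
  have "(\<lambda>n. integral\<^sup>L lborel (f n)) sums (\<integral>\<theta>. (\<Sum>n. f n \<theta>) \<partial>lborel)"
  proof (rule sums_integral[OF int])
    show "AE \<theta> in lborel. summable (\<lambda>n. norm (f n \<theta>))"
    proof (rule AE_I2)
      fix \<theta>
      show "summable (\<lambda>n. norm (f n \<theta>))"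
        by (rule summable_comparison_test'[OF summable_mult2[OF v, of "B * indicator {-pi..pi} \<theta>"]]) (use bound in simp)
    qed
    have I: "integrable lborel (\<lambda>\<theta>. norm (v n) * (B * indicator {-pi..pi} \<theta>))" for n
      by (intro integrable_mult_right integrable_real_indicator) auto
    have "(\<integral>\<theta>. norm (f n \<theta>) \<partial>lborel) \<le> (\<integral>\<theta>. norm (v n) * (B * indicator {-pi..pi} \<theta>) \<partial>lborel)" for n
      by (rule integral_mono[OF integrable_norm[OF int] I bound])
    also have "(\<integral>\<theta>. norm (v n) * (B * indicator {-pi..pi} \<theta>) \<partial>lborel) = norm (v n) * (B * (2 * pi))" for n
      by simp
    finally have le: "(\<integral>\<theta>. norm (f n \<theta>) \<partial>lborel) \<le> norm (v n) * (B * (2 * pi))" for n .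
    show "summable (\<lambda>n. \<integral>\<theta>. norm (f n \<theta>) \<partial>lborel)"
      by (rule summable_comparison_test'[OF summable_mult2[OF v, of "B * (2 * pi)"]]) (use le in simp)
  qed
  moreover have "integral\<^sup>L lborel (f n) = v n * (LINT \<theta>:{-pi..pi}|lborel. u \<theta> * cis (real n * \<theta>))" for n
    unfolding set_lebesgue_integral_def f_def by (simp flip: integral_mult_right_zero)
  moreover have "(\<Sum>n. f n \<theta>) = indicator {-pi..pi} \<theta> *\<^sub>R (u \<theta> * (\<Sum>n. v n * cis (real n * \<theta>)))" for \<theta>
  proof -
    have "summable (\<lambda>n. v n * cis (real n * \<theta>))"
      by (rule summable_norm_cancel) (use v in \<open>simp add: norm_mult\<close>)
    then have "(\<lambda>n. indicator {-pi..pi} \<theta> *\<^sub>R (u \<theta> * (v n * cis (real n * \<theta>)))) sums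
        (indicator {-pi..pi} \<theta> *\<^sub>R (u \<theta> * (\<Sum>n. v n * cis (real n * \<theta>))))"
      by (intro sums_scaleR_right sums_mult summable_sums)
    from sums_unique[OF this] show ?thesis by (simp add: f_def mult_ac)
  qed
  ultimately show ?thesis unfolding set_lebesgue_integral_def by simp
qed

lemma integral_trig_series_coeff:
  fixes v :: "nat \<Rightarrow> complex"
  assumes v: "summable (\<lambda>n. norm (v n))"
  shows "(LINT \<theta>:{-pi..pi}|lborel. cis (- (of_int m * \<theta>)) * (\<Sum>n. v n * cis (real n * \<theta>)))
    = 2 * of_real pi * (if m < 0 then 0 else v (nat m))"
proof -
  have "cis (- (of_int m * \<theta>)) * cis (real n * \<theta>) = cis (of_int (int n - m) * \<theta>)" for n \<theta>
    by (simp add: cis_mult algebra_simps)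
  then have eq: "v n * (LINT \<theta>:{-pi..pi}|lborel. cis (- (of_int m * \<theta>)) * cis (real n * \<theta>))
      = (if int n = m then 2 * of_real pi * v n else 0)" for n
    by (simp only: integral_cis_eq) simp
  have "(\<lambda>n. if int n = m then 2 * of_real pi * v n else 0) sums
      (LINT \<theta>:{-pi..pi}|lborel. cis (- (of_int m * \<theta>)) * (\<Sum>n. v n * cis (real n * \<theta>)))"
    unfolding eq[symmetric] by (rule integral_trig_series[OF _ v]) (intro continuous_intros)
  moreover have "(\<lambda>n. if int n = m then 2 * of_real pi * v n else 0) sums
      (\<Sum>n\<in>(if m < 0 then {} else {nat m}). if int n = m then 2 * of_real pi * v n else 0)"
    by (rule sums_finite) auto
  ultimately have "(LINT \<theta>:{-pi..pi}|lborel. cis (- (of_int m * \<theta>)) * (\<Sum>n. v n * cis (real n * \<theta>)))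
      = (\<Sum>n\<in>(if m < 0 then {} else {nat m}). if int n = m then 2 * of_real pi * v n else 0)"
    by (rule sums_unique2)
  then show ?thesis by (cases "m < 0") simp_all
qed

text \<open>Only the first series is integrated term by term; the other one stays inside as a
  continuous function until its own coefficient is extracted.\<close>

lemma integral_trig_series_product:
  fixes v y :: "nat \<Rightarrow> complex" and h :: "real \<Rightarrow> complex"
  assumes v: "summable (\<lambda>n. norm (v n))" and y: "summable (\<lambda>n. norm (y n))"
    and h: "continuous_on {-pi..pi} h" "\<And>\<theta>. h \<theta> = (\<Sum>n. y n * cis (real n * \<theta>))"
  shows "(\<lambda>n. 2 * of_real pi * (v n * cnj (if int n < k then 0 else y (nat (int n - k))))) sums
    (LINT \<theta>:{-pi..pi}|lborel. cis (- (of_int k * \<theta>)) * ((\<Sum>n. v n * cis (real n * \<theta>)) * cnj (h \<theta>)))"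
proof -
  have eq: "v n * (LINT \<theta>:{-pi..pi}|lborel. (cis (- (of_int k * \<theta>)) * cnj (h \<theta>)) * cis (real n * \<theta>))
      = 2 * of_real pi * (v n * cnj (if int n < k then 0 else y (nat (int n - k))))" for n
  proof -
    have "(cis (- (of_int k * \<theta>)) * cnj (h \<theta>)) * cis (real n * \<theta>) = cnj (cis (- (of_int (int n - k) * \<theta>)) * h \<theta>)" for \<theta>
    proof -
      have "cnj (cis (- (of_int (int n - k) * \<theta>))) = cis (- (of_int k * \<theta>)) * cis (real n * \<theta>)"
        by (simp add: cis_cnj cis_mult algebra_simps)
      then show ?thesis by simp
    qed
    then have "(LINT \<theta>:{-pi..pi}|lborel. (cis (- (of_int k * \<theta>)) * cnj (h \<theta>)) * cis (real n * \<theta>))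
        = (LINT \<theta>:{-pi..pi}|lborel. cnj (cis (- (of_int (int n - k) * \<theta>)) * h \<theta>))" by (simp only:)
    also have "\<dots> = cnj (LINT \<theta>:{-pi..pi}|lborel. cis (- (of_int (int n - k) * \<theta>)) * h \<theta>)"
    proof -
      have "indicator {-pi..pi} \<theta> *\<^sub>R cnj z = cnj (indicator {-pi..pi} \<theta> *\<^sub>R z)" for \<theta> :: real and z
        by (simp add: scaleR_conv_of_real)
      then show ?thesis unfolding set_lebesgue_integral_def by (subst Bochner_Integration.integral_cnj[symmetric]) simp
    qed
    also have "\<dots> = cnj (2 * of_real pi * (if int n - k < 0 then 0 else y (nat (int n - k))))"
      unfolding h(2) integral_trig_series_coeff[OF y] ..
    finally show ?thesis by simp
  qed
  have "(\<lambda>n. v n * (LINT \<theta>:{-pi..pi}|lborel. (cis (- (of_int k * \<theta>)) * cnj (h \<theta>)) * cis (real n * \<theta>))) sums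
      (LINT \<theta>:{-pi..pi}|lborel. (cis (- (of_int k * \<theta>)) * cnj (h \<theta>)) * (\<Sum>n. v n * cis (real n * \<theta>)))"
    by (rule integral_trig_series[OF _ v]) (intro continuous_intros h(1))
  then show ?thesis unfolding eq by (simp add: mult_ac)
qed

text \<open>Used with \<open>s = 2 * d\<close>: this is where \<open>d < 1 / 2\<close> makes the
  symbol integrable.\<close>

lemma integrable_abs_powr:
  fixes s :: real
  assumes "0 \<le> s" "s < 1"
  shows "integrable lborel (\<lambda>\<theta>. indicator {-pi..pi} \<theta> * \<bar>\<theta>\<bar> powr (- s))"
proof -
  have "(\<lambda>x. x powr (- s)) integrable_on {0..pi}"
    by (rule integrable_on_powr_from_0) (use assms in auto)
  then have "(\<lambda>x. x powr (- s)) absolutely_integrable_on {0..pi}"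
    by (rule nonnegative_absolutely_integrable_1) simp
  then have "integrable lebesgue (\<lambda>x. indicator {0..pi} x *\<^sub>R x powr (- s))"
    by (simp add: set_integrable_def)
  then have 1: "integrable lborel (\<lambda>x. indicator {0..pi} x *\<^sub>R x powr (- s))"
    by (subst (asm) integrable_completion) auto
  then have 2: "integrable lborel (\<lambda>x. indicator {0..pi} (0 + (- 1) * x) *\<^sub>R (0 + (- 1) * x) powr (- s))"
    by (rule lborel_integrable_real_affine) simp
  show ?thesis
  proof (rule Bochner_Integration.integrable_bound[OF Bochner_Integration.integrable_add[OF 1 2]])
    show "(\<lambda>\<theta>. indicator {-pi..pi} \<theta> * \<bar>\<theta>\<bar> powr (- s)) \<in> borel_measurable lborel" by measurable
    show "AE x in lborel. norm (indicator {- pi..pi} x * \<bar>x\<bar> powr - s)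
        \<le> norm (indicator {0..pi} x *\<^sub>R x powr - s + indicator {0..pi} (0 + - 1 * x) *\<^sub>R (0 + - 1 * x) powr - s)"
      by (intro AE_I2) (auto simp: indicator_def abs_if)
  qed
qed

text \<open>The norm equals \<open>2 * |sin (\<theta> / 2)|\<close>. Any linear lower bound would
  serve; the constant \<open>1 / pi\<close> follows from \<open>cos \<ge> 1 / 2\<close> up to
  \<open>pi / 3\<close> and from monotonicity of the sine beyond.\<close>

lemma norm_one_minus_cis_ge:
  assumes "\<bar>\<theta>\<bar> \<le> pi"
  shows "norm (1 - cis \<theta>) \<ge> \<bar>\<theta>\<bar> / pi"
proof -
  have "(norm (1 - cis \<theta>))\<^sup>2 = (2 * sin (\<theta> / 2))\<^sup>2"
  proof -
    have "(norm (1 - cis \<theta>))\<^sup>2 = (1 - cos \<theta>)\<^sup>2 + (sin \<theta>)\<^sup>2" by (simp add: cmod_power2)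
    also have "\<dots> = 2 - 2 * cos \<theta>" using sin_cos_squared_add[of \<theta>] by (simp add: power2_eq_square algebra_simps)
    also have "cos \<theta> = 1 - 2 * (sin (\<theta> / 2))\<^sup>2" using cos_double_sin[of "\<theta> / 2"] by simp
    finally show ?thesis by (simp add: power2_eq_square)
  qed
  then have n: "norm (1 - cis \<theta>) = \<bar>2 * sin (\<theta> / 2)\<bar>"
    using power2_eq_iff_nonneg[of "norm (1 - cis \<theta>)" "\<bar>2 * sin (\<theta> / 2)\<bar>"] by simp
  have pos: "2 * sin (x / 2) \<ge> x / pi" if "0 \<le> x" "x \<le> pi" for x
  proof -
    show ?thesis
    proof (cases "x / 2 \<le> pi / 3")
      case True
      have "sin (x / 2) \<ge> x / 2 * (1 / 2)"
      proof (cases "x = 0")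
        case False
        have "\<exists>z>0. z < x / 2 \<and> sin (x / 2) - sin 0 = (x / 2 - 0) * cos z"
          by (rule MVT2) (use that False in auto)
        then obtain z where z: "z > 0" "z < x / 2" "sin (x / 2) = x / 2 * cos z" by auto
        have "cos (pi / 3) \<le> cos z" by (rule cos_monotone_0_pi_le) (use z True in auto)
        then show ?thesis using z(3) that mult_left_mono[of "1 / 2" "cos z" "x / 2"] by (simp add: cos_60)
      qed simp
      moreover have "x / pi \<le> x / 2" using that pi_gt3 by (intro divide_left_mono) auto
      ultimately show ?thesis by linarith
    next
      case False
      have "sin (pi / 3) \<le> sin (x / 2)" by (rule sin_monotone_2pi_le) (use that False in auto)
      then have "sqrt 3 / 2 \<le> sin (x / 2)" by (simp add: sin_60)
      moreover have "1 \<le> sqrt 3" by simp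
      moreover have "x / pi \<le> 1" using that by simp
      ultimately show ?thesis by linarith
    qed
  qed
  show ?thesis
  proof (cases "\<theta> \<ge> 0")
    case True
    then show ?thesis using pos[of \<theta>] assms by (simp add: n)
  next
    case False
    then show ?thesis using pos[of "- \<theta>"] assms by (simp add: n)
  qed
qed

lemma cis_eq_1_iff_in_period:
  assumes "\<bar>\<theta>\<bar> \<le> pi"
  shows "cis \<theta> = 1 \<longleftrightarrow> \<theta> = 0"
proof
  assume "cis \<theta> = 1"
  then have "\<bar>\<theta>\<bar> / pi \<le> 0" using norm_one_minus_cis_ge[OF assms] by simp
  then have "pi \<le> 0 \<or> \<theta> = 0" by (simp add: divide_le_0_iff)
  then show "\<theta> = 0" by (metis not_le pi_gt_zero)
qed simp

text \<open>Parseval's identity for boundary values of the form \<open>(1 - z) powr (- d) * p z\<close>, by Abel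
  summation: the integrals over the circles of radius \<open>r < 1\<close> are dominated by a multiple of
  \<open>\<bar>\<theta>\<bar> powr (- 2 * d)\<close>.\<close>

proposition abel_parseval:
  fixes x y :: "int \<Rightarrow> complex" and p q :: "complex \<Rightarrow> complex" and k :: int
  assumes d: "0 < d" "d < 1 / 2"
    and xs: "\<And>k. k < 0 \<Longrightarrow> x k = 0" "dec (1 - d) x" and ys: "\<And>k. k < 0 \<Longrightarrow> y k = 0" "dec (1 - d) y"
    and p: "continuous_on (cball 0 1) p" and q: "continuous_on (cball 0 1) q"
    and x_sums: "\<And>z. norm z < 1 \<Longrightarrow> (\<lambda>n. x (int n) * z ^ n) sums ((1 - z) powr of_real (- d) * p z)"
    and y_sums: "\<And>z. norm z < 1 \<Longrightarrow> (\<lambda>n. y (int n) * z ^ n) sums ((1 - z) powr of_real (- d) * q z)"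
  defines "\<Phi> \<equiv> \<lambda>\<theta>. indicator {-pi..pi} \<theta> *\<^sub>R
      (cis (- (of_int k * \<theta>)) * (of_real (norm (1 - cis \<theta>) powr (- 2 * d)) * (p (cis \<theta>) * cnj (q (cis \<theta>)))))"
  shows "integrable lborel \<Phi>" "integral\<^sup>L lborel \<Phi> = 2 * of_real pi * (\<Sum>\<^sub>\<infinity>l. x l * cnj (y (l - k)))"
proof -
  define F where "F = (\<lambda>z. (1 - z) powr of_real (- d) * p z)"
  define H where "H = (\<lambda>z. (1 - z) powr of_real (- d) * q z)"
  define r where "r = (\<lambda>n. 1 - 1 / real (Suc n))"
  have r: "0 \<le> r n" "r n < 1" for n by (auto simp: r_def field_simps)
  have r_lim: "r \<longlonglongrightarrow> 1"
    unfolding r_def using tendsto_diff[OF tendsto_const LIMSEQ_Suc[OF lim_1_over_n], of 1] by simp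
  have norm_r: "norm (of_real (r n) * cis \<theta>) = r n" for n \<theta> using r by (simp add: norm_mult)
  have cont_powr: "continuous_on (cball 0 1 - {1}) (\<lambda>z. (1 - z) powr complex_of_real (- d))"
    by (intro continuous_intros) (auto dest: order_trans[OF complex_Re_le_cmod])
  have contF: "continuous_on (cball 0 1 - {1}) F" and contH: "continuous_on (cball 0 1 - {1}) H"
    unfolding F_def H_def by (intro continuous_on_mult cont_powr continuous_on_subset[OF p] continuous_on_subset[OF q]; auto)+
  have ne1: "of_real (r n) * cis \<theta> \<in> cball 0 1 - {1}" for n \<theta>
    using norm_r[of n \<theta>] r[of n] by force
  have cont_r1: "continuous_on S (\<lambda>\<theta>. F (of_real (r n) * cis \<theta>))" for n S
    by (rule continuous_on_compose2[OF contF], intro continuous_intros) (rule image_subsetI, rule ne1)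
  have cont_r2: "continuous_on S (\<lambda>\<theta>. H (of_real (r n) * cis \<theta>))" for n S
    by (rule continuous_on_compose2[OF contH], intro continuous_intros) (rule image_subsetI, rule ne1)
  define s where "s = (\<lambda>n \<theta>. indicator {-pi..pi} \<theta> *\<^sub>R
      (cis (- (of_int k * \<theta>)) * (F (of_real (r n) * cis \<theta>) * cnj (H (of_real (r n) * cis \<theta>)))))"
  obtain P where P: "P > 0" "\<And>z. z \<in> cball 0 1 \<Longrightarrow> norm (p z) \<le> P"
    using compact_imp_bounded[OF compact_continuous_image[OF p]] unfolding bounded_pos by auto
  obtain Q where Q: "Q > 0" "\<And>z. z \<in> cball 0 1 \<Longrightarrow> norm (q z) \<le> Q"
    using compact_imp_bounded[OF compact_continuous_image[OF q]] unfolding bounded_pos by auto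
  define W where "W = (\<lambda>\<theta>. (P * Q * (2 * pi) powr (2 * d)) * (indicator {-pi..pi} \<theta> * \<bar>\<theta>\<bar> powr (- (2 * d))))"
  have W: "integrable lborel W"
    unfolding W_def by (intro integrable_mult_right integrable_abs_powr) (use d in auto)
  have s_int: "integrable lborel (s n)" for n
    unfolding s_def
    by (rule borel_integrable_atLeastAtMost'[unfolded set_integrable_def]) (intro continuous_intros cont_r1 cont_r2)
  have ae: "AE \<theta> in lborel. \<theta> \<noteq> (0 :: real)" by (rule AE_lborel_singleton)
  have s_le: "norm (s n \<theta>) \<le> W \<theta>" if "\<theta> \<noteq> 0" for n \<theta>
  proof (cases "\<theta> \<in> {-pi..pi}")
    case True
    let ?z = "of_real (r n) * cis \<theta>"
    have th: "\<bar>\<theta>\<bar> \<le> pi" using True by auto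
    \<comment> \<open>The majorant must not depend on the radius:
      \<open>1 - |z| \<le> |1 - z|\<close> yields
      \<open>|1 - cis \<theta>| \<le> 2 * |1 - z|\<close> on every circle.\<close>
    have "norm (1 - cis \<theta>) \<le> norm (1 - ?z) + norm (?z - cis \<theta>)"
      using norm_triangle_ineq[of "1 - ?z" "?z - cis \<theta>"] by simp
    also have "?z - cis \<theta> = of_real (r n - 1) * cis \<theta>" by (simp add: algebra_simps)
    also have "norm \<dots> = 1 - norm ?z" using r[of n] by (simp only: norm_mult norm_of_real) simp
    also have "\<dots> \<le> norm (1 - ?z)" using norm_triangle_ineq2[of 1 ?z] by simp
    finally have "\<bar>\<theta>\<bar> / (2 * pi) \<le> norm (1 - ?z)" using norm_one_minus_cis_ge[OF th] by simp
    then have "norm (1 - ?z) powr (- d) \<le> (\<bar>\<theta>\<bar> / (2 * pi)) powr (- d)"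
      using that d by (intro powr_mono2') auto
    then have k: "norm ((1 - ?z) powr complex_of_real (- d)) \<le> (\<bar>\<theta>\<bar> / (2 * pi)) powr (- d)"
      using ne1[of n \<theta>] by (subst norm_powr_real_powr') auto
    have "norm (s n \<theta>) = norm (F ?z) * norm (H ?z)" using True by (simp add: s_def norm_mult)
    also have "\<dots> \<le> ((\<bar>\<theta>\<bar> / (2 * pi)) powr (- d) * P) * ((\<bar>\<theta>\<bar> / (2 * pi)) powr (- d) * Q)"
      unfolding F_def H_def norm_mult
      using k P(1) Q(1) ne1[of n \<theta>] by (intro mult_mono P(2) Q(2)) (auto intro: mult_nonneg_nonneg)
    also have "\<dots> = P * Q * (\<bar>\<theta>\<bar> / (2 * pi)) powr (- d + - d)" unfolding powr_add by simp
    also have "(\<bar>\<theta>\<bar> / (2 * pi)) powr (- d + - d) = (2 * pi) powr (2 * d) * \<bar>\<theta>\<bar> powr (- (2 * d))"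
      using that by (simp add: powr_divide powr_minus field_simps)
    finally show ?thesis using True by (simp add: W_def)
  qed (simp add: s_def W_def)
  have s_lim: "(\<lambda>n. s n \<theta>) \<longlonglongrightarrow> \<Phi> \<theta>" if "\<theta> \<noteq> 0" for \<theta>
  proof (cases "\<theta> \<in> {-pi..pi}")
    case True
    then have "\<bar>\<theta>\<bar> \<le> pi" by auto
    then have c1: "cis \<theta> \<in> cball 0 1 - {1}" using cis_eq_1_iff_in_period[of \<theta>] that by auto
    have "(\<lambda>n. of_real (r n) * cis \<theta>) \<longlonglongrightarrow> of_real 1 * cis \<theta>"
      by (intro tendsto_mult tendsto_of_real r_lim tendsto_const)
    then have z: "(\<lambda>n. of_real (r n) * cis \<theta>) \<longlonglongrightarrow> cis \<theta>" by simp
    have "(\<lambda>n. F (of_real (r n) * cis \<theta>)) \<longlonglongrightarrow> F (cis \<theta>)"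
      by (rule continuous_on_tendsto_compose[OF contF z c1]) (use ne1 in auto)
    moreover have "(\<lambda>n. H (of_real (r n) * cis \<theta>)) \<longlonglongrightarrow> H (cis \<theta>)"
      by (rule continuous_on_tendsto_compose[OF contH z c1]) (use ne1 in auto)
    ultimately have "(\<lambda>n. s n \<theta>) \<longlonglongrightarrow> indicator {-pi..pi} \<theta> *\<^sub>R (cis (- (of_int k * \<theta>)) * (F (cis \<theta>) * cnj (H (cis \<theta>))))"
      unfolding s_def by (intro tendsto_intros)
    moreover have "F (cis \<theta>) * cnj (H (cis \<theta>)) = of_real (norm (1 - cis \<theta>) powr (- 2 * d)) * (p (cis \<theta>) * cnj (q (cis \<theta>)))"
    proof -
      let ?a = "(1 - cis \<theta>) powr complex_of_real (- d)"
      have "norm ?a = norm (1 - cis \<theta>) powr (- d)"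
        using c1 by (subst norm_powr_real_powr') auto
      then have "?a * cnj ?a = of_real (norm (1 - cis \<theta>) powr (- d + - d))"
        unfolding powr_add by (simp only: complex_norm_square[symmetric] power2_eq_square of_real_mult)
      then have "?a * cnj ?a = of_real (norm (1 - cis \<theta>) powr (- 2 * d))" by simp
      then show ?thesis unfolding F_def H_def by (simp only: complex_cnj_mult) (simp only: mult_ac)
    qed
    ultimately show ?thesis by (simp add: \<Phi>_def)
  qed (simp add: s_def \<Phi>_def)
  have cp: "continuous_on UNIV (\<lambda>\<theta>. p (cis \<theta>))"
    by (rule continuous_on_compose2[OF p], intro continuous_intros) force
  have cq: "continuous_on UNIV (\<lambda>\<theta>. q (cis \<theta>))"
    by (rule continuous_on_compose2[OF q], intro continuous_intros) force
  have \<Phi>_meas: "\<Phi> \<in> borel_measurable lborel"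
  proof -
    have [measurable]: "(\<lambda>\<theta>. p (cis \<theta>)) \<in> borel_measurable borel" "(\<lambda>\<theta>. cnj (q (cis \<theta>))) \<in> borel_measurable borel"
      "(\<lambda>\<theta>. cis (- (of_int k * \<theta>))) \<in> borel_measurable borel" "(\<lambda>\<theta>. norm (1 - cis \<theta>)) \<in> borel_measurable borel"
      by (intro borel_measurable_continuous_onI continuous_intros cp cq)+
    show ?thesis unfolding \<Phi>_def by measurable
  qed
  have AE_lim: "AE \<theta> in lborel. (\<lambda>n. s n \<theta>) \<longlonglongrightarrow> \<Phi> \<theta>" using ae by eventually_elim (rule s_lim)
  have AE_le: "AE \<theta> in lborel. norm (s n \<theta>) \<le> W \<theta>" for n using ae by eventually_elim (rule s_le)
  show "integrable lborel \<Phi>"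
    by (rule integrable_dominated_convergence[OF \<Phi>_meas _ W AE_lim AE_le]) (use s_int in auto)
  have lim1: "(\<lambda>n. integral\<^sup>L lborel (s n)) \<longlonglongrightarrow> integral\<^sup>L lborel \<Phi>"
    by (rule integral_dominated_convergence[OF \<Phi>_meas _ W AE_lim AE_le]) (use s_int in auto)
  \<comment> \<open>The terms of the correlation at radius \<open>r n\<close>; the cutoff at
    \<open>int m < k\<close> is the causality of \<open>y\<close>.\<close>
  define a where "a = (\<lambda>m n. (x (int m) * of_real (r n) ^ m) * cnj (if int m < k then 0 else y (int m - k) * of_real (r n) ^ nat (int m - k)))"
  have abs: "summable (\<lambda>m. norm (u (int m) * of_real (r n) ^ m))" if u: "dec (1 - d) u" for u :: "int \<Rightarrow> complex" and n
  proof -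
    obtain D where "\<And>k. norm (u k) \<le> D" using bddE[OF bdd_dec[OF u]] d by auto
    then show ?thesis by (intro summable_powser_bdd[of _ D]) (use r in auto)
  qed
  have s_sums: "(\<lambda>m. 2 * of_real pi * a m n) sums integral\<^sup>L lborel (s n)" for n
  proof -
    have series: "(\<Sum>m. u (int m) * of_real (r n) ^ m * cis (real m * \<theta>)) = U (of_real (r n) * cis \<theta>)"
      if "\<And>z. norm z < 1 \<Longrightarrow> (\<lambda>n. u (int n) * z ^ n) sums U z" for u U \<theta>
    proof -
      have "cis (real m * \<theta>) = cis \<theta> ^ m" for m by (rule Complex.DeMoivre[symmetric])
      moreover have "norm (of_real (r n) * cis \<theta>) < 1" using norm_r r by simp
      ultimately show ?thesis
        using that[of "of_real (r n) * cis \<theta>"] by (simp add: sums_iff power_mult_distrib mult.assoc)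
    qed
    have "(\<lambda>m. 2 * of_real pi * ((x (int m) * of_real (r n) ^ m) *
        cnj (if int m < k then 0 else y (int (nat (int m - k))) * of_real (r n) ^ nat (int m - k)))) sums
      (LINT \<theta>:{-pi..pi}|lborel. cis (- (of_int k * \<theta>)) *
        ((\<Sum>m. x (int m) * of_real (r n) ^ m * cis (real m * \<theta>)) * cnj (H (of_real (r n) * cis \<theta>))))"
      by (rule integral_trig_series_product[OF abs[OF xs(2)] abs[OF ys(2)] cont_r2])
        (use series[OF y_sums] in \<open>simp add: H_def\<close>)
    moreover have "(if int m < k then 0 else y (int (nat (int m - k))) * of_real (r n) ^ nat (int m - k))
        = (if int m < k then 0 else y (int m - k) * of_real (r n) ^ nat (int m - k))" for m by simp
    moreover have "(\<Sum>m. x (int m) * of_real (r n) ^ m * cis (real m * \<theta>)) = F (of_real (r n) * cis \<theta>)" for \<theta>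
      by (rule series) (use x_sums in \<open>simp add: F_def\<close>)
    ultimately show ?thesis
      unfolding a_def s_def set_lebesgue_integral_def by (simp only:)
  qed
  define b where "b = (\<lambda>m. x (int m) * cnj (y (int m - k)))"
  \<comment> \<open>Absolute convergence at radius 1, from \<open>2 * (1 - d) > 1\<close>; it
    provides the majorant for Tannery's theorem.\<close>
  have cb: "(\<lambda>l. norm (x l) * norm (y (l - k))) summable_on UNIV"
    using conv_bdd_abs[OF conv_bdd_dec[of "1 - d" x "1 - d" "\<lambda>l. y (- l)"], of k] xs(2) ys(2) d
    by (simp add: dec_reflect conv_abs_def)
  have "(\<lambda>l. norm (x l) * norm (y (l - k))) summable_on {0..}"
    by (rule summable_on_subset_banach[OF cb]) auto
  then have sb: "summable (\<lambda>m. norm (x (int m)) * norm (y (int m - k)))"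
    by (intro summable_on_imp_summable) (simp add: summable_on_int_ge)
  have "(\<lambda>n. \<Sum>m. a m n) \<longlonglongrightarrow> suminf b"
  proof (rule tannerys_theorem[THEN conjunct2, THEN conjunct2])
    fix m
    show "(\<lambda>n. a m n) \<longlonglongrightarrow> b m"
    proof (cases "int m < k")
      case True
      then show ?thesis by (simp add: a_def b_def ys(1))
    next
      case False
      have "(\<lambda>n. (x (int m) * of_real (r n) ^ m) * cnj (y (int m - k) * of_real (r n) ^ nat (int m - k)))
          \<longlonglongrightarrow> (x (int m) * of_real 1 ^ m) * cnj (y (int m - k) * of_real 1 ^ nat (int m - k))"
        by (intro tendsto_intros r_lim)
      then show ?thesis using False by (simp add: a_def b_def)
    qed
  next
    have "norm (a m n) \<le> norm (x (int m)) * norm (y (int m - k))" for m n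
    proof -
      have le1: "\<bar>r n\<bar> ^ i \<le> 1" for i using r[of n] by (intro power_le_one) auto
      have "norm (a m n) \<le> (norm (x (int m)) * \<bar>r n\<bar> ^ m) * (norm (y (int m - k)) * \<bar>r n\<bar> ^ nat (int m - k))"
        by (auto simp: a_def norm_mult norm_power)
      also have "\<dots> \<le> (norm (x (int m)) * 1) * (norm (y (int m - k)) * 1)"
        by (intro mult_mono le1) auto
      finally show ?thesis by simp
    qed
    then show "\<forall>\<^sub>F (m, n) in sequentially \<times>\<^sub>F sequentially. norm (a m n) \<le> norm (x (int m)) * norm (y (int m - k))"
      by (intro always_eventually) auto
  qed (use sb in auto)
  then have "(\<lambda>n. 2 * of_real pi * (\<Sum>m. a m n)) \<longlonglongrightarrow> 2 * of_real pi * suminf b"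
    by (intro tendsto_mult tendsto_const)
  moreover have "2 * of_real pi * (\<Sum>m. a m n) = integral\<^sup>L lborel (s n)" for n
  proof -
    have "(\<lambda>m. a m n) sums (integral\<^sup>L lborel (s n) / (2 * of_real pi))"
      using sums_divide[OF s_sums[of n], of "2 * of_real pi"] by simp
    then show ?thesis by (simp add: sums_iff)
  qed
  ultimately have "integral\<^sup>L lborel \<Phi> = 2 * of_real pi * suminf b"
    using lim1 LIMSEQ_unique by simp
  moreover have "suminf b = (\<Sum>\<^sub>\<infinity>l. x l * cnj (y (l - k)))"
  proof -
    have "(\<Sum>\<^sub>\<infinity>l. x l * cnj (y (l - k))) = (\<Sum>\<^sub>\<infinity>l\<in>{0..}. x l * cnj (y (l - k)))"
      by (rule infsum_cong_neutral) (use xs(1) in auto)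
    also have "\<dots> = infsum b UNIV" by (simp add: infsum_int_ge b_def)
    finally have I: "(\<Sum>\<^sub>\<infinity>l. x l * cnj (y (l - k))) = infsum b UNIV" .
    have "b summable_on UNIV"
      by (rule norm_summable_imp_summable_on) (use sb in \<open>simp add: b_def norm_mult\<close>)
    from has_sum_imp_sums[OF has_sum_infsum[OF this]] show ?thesis unfolding I by (simp add: sums_iff)
  qed
  ultimately show "integral\<^sup>L lborel \<Phi> = 2 * of_real pi * (\<Sum>\<^sub>\<infinity>l. x l * cnj (y (l - k)))" by simp
qed

section \<open>Inverses of finite block Toeplitz matrices\<close>

lemma conv_finite_support:
  fixes f x :: "int \<Rightarrow> 'a::real_normed_algebra"
  assumes "\<And>k. k \<notin> {1..int n} \<Longrightarrow> x k = 0"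
  shows "(f \<star> x) i = (\<Sum>l=1..n. f (i - int l) * x (int l))"
proof -
  have "(f \<star> x) i = (\<Sum>\<^sub>\<infinity>j\<in>{i - int n..i - 1}. f j * x (i - j))"
    unfolding conv_def by (rule infsum_cong_neutral) (use assms in auto)
  also have "\<dots> = (\<Sum>j\<in>{i - int n..i - 1}. f j * x (i - j))" by simp
  also have "\<dots> = (\<Sum>l=1..n. f (i - int l) * x (int l))"
    by (rule sum.reindex_bij_witness[where i = "\<lambda>l. i - int l" and j = "\<lambda>j. nat (i - j)"]) auto
  finally show ?thesis .
qed

lemma sum_nat_int_interval: "(\<Sum>s\<in>{1..int n}. f s) = (\<Sum>s=1..n. f (int s))"
  by (rule sum.reindex_bij_witness[where i = int and j = nat]) auto

section \<open>The approximate inverse in the abstract algebra\<close>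

context toeplitz_factors
begin

text \<open>The \<open>X\<close> of the dual factors, that is, the semi-infinite inverse for the
  reversed symbol.\<close>

definition Y :: "int \<Rightarrow> int \<Rightarrow> 'a" where
  "Y s t = (\<Sum>l\<in>{1..s}. adj (a (s - l)) * a (t - l))"

definition approx_inverse :: "real \<Rightarrow> nat \<Rightarrow> nat \<Rightarrow> nat \<Rightarrow> 'a" where
  "approx_inverse \<delta> n s t =
    (if s \<in> head_idx \<delta> n \<and> t \<in> head_idx \<delta> n then X (int s) (int t)
     else if s \<in> tail_idx \<delta> n \<and> t \<in> tail_idx \<delta> n then Y (int (n + 1 - s)) (int (n + 1 - t))
     else (1 / 2) *\<^sub>R (X (int s) (int t) + Y (int (n + 1 - s)) (int (n + 1 - t))))"

lemma adj_\<gamma>: "adj (\<gamma> k) = \<gamma> (- k)"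
proof -
  have "star \<gamma> (- k) = \<gamma> (- k)"
    unfolding symbol_c using star_conv[of c "star c" "- k"] conv_bdd_abs[OF conv_bdd_cc] by simp
  then show ?thesis by (simp add: star_def)
qed

text \<open>A homogeneous system is a column with \<open>\<eta> = 0\<close>, for which the column
  estimate, taken at \<open>t = 1\<close> with \<open>\<delta> = 1\<close>, has the bound
  \<open>0\<close>.\<close>

lemma finite_section_injective:
  "\<exists>N. \<forall>n\<ge>N. \<forall>x :: nat \<Rightarrow> 'a. (\<forall>s\<in>{1..n}. (\<Sum>l=1..n. \<gamma> (int s - int l) * x l) = 0) \<longrightarrow> (\<forall>s\<in>{1..n}. x s = 0)"
proof -
  obtain C N where C: "\<And>n t x \<eta>. n \<ge> N \<Longrightarrow> 1 \<le> t \<Longrightarrow> t \<le> int n \<Longrightarrow> 1 * real n \<le> of_int (int n - t + 1) \<Longrightarrow>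
    (\<forall>k. k \<notin> {1..int n} \<longrightarrow> x k = 0) \<Longrightarrow>
    (\<forall>s\<in>{1..int n}. (\<gamma> \<star> x) s = (if s = t then \<eta> else 0)) \<Longrightarrow>
    (\<Sum>s\<in>{1..int n}. norm (x s - X s t * \<eta>)) \<le> C * real n powr (- d) * norm \<eta>"
    using column_estimate[OF zero_less_one order_refl] by blast
  have "x s = 0" if n: "n \<ge> N" and x: "\<And>s. s \<in> {1..n} \<Longrightarrow> (\<Sum>l=1..n. \<gamma> (int s - int l) * x l) = 0" and s: "s \<in> {1..n}"
    for n and x :: "nat \<Rightarrow> 'a" and s
  proof -
    define x' where "x' = (\<lambda>k. if k \<in> {1..int n} then x (nat k) else 0)"
    have x'0: "x' k = 0" if "k \<notin> {1..int n}" for k using that by (auto simp: x'_def)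
    have "(\<gamma> \<star> x') k = 0" if "k \<in> {1..int n}" for k
    proof -
      have "(\<gamma> \<star> x') k = (\<Sum>l=1..n. \<gamma> (k - int l) * x' (int l))" by (rule conv_finite_support[OF x'0])
      also have "\<dots> = (\<Sum>l=1..n. \<gamma> (int (nat k) - int l) * x l)"
        using that by (intro sum.cong) (auto simp: x'_def)
      also have "\<dots> = 0" by (rule x) (use that in auto)
      finally show ?thesis .
    qed
    then have "(\<Sum>k\<in>{1..int n}. norm (x' k - X k 1 * 0)) \<le> C * real n powr (- d) * norm (0 :: 'a)"
      using s x'0 by (intro C[OF n]) auto
    then have "(\<Sum>k\<in>{1..int n}. norm (x' k)) = 0" using sum_nonneg[of "{1..int n}" "\<lambda>k. norm (x' k)"] by simp
    then have "x' (int s) = 0" using s by (subst (asm) sum_nonneg_eq_0_iff) auto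
    then show ?thesis using s by (simp add: x'_def)
  qed
  then show ?thesis by blast
qed

text \<open>\<open>\<delta> \<le> 1 / 2\<close> keeps head and tail disjoint; an index outside one
  of them has distance at least \<open>\<delta> * n\<close> from the corresponding end.\<close>

lemma head_tail_bounds:
  assumes \<delta>: "0 < \<delta>" "\<delta> \<le> 1 / 2" and st: "s \<in> {1..n}" "t \<in> {1..n}"
  shows "\<not> (s \<in> head_idx \<delta> n \<and> t \<in> head_idx \<delta> n) \<Longrightarrow> \<delta> * real n \<le> real s \<or> \<delta> * real n \<le> real t"
    and "\<not> (s \<in> tail_idx \<delta> n \<and> t \<in> tail_idx \<delta> n) \<Longrightarrow> \<delta> * real n \<le> real (n + 1 - s) \<or> \<delta> * real n \<le> real (n + 1 - t)"
    and "t \<notin> tail_idx \<delta> n \<Longrightarrow> \<delta> * real n \<le> real (n + 1 - t)"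
    and "t \<in> tail_idx \<delta> n \<Longrightarrow> \<delta> * real n \<le> real t \<and> t \<notin> head_idx \<delta> n"
proof -
  define m where "m = nat \<lfloor>\<delta> * real n\<rfloor>"
  have m0: "0 \<le> \<delta> * real n" using \<delta> by simp
  have m1: "real m \<le> \<delta> * real n" "\<delta> * real n < real m + 1"
    using m0 by (simp_all add: m_def)
  have "\<delta> * real n \<le> 1 / 2 * real n" using \<delta> by (intro mult_right_mono) auto
  then have m2: "2 * m \<le> n" using m1 by linarith
  have H: "u \<in> head_idx \<delta> n \<longleftrightarrow> 1 \<le> u \<and> u \<le> m" for u by (auto simp: head_idx_def m_def)
  have T: "u \<in> tail_idx \<delta> n \<longleftrightarrow> n - m + 1 \<le> u \<and> u \<le> n" for u by (auto simp: tail_idx_def m_def)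
  have not_head: "\<delta> * real n \<le> real u" if "u \<notin> head_idx \<delta> n" "u \<in> {1..n}" for u
  proof -
    have "m + 1 \<le> u" using that H by auto
    then show ?thesis using m1 by linarith
  qed
  have not_tail: "\<delta> * real n \<le> real (n + 1 - u)" if "u \<notin> tail_idx \<delta> n" "u \<in> {1..n}" for u
  proof -
    have "m + 1 \<le> n + 1 - u" using that T m2 by auto
    then show ?thesis using m1 by linarith
  qed
  show "\<not> (s \<in> head_idx \<delta> n \<and> t \<in> head_idx \<delta> n) \<Longrightarrow> \<delta> * real n \<le> real s \<or> \<delta> * real n \<le> real t"
    using not_head st by blast
  show "\<not> (s \<in> tail_idx \<delta> n \<and> t \<in> tail_idx \<delta> n) \<Longrightarrow> \<delta> * real n \<le> real (n + 1 - s) \<or> \<delta> * real n \<le> real (n + 1 - t)"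
    using not_tail st by blast
  show "t \<notin> tail_idx \<delta> n \<Longrightarrow> \<delta> * real n \<le> real (n + 1 - t)" using not_tail st by blast
  show "\<delta> * real n \<le> real t \<and> t \<notin> head_idx \<delta> n" if "t \<in> tail_idx \<delta> n"
  proof -
    have "t \<notin> head_idx \<delta> n" using that H T m2 by auto
    then show ?thesis using not_head st by blast
  qed
qed

text \<open>Both are within \<open>O(n powr (- 1 - d))\<close> of \<open>\<omega> (s - t)\<close>:
  \<open>X\<close> because \<open>s\<close> or \<open>t\<close> is far from the left end,
  \<open>Y\<close> because \<open>s\<close> or \<open>t\<close> is far from the right end.\<close>

lemma X_near_Y:
  assumes \<delta>: "0 < \<delta>" "\<delta> \<le> 1 / 2"
  shows "\<exists>K. \<forall>n s t. s \<in> {1..n} \<longrightarrow> t \<in> {1..n} \<longrightarrow> \<not> (s \<in> head_idx \<delta> n \<and> t \<in> head_idx \<delta> n) \<longrightarrow>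
    \<not> (s \<in> tail_idx \<delta> n \<and> t \<in> tail_idx \<delta> n) \<longrightarrow>
    norm (X (int s) (int t) - Y (int (n + 1 - s)) (int (n + 1 - t))) \<le> K * real n powr (- 1 - d)"
proof -
  interpret dual: toeplitz_factors d "\<lambda>k. adj (b k)" "\<lambda>k. adj (a k)" "\<lambda>k. adj (e k)" "\<lambda>k. adj (c k)" "\<lambda>k. \<gamma> (- k)"
    by (rule toeplitz_factors_dual)
  have dX: "dual.X s t = Y s t" for s t by (simp add: dual.X_def Y_def)
  have d\<omega>: "dual.\<omega> k = \<omega> (- k)" for k
  proof -
    have "star (\<lambda>k. adj (b k)) = (\<lambda>k. b (- k))" "(\<lambda>k. adj (b k)) = (\<lambda>k. star b (- k))"
      by (simp_all add: fun_eq_iff star_def)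
    then show ?thesis unfolding dual.\<omega>_def \<omega>_eq by (simp only: conv_reflect)
  qed
  obtain K where K: "\<And>s t. s \<ge> 1 \<Longrightarrow> t \<ge> 1 \<Longrightarrow> norm (\<omega> (s - t) - X s t) \<le> K * wt (1 + d) s \<and> norm (\<omega> (s - t) - X s t) \<le> K * wt (1 + d) t"
    using X_near_\<omega> by blast
  obtain L where L: "\<And>s t. s \<ge> 1 \<Longrightarrow> t \<ge> 1 \<Longrightarrow> norm (\<omega> (t - s) - Y s t) \<le> L * wt (1 + d) s \<and> norm (\<omega> (t - s) - Y s t) \<le> L * wt (1 + d) t"
    using dual.X_near_\<omega> unfolding dX d\<omega> by auto
  have wn: "\<not> wt (1 + d) 1 \<le> 0" using wt_pos[of "1 + d" 1] by linarith
  have K0: "K \<ge> 0" "L \<ge> 0"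
    using order_trans[OF norm_ge_zero conjunct1[OF K[of 1 1]]] order_trans[OF norm_ge_zero conjunct1[OF L[of 1 1]]] wn
    by (auto simp: zero_le_mult_iff)
  have w: "wt (1 + d) (int u) \<le> \<delta> powr (- 1 - d) * real n powr (- 1 - d)" if "\<delta> * real n \<le> real u" "n \<ge> 1" for u n
  proof -
    have "wt (1 + d) (int u) \<le> (\<delta> * real n) powr (- (1 + d))"
      unfolding wt_def using that \<delta> d by (intro powr_mono2') auto
    then show ?thesis using \<delta> by (simp add: powr_mult)
  qed
  have "norm (X (int s) (int t) - Y (int (n + 1 - s)) (int (n + 1 - t))) \<le> ((K + L) * \<delta> powr (- 1 - d)) * real n powr (- 1 - d)"
    if st: "s \<in> {1..n}" "t \<in> {1..n}" and nh: "\<not> (s \<in> head_idx \<delta> n \<and> t \<in> head_idx \<delta> n)"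
      and nt: "\<not> (s \<in> tail_idx \<delta> n \<and> t \<in> tail_idx \<delta> n)" for n s t
  proof -
    let ?W = "\<delta> powr (- 1 - d) * real n powr (- 1 - d)"
    have n1: "n \<ge> 1" using st by simp
    have k: "norm (\<omega> (int s - int t) - X (int s) (int t)) \<le> K * wt (1 + d) (int s)"
      "norm (\<omega> (int s - int t) - X (int s) (int t)) \<le> K * wt (1 + d) (int t)"
      using K[of "int s" "int t"] st by auto
    have l: "norm (\<omega> (int s - int t) - Y (int (n + 1 - s)) (int (n + 1 - t))) \<le> L * wt (1 + d) (int (n + 1 - s))"
      "norm (\<omega> (int s - int t) - Y (int (n + 1 - s)) (int (n + 1 - t))) \<le> L * wt (1 + d) (int (n + 1 - t))"
    proof -
      have "int (n + 1 - t) - int (n + 1 - s) = int s - int t" using st by auto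
      then show "norm (\<omega> (int s - int t) - Y (int (n + 1 - s)) (int (n + 1 - t))) \<le> L * wt (1 + d) (int (n + 1 - s))"
        "norm (\<omega> (int s - int t) - Y (int (n + 1 - s)) (int (n + 1 - t))) \<le> L * wt (1 + d) (int (n + 1 - t))"
        using L[of "int (n + 1 - s)" "int (n + 1 - t)"] st by auto
    qed
    have 1: "norm (\<omega> (int s - int t) - X (int s) (int t)) \<le> K * ?W"
      using head_tail_bounds(1)[OF \<delta> st nh]
    proof
      assume "\<delta> * real n \<le> real s"
      from mult_left_mono[OF w[OF this n1] K0(1)] k(1) show ?thesis by linarith
    next
      assume "\<delta> * real n \<le> real t"
      from mult_left_mono[OF w[OF this n1] K0(1)] k(2) show ?thesis by linarith
    qed
    have 2: "norm (\<omega> (int s - int t) - Y (int (n + 1 - s)) (int (n + 1 - t))) \<le> L * ?W"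
      using head_tail_bounds(2)[OF \<delta> st nt]
    proof
      assume "\<delta> * real n \<le> real (n + 1 - s)"
      from mult_left_mono[OF w[OF this n1] K0(2)] l(1) show ?thesis by linarith
    next
      assume "\<delta> * real n \<le> real (n + 1 - t)"
      from mult_left_mono[OF w[OF this n1] K0(2)] l(2) show ?thesis by linarith
    qed
    have "X (int s) (int t) - Y (int (n + 1 - s)) (int (n + 1 - t))
        = (\<omega> (int s - int t) - Y (int (n + 1 - s)) (int (n + 1 - t))) - (\<omega> (int s - int t) - X (int s) (int t))" by simp
    then have "norm (X (int s) (int t) - Y (int (n + 1 - s)) (int (n + 1 - t))) \<le> L * ?W + K * ?W"
      using norm_triangle_ineq4[of "\<omega> (int s - int t) - Y (int (n + 1 - s)) (int (n + 1 - t))" "\<omega> (int s - int t) - X (int s) (int t)"] 1 2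
      by simp
    then show ?thesis by (simp add: algebra_simps)
  qed
  then show ?thesis by blast
qed

lemma column_estimate_nat:
  assumes \<delta>: "0 < \<delta>" "\<delta> \<le> 1"
  shows "\<exists>C N. \<forall>n\<ge>N. \<forall>t x. t \<in> {1..n} \<longrightarrow> \<delta> * real n \<le> real (n + 1 - t) \<longrightarrow>
    (\<forall>s\<in>{1..n}. (\<Sum>l=1..n. \<gamma> (int s - int l) * x l) = (if s = t then 1 else 0)) \<longrightarrow>
    (\<Sum>s=1..n. norm (x s - X (int s) (int t))) \<le> C * real n powr (- d)"
proof -
  obtain C N where C: "\<And>n t x \<eta>. n \<ge> N \<Longrightarrow> 1 \<le> t \<Longrightarrow> t \<le> int n \<Longrightarrow> \<delta> * real n \<le> of_int (int n - t + 1) \<Longrightarrow>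
    (\<forall>k. k \<notin> {1..int n} \<longrightarrow> x k = 0) \<Longrightarrow>
    (\<forall>s\<in>{1..int n}. (\<gamma> \<star> x) s = (if s = t then \<eta> else 0)) \<Longrightarrow>
    (\<Sum>s\<in>{1..int n}. norm (x s - X s t * \<eta>)) \<le> C * real n powr (- d) * norm \<eta>"
    using column_estimate[OF \<delta>] by blast
  have "(\<Sum>s=1..n. norm (x s - X (int s) (int t))) \<le> C * real n powr (- d)"
    if n: "n \<ge> N" and t: "t \<in> {1..n}" "\<delta> * real n \<le> real (n + 1 - t)"
      and x: "\<And>s. s \<in> {1..n} \<Longrightarrow> (\<Sum>l=1..n. \<gamma> (int s - int l) * x l) = (if s = t then 1 else 0)"
    for n t and x :: "nat \<Rightarrow> 'a"
  proof -
    define x' where "x' = (\<lambda>k. if k \<in> {1..int n} then x (nat k) else 0)"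
    have x'0: "x' k = 0" if "k \<notin> {1..int n}" for k using that by (auto simp: x'_def)
    have "(\<gamma> \<star> x') k = (if k = int t then 1 else 0)" if "k \<in> {1..int n}" for k
    proof -
      have "(\<gamma> \<star> x') k = (\<Sum>l=1..n. \<gamma> (k - int l) * x' (int l))" by (rule conv_finite_support[OF x'0])
      also have "\<dots> = (\<Sum>l=1..n. \<gamma> (int (nat k) - int l) * x l)"
        using that by (intro sum.cong) (auto simp: x'_def)
      also have "\<dots> = (if nat k = t then 1 else 0)" by (rule x) (use that in auto)
      finally show ?thesis using that by auto
    qed
    moreover have "\<delta> * real n \<le> of_int (int n - int t + 1)" using t by simp
    ultimately have "(\<Sum>k\<in>{1..int n}. norm (x' k - X k (int t) * 1)) \<le> C * real n powr (- d) * norm (1 :: 'a)"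
      using t x'0 by (intro C[OF n]) auto
    then show ?thesis by (simp add: sum_nat_int_interval x'_def)
  qed
  then show ?thesis by blast
qed

text \<open>A column outside the tail is compared with \<open>X\<close>, a tail column after
  reversal with \<open>Y\<close>. Elsewhere in such a column the approximant is an average of two
  nearly equal entries, at a cost of \<open>O(n powr (- 1 - d))\<close> for each of the
  \<open>n\<close> rows.\<close>

theorem approx_inverse_estimate:
  assumes \<delta>: "0 < \<delta>" "\<delta> \<le> 1 / 2"
  shows "\<exists>C N. \<forall>n\<ge>N. \<forall>D t. t \<in> {1..n} \<longrightarrow>
    (\<forall>s\<in>{1..n}. \<forall>t\<in>{1..n}. (\<Sum>l=1..n. \<gamma> (int s - int l) * D l t) = (if s = t then 1 else 0)) \<longrightarrow>
    (\<Sum>s=1..n. norm (D s t - approx_inverse \<delta> n s t)) \<le> C * real n powr (- d)"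
proof -
  interpret dual: toeplitz_factors d "\<lambda>k. adj (b k)" "\<lambda>k. adj (a k)" "\<lambda>k. adj (e k)" "\<lambda>k. adj (c k)" "\<lambda>k. \<gamma> (- k)"
    by (rule toeplitz_factors_dual)
  have dX: "dual.X s t = Y s t" for s t by (simp add: dual.X_def Y_def)
  have \<delta>1: "\<delta> \<le> 1" using \<delta> by simp
  obtain C\<^sub>1 N\<^sub>1 where C1: "\<And>n t x. n \<ge> N\<^sub>1 \<Longrightarrow> t \<in> {1..n} \<Longrightarrow> \<delta> * real n \<le> real (n + 1 - t) \<Longrightarrow>
    (\<forall>s\<in>{1..n}. (\<Sum>l=1..n. \<gamma> (int s - int l) * x l) = (if s = t then 1 else 0)) \<Longrightarrow>
    (\<Sum>s=1..n. norm (x s - X (int s) (int t))) \<le> C\<^sub>1 * real n powr (- d)"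
    using column_estimate_nat[OF \<delta>(1) \<delta>1] by blast
  obtain C\<^sub>2 N\<^sub>2 where C2: "\<And>n t x. n \<ge> N\<^sub>2 \<Longrightarrow> t \<in> {1..n} \<Longrightarrow> \<delta> * real n \<le> real (n + 1 - t) \<Longrightarrow>
    (\<forall>s\<in>{1..n}. (\<Sum>l=1..n. \<gamma> (- (int s - int l)) * x l) = (if s = t then 1 else 0)) \<Longrightarrow>
    (\<Sum>s=1..n. norm (x s - Y (int s) (int t))) \<le> C\<^sub>2 * real n powr (- d)"
    using dual.column_estimate_nat[OF \<delta>(1) \<delta>1] unfolding dX by blast
  obtain K where K: "\<And>n s t. s \<in> {1..n} \<Longrightarrow> t \<in> {1..n} \<Longrightarrow> \<not> (s \<in> head_idx \<delta> n \<and> t \<in> head_idx \<delta> n) \<Longrightarrow>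
    \<not> (s \<in> tail_idx \<delta> n \<and> t \<in> tail_idx \<delta> n) \<Longrightarrow>
    norm (X (int s) (int t) - Y (int (n + 1 - s)) (int (n + 1 - t))) \<le> K * real n powr (- 1 - d)"
    using X_near_Y[OF \<delta>] by blast
  define K' where "K' = \<bar>K\<bar>"
  have "(\<Sum>s=1..n. norm (D s t - approx_inverse \<delta> n s t)) \<le> (\<bar>C\<^sub>1\<bar> + \<bar>C\<^sub>2\<bar> + K') * real n powr (- d)"
    if n: "n \<ge> max N\<^sub>1 N\<^sub>2" and t: "t \<in> {1..n}"
      and D: "\<And>s t. s \<in> {1..n} \<Longrightarrow> t \<in> {1..n} \<Longrightarrow> (\<Sum>l=1..n. \<gamma> (int s - int l) * D l t) = (if s = t then 1 else 0)"
    for n t and D :: "nat \<Rightarrow> nat \<Rightarrow> 'a"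
  proof -
    let ?P = "real n powr (- d)" and ?Q = "K' * real n powr (- 1 - d)"
    let ?Y = "\<lambda>s. Y (int (n + 1 - s)) (int (n + 1 - t))" and ?X = "\<lambda>s. X (int s) (int t)"
    have Q0: "?Q \<ge> 0" by (simp add: K'_def)
    have n1: "real n \<ge> 1" using t by simp
    have XY: "norm (?X s - ?Y s) \<le> ?Q" if "s \<in> {1..n}" "\<not> (s \<in> head_idx \<delta> n \<and> t \<in> head_idx \<delta> n)"
      "\<not> (s \<in> tail_idx \<delta> n \<and> t \<in> tail_idx \<delta> n)" for s
    proof -
      have "norm (?X s - ?Y s) \<le> K * real n powr (- 1 - d)" by (rule K) (use that t in auto)
      also have "\<dots> \<le> ?Q" unfolding K'_def by (intro mult_right_mono) auto
      finally show ?thesis .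
    qed
    have half: "norm (u - (1 / 2) *\<^sub>R (p + q)) \<le> norm (u - p) + norm (p - q)" for u p q :: 'a
    proof -
      have "(1 / 2) *\<^sub>R (p - q) + (1 / 2) *\<^sub>R (p + q) = p"
        by (simp flip: scaleR_add_right scaleR_2)
      then have "(1 / 2) *\<^sub>R (p + q) = p - (1 / 2) *\<^sub>R (p - q)" by (simp only: eq_diff_eq add.commute)
      then have "u - (1 / 2) *\<^sub>R (p + q) = (u - p) + (1 / 2) *\<^sub>R (p - q)" by simp
      then have "norm (u - (1 / 2) *\<^sub>R (p + q)) \<le> norm (u - p) + norm ((1 / 2) *\<^sub>R (p - q))"
        by (simp only: norm_triangle_ineq)
      moreover have "norm ((1 / 2) *\<^sub>R (p - q)) \<le> norm (p - q)" by simp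
      ultimately show ?thesis by linarith
    qed
    have half': "norm (u - (1 / 2) *\<^sub>R (p + q)) \<le> norm (u - q) + norm (p - q)" for u p q :: 'a
      using half[of u q p] by (simp only: add.commute[of q p] norm_minus_commute[of q p])
    have sumQ: "(\<Sum>s=1..n. z s + ?Q) = (\<Sum>s=1..n. z s) + K' * ?P" for z :: "nat \<Rightarrow> real"
    proof -
      have "real n * real n powr (- 1 - d) = ?P"
        using n1 powr_add[of "real n" 1 "- 1 - d"] by simp
      then show ?thesis by (simp add: sum.distrib mult.left_commute)
    qed
    show ?thesis
    proof (cases "t \<in> tail_idx \<delta> n")
      case False
      have "norm (D s t - approx_inverse \<delta> n s t) \<le> norm (D s t - ?X s) + ?Q" if s: "s \<in> {1..n}" for s
        using False Q0 half[of "D s t" "?X s" "?Y s"] XY[OF s] unfolding approx_inverse_def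
        by (cases "s \<in> head_idx \<delta> n \<and> t \<in> head_idx \<delta> n") auto
      then have "(\<Sum>s=1..n. norm (D s t - approx_inverse \<delta> n s t)) \<le> (\<Sum>s=1..n. norm (D s t - ?X s) + ?Q)"
        by (rule sum_mono)
      also have "\<dots> \<le> C\<^sub>1 * ?P + K' * ?P"
        unfolding sumQ using C1[of n t "\<lambda>s. D s t"] n t D head_tail_bounds(3)[OF \<delta> t t False] by auto
      also have "\<dots> \<le> (\<bar>C\<^sub>1\<bar> + \<bar>C\<^sub>2\<bar> + K') * ?P"
        unfolding distrib_right[symmetric] by (intro mult_right_mono) auto
      finally show ?thesis .
    next
      case True
      have tb: "\<delta> * real n \<le> real t" "t \<notin> head_idx \<delta> n" using head_tail_bounds(4)[OF \<delta> t t True] by auto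
      define t' where "t' = n + 1 - t"
      have t': "t' \<in> {1..n}" "n + 1 - t' = t" using t by (auto simp: t'_def)
      \<comment> \<open>The reversed column solves the system of the reversed symbol, with the unit
        at \<open>t'\<close>.\<close>
      define x where "x = (\<lambda>s. D (n + 1 - s) t)"
      have "norm (D s t - approx_inverse \<delta> n s t) \<le> norm (D s t - ?Y s) + ?Q" if s: "s \<in> {1..n}" for s
        using tb Q0 half'[of "D s t" "?X s" "?Y s"] XY[OF s] unfolding approx_inverse_def
        by (cases "s \<in> tail_idx \<delta> n \<and> t \<in> tail_idx \<delta> n") auto
      then have "(\<Sum>s=1..n. norm (D s t - approx_inverse \<delta> n s t)) \<le> (\<Sum>s=1..n. norm (D s t - ?Y s) + ?Q)"
        by (rule sum_mono)
      also have "\<dots> = (\<Sum>s=1..n. norm (D s t - ?Y s)) + K' * ?P" by (rule sumQ)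
      also have "(\<Sum>s=1..n. norm (D s t - ?Y s)) = (\<Sum>s=1..n. norm (x s - Y (int s) (int t')))"
        by (rule sum.reindex_bij_witness[where i = "\<lambda>s. n + 1 - s" and j = "\<lambda>s. n + 1 - s"]) (auto simp: x_def t'_def)
      also have "\<dots> \<le> C\<^sub>2 * ?P"
      proof (rule C2)
        show "n \<ge> N\<^sub>2" "t' \<in> {1..n}" "\<delta> * real n \<le> real (n + 1 - t')" using n t' tb by auto
        show "\<forall>s\<in>{1..n}. (\<Sum>l=1..n. \<gamma> (- (int s - int l)) * x l) = (if s = t' then 1 else 0)"
        proof
          fix s assume s: "s \<in> {1..n}"
          have "(\<Sum>l=1..n. \<gamma> (- (int s - int l)) * x l) = (\<Sum>l=1..n. \<gamma> (int (n + 1 - s) - int l) * D l t)"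
            by (rule sum.reindex_bij_witness[where i = "\<lambda>s. n + 1 - s" and j = "\<lambda>s. n + 1 - s"])
              (use s in \<open>auto simp: x_def of_nat_diff algebra_simps\<close>)
          also have "\<dots> = (if n + 1 - s = t then 1 else 0)" by (rule D) (use s t in auto)
          finally show "(\<Sum>l=1..n. \<gamma> (- (int s - int l)) * x l) = (if s = t' then 1 else 0)"
            using s t by (auto simp: t'_def)
        qed
      qed
      also have "C\<^sub>2 * ?P + K' * ?P \<le> (\<bar>C\<^sub>1\<bar> + \<bar>C\<^sub>2\<bar> + K') * ?P"
        unfolding distrib_right[symmetric] by (intro mult_right_mono) auto
      finally show ?thesis by simp
    qed
  qed
  then show ?thesis by blast
qed

end

section \<open>The factors of the symbol\<close>

lemma mscale_nth [simp]: "mscale c A $ i $ j = c * A $ i $ j"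
  by (simp add: mscale_def map_matrix_def)

lemma mscale_mult: "mscale c A ** mscale d B = mscale (c * d) (A ** B)"
  by (simp add: vec_eq_iff matrix_matrix_mult_def sum_distrib_left mult_ac)

lemma sums_matrixI:
  fixes f :: "nat \<Rightarrow> complex^'q::finite^'q"
  assumes "\<And>i j. (\<lambda>k. f k $ i $ j) sums (S $ i $ j)"
  shows "f sums S"
  unfolding sums_def
  by (intro vec_tendstoI) (use assms in \<open>simp add: sums_def sum_component\<close>)

lemma integrable_matrixI:
  fixes E :: "'q::finite \<Rightarrow> 'q \<Rightarrow> 'a \<Rightarrow> complex"
  assumes "\<And>i j. integrable M (E i j)"
  shows "integrable M (\<lambda>x. (\<chi> i j. E i j x) :: complex^'q^'q)"
proof -
  have "bounded_linear (\<lambda>z :: complex. axis i (axis j z) :: complex^'q^'q)" for i j :: 'q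
    unfolding linear_conv_bounded_linear[symmetric]
    by (rule linearI) (auto simp: axis_def vec_eq_iff)
  then have "integrable M (\<lambda>x. \<Sum>i\<in>UNIV. \<Sum>j\<in>UNIV. axis i (axis j (E i j x)) :: complex^'q^'q)"
    by (intro Bochner_Integration.integrable_sum integrable_bounded_linear[OF _ assms])
  moreover have "(\<Sum>i\<in>UNIV. \<Sum>j\<in>UNIV. axis i (axis j (E i j x))) = ((\<chi> i j. E i j x) :: complex^'q^'q)" for x
  proof -
    have "(\<Sum>i\<in>UNIV. \<Sum>j\<in>UNIV. axis i (axis j (E i j x))) $ k $ l = E k l x" for k l
    proof -
      have "axis i (axis j z) $ k $ l = (if k = i then if l = j then z else 0 else 0)" for i j :: 'q and z :: complex
        by (simp add: axis_def)
      then have "(\<Sum>i\<in>UNIV. \<Sum>j\<in>UNIV. axis i (axis j (E i j x))) $ k $ l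
          = (\<Sum>i\<in>UNIV. \<Sum>j\<in>UNIV. if k = i then if l = j then E i j x else 0 else 0)"
        by (simp only: sum_component)
      also have "\<dots> = (\<Sum>i\<in>UNIV. if k = i then E i l x else 0)"
      proof (rule sum.cong[OF refl])
        fix i
        show "(\<Sum>j\<in>UNIV. if k = i then if l = j then E i j x else 0 else 0) = (if k = i then E i l x else 0)"
          by (cases "k = i") simp_all
      qed
      finally show ?thesis by simp
    qed
    then show ?thesis by (simp add: vec_eq_iff)
  qed
  ultimately show ?thesis by simp
qed

lemma h_fun_inverse:
  assumes "det (g z) \<noteq> 0" "z \<noteq> 1"
  shows "matrix_inv (h_fun d g z) = mscale ((1 - z) powr of_real d) (matrix_inv (g z))"
proof (rule matrix_inv_unique)
  have "(1 - z) powr of_real (- d) * (1 - z) powr of_real d = 1"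
    using assms(2) by (simp flip: powr_add)
  then show "h_fun d g z ** mscale ((1 - z) powr of_real d) (matrix_inv (g z)) = mat 1"
    unfolding h_fun_def mscale_mult by (simp add: mult_matrix_inv[OF assms(1)] vec_eq_iff)
qed

lemma neg_inv_coeffs_eq:
  fixes h :: "complex \<Rightarrow> complex^'q::finite^'q"
  assumes "\<And>z i j. z \<in> ball 0 1 \<Longrightarrow> (\<lambda>k. c k $ i $ j * z ^ k) sums (- matrix_inv (h z) $ i $ j)"
  shows "neg_inv_coeffs h = c"
  unfolding neg_inv_coeffs_def
proof (rule the_equality)
  show *: "\<forall>z\<in>ball 0 1. (\<lambda>k. mscale (z ^ k) (c k)) sums - matrix_inv (h z)"
    by (intro ballI sums_matrixI) (use assms in \<open>simp add: mult.commute\<close>)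
  fix c' assume c': "\<forall>z\<in>ball 0 1. (\<lambda>k. mscale (z ^ k) (c' k)) sums - matrix_inv (h z)"
  have sc: "mscale (of_real x ^ k) A = x ^ k *\<^sub>R A" for x :: real and k and A :: "complex^'q^'q"
    by (simp add: vec_eq_iff scaleR_conv_of_real[where 'a = complex])
  show "c' = c"
  proof (rule powser_unique)
    fix x :: real assume "0 < x" "x < 1"
    then have x: "of_real x \<in> ball (0 :: complex) 1" by simp
    show "(\<lambda>k. x ^ k *\<^sub>R c' k) sums - matrix_inv (h (of_real x))"
      using bspec[OF c' x] unfolding sc .
    show "(\<lambda>k. x ^ k *\<^sub>R c k) sums - matrix_inv (h (of_real x))"
      using bspec[OF * x] unfolding sc .
  qed
qed

lemma neg_inv_coeffs_cong:
  assumes "\<And>z. z \<in> ball 0 1 \<Longrightarrow> h z = h' z"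
  shows "neg_inv_coeffs h = neg_inv_coeffs h'"
proof -
  have "(\<forall>z\<in>ball 0 1. (\<lambda>k. mscale (z ^ k) (c k)) sums - matrix_inv (h z))
      = (\<forall>z\<in>ball 0 1. (\<lambda>k. mscale (z ^ k) (c k)) sums - matrix_inv (h' z))" for c
    by (intro ball_cong refl) (simp only: assms)
  then show ?thesis by (simp only: neg_inv_coeffs_def)
qed

lemma has_sum_finite_sum:
  fixes f :: "'m \<Rightarrow> 'i \<Rightarrow> 'b::topological_comm_monoid_add"
  assumes "\<And>m. m \<in> A \<Longrightarrow> (f m has_sum S m) B"
  shows "((\<lambda>x. \<Sum>m\<in>A. f m x) has_sum (\<Sum>m\<in>A. S m)) B"
  using assms by (induction A rule: infinite_finite_induct) (auto intro!: has_sum_add)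

lemma conv_star_nth:
  fixes c :: "int \<Rightarrow> 'q::finite cmat"
  assumes "conv_abs c (star c) k"
  shows "mat_of ((c \<star> star c) k) $ i $ j = (\<Sum>m\<in>UNIV. \<Sum>\<^sub>\<infinity>l. mat_of (c l) $ i $ m * cnj (mat_of (c (l - k)) $ j $ m))"
proof -
  have S: "(\<lambda>l. c l * star c (k - l)) summable_on UNIV" by (rule conv_abs_summable[OF assms])
  have "mat_of ((c \<star> star c) k) $ i $ j = (\<Sum>\<^sub>\<infinity>l. mat_of (c l * star c (k - l)) $ i $ j)"
    unfolding conv_def
    using infsumI[OF has_sum_bounded_linear[OF bounded_linear_mat_of_nth has_sum_infsum[OF S]], of i j] by simp
  also have "\<dots> = (\<Sum>\<^sub>\<infinity>l. \<Sum>m\<in>UNIV. mat_of (c l) $ i $ m * cnj (mat_of (c (l - k)) $ j $ m))"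
    by (simp add: matrix_matrix_mult_def star_def hconj_nth)
  also have "\<dots> = (\<Sum>m\<in>UNIV. \<Sum>\<^sub>\<infinity>l. mat_of (c l) $ i $ m * cnj (mat_of (c (l - k)) $ j $ m))"
  proof (rule infsumI, rule has_sum_finite_sum)
    fix m
    have "(\<lambda>l. norm (mat_of (c l) $ i $ m * cnj (mat_of (c (l - k)) $ j $ m))) summable_on UNIV"
    proof (rule summable_on_comparison_test[OF assms[unfolded conv_abs_def]])
      show "norm (mat_of (c l) $ i $ m * cnj (mat_of (c (l - k)) $ j $ m)) \<le> norm (c l) * norm (star c (k - l))" for l
      proof -
        have "norm (star c (k - l)) = norm (c (l - k))" by (simp add: norm_star)
        then show ?thesis
          using norm_entry_le[of "mat_of (c l)" i m] norm_entry_le[of "mat_of (c (l - k))" j m]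
          by (simp add: norm_mult mult_mono flip: norm_cmat_eq)
      qed
    qed auto
    then show "((\<lambda>l. mat_of (c l) $ i $ m * cnj (mat_of (c (l - k)) $ j $ m)) has_sum
        (\<Sum>\<^sub>\<infinity>l. mat_of (c l) $ i $ m * cnj (mat_of (c (l - k)) $ j $ m))) UNIV"
      by (rule has_sum_infsum[OF abs_summable_summable])
  qed
  finally show ?thesis .
qed

text \<open>\<open>a\<close> and \<open>c\<close> are the coefficients of
  \<open>- (1 - z)^d g^(-1)\<close> and \<open>(1 - z)^(-d) g\<close>. It is applied twice, to the
  symbol and to its reflection.\<close>

proposition symbol_factor:
  fixes g w :: "complex \<Rightarrow> complex^'q::finite^'q"
  assumes d: "0 < d" "d < 1 / 2" and g: "regular_rational g"
    and w: "\<And>z. norm z = 1 \<Longrightarrow> z \<noteq> 1 \<Longrightarrow> w z = (norm (1 - z) powr (- 2 * d)) *\<^sub>R (g z ** hconj (g z))"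
  obtains G Gi a c :: "int \<Rightarrow> 'q cmat" where
    "dec 4 G" "dec 4 Gi" "infsum G UNIV = Cmat (g 1)" "infsum Gi UNIV = Cmat (matrix_inv (g 1))"
    "a = (\<lambda>k. - (emb (bcoef d) \<star> Gi) k)" "c = emb (bcoef (- d)) \<star> G"
    "\<And>k. k < 0 \<Longrightarrow> a k = 0" "\<And>k. k < 0 \<Longrightarrow> c k = 0" "dec (1 + d) a" "dec (1 - d) c"
    "c \<star> a = delta 0 (- 1)" "a \<star> c = delta 0 (- 1)"
    "\<And>k. fourier_coeff w k = mat_of ((c \<star> star c) k)"
    "neg_inv_coeffs (h_fun d g) = (\<lambda>k. mat_of (a (int k)))"
proof -
  obtain G Gi :: "int \<Rightarrow> 'q cmat" where G: "\<And>k. k < 0 \<Longrightarrow> G k = 0" and Gi: "\<And>k. k < 0 \<Longrightarrow> Gi k = 0"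
    and dG: "dec 4 G" and dGi: "dec 4 Gi"
    and G_sums: "\<And>z i j. z \<in> cball 0 1 \<Longrightarrow> (\<lambda>k. mat_of (G (int k)) $ i $ j * z ^ k) sums (g z $ i $ j)"
    and Gi_sums: "\<And>z i j. z \<in> cball 0 1 \<Longrightarrow> (\<lambda>k. mat_of (Gi (int k)) $ i $ j * z ^ k) sums (matrix_inv (g z) $ i $ j)"
    and GGi: "G \<star> Gi = delta 0 1" "Gi \<star> G = delta 0 1"
    and sumG: "infsum G UNIV = Cmat (g 1)" and sumGi: "infsum Gi UNIV = Cmat (matrix_inv (g 1))"
    by (rule regular_rational_series[OF g]) (rule that)
  let ?\<alpha> = "emb (bcoef d) :: int \<Rightarrow> 'q cmat" and ?c = "emb (bcoef (- d)) :: int \<Rightarrow> 'q cmat"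
  have e0: "?\<alpha> k = 0" "?c k = 0" if "k < 0" for k using that by (simp_all add: emb_def)
  have \<alpha>c: "?\<alpha> \<star> ?c = delta 0 1" "?c \<star> ?\<alpha> = delta 0 1"
  proof -
    have l: "l1 (bcoef d)" and b: "bdd (bcoef (- d))"
      using l1_dec[OF dec_bcoef_d(1)[OF d]] bdd_dec[OF dec_bcoef_d(2)[OF d]] d by auto
    have "(?\<alpha> \<star> ?c) i = delta 0 1 i" for i
      using emb_conv[where 'a = "'q cmat", OF conv_bdd_abs[OF conv_bddI1[OF l b]], of i]
      by (simp add: bcoef_inverse emb_def delta_def)
    then show "?\<alpha> \<star> ?c = delta 0 1" by blast
    then show "?c \<star> ?\<alpha> = delta 0 1" by (simp only: emb_commute[of "bcoef (- d)" ?\<alpha>])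
  qed
  define a where "a = (\<lambda>k. - (?\<alpha> \<star> Gi) k)"
  define c where "c = ?c \<star> G"
  have a0: "a k = 0" if "k < 0" for k
    unfolding a_def using causal_conv[of ?\<alpha> Gi k] e0 Gi that by simp
  have c0: "c k = 0" if "k < 0" for k
    unfolding c_def by (rule causal_conv) (use e0 G that in auto)
  have da: "dec (1 + d) a"
    unfolding a_def dec_minus by (rule dec_conv[of "1 + d" _ 4]) (use dec_bcoef_d[OF d] dGi d in auto)
  have dc: "dec (1 - d) c"
    unfolding c_def by (rule dec_conv[of "1 - d" _ 4]) (use dec_bcoef_d[OF d] dG d in auto)
  have one: "delta 0 1 \<star> f = f" for f :: "int \<Rightarrow> 'q cmat"
    by (simp add: fun_eq_iff conv_delta_left)
  \<comment> \<open>The scalar sequence is moved past \<open>H\<close>, so that the binomial factors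
    meet their inverses and \<open>H\<close> meets \<open>K\<close>.\<close>
  have product: "emb p \<star> H \<star> (emb r \<star> K) = delta 0 1"
    if "emb p \<star> emb r = (delta 0 1 :: int \<Rightarrow> 'q cmat)" "H \<star> K = delta 0 1"
      "\<And>k. k < 0 \<Longrightarrow> emb p k = (0 :: 'q cmat)" "\<And>k. k < 0 \<Longrightarrow> emb r k = (0 :: 'q cmat)"
      "\<And>k. k < 0 \<Longrightarrow> H k = 0" "\<And>k. k < 0 \<Longrightarrow> K k = 0" for p r and H K :: "int \<Rightarrow> 'q cmat"
  proof -
    have z: "(f \<star> g) k = 0" if "\<And>k. k < 0 \<Longrightarrow> f k = 0" "\<And>k. k < 0 \<Longrightarrow> g k = 0" "k < 0" for f g :: "int \<Rightarrow> 'q cmat" and k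
      by (rule causal_conv) (use that in auto)
    have "emb p \<star> H \<star> (emb r \<star> K) = H \<star> emb p \<star> (emb r \<star> K)" by (simp only: emb_commute[of p H])
    also have "\<dots> = H \<star> (emb p \<star> (emb r \<star> K))"
      by (rule conv_assoc_causal) (use that z in auto)
    also have "emb p \<star> (emb r \<star> K) = emb p \<star> emb r \<star> K"
      by (rule conv_assoc_causal[symmetric]) (use that in auto)
    finally show ?thesis using that(1,2) by (simp add: one)
  qed
  have ca: "c \<star> a = delta 0 (- 1)"
  proof
    fix i
    have "(c \<star> a) i = - (?c \<star> G \<star> (?\<alpha> \<star> Gi)) i" unfolding a_def c_def by (rule conv_minus_right)
    also have "?c \<star> G \<star> (?\<alpha> \<star> Gi) = delta 0 1" by (rule product) (use \<alpha>c GGi e0 G Gi in auto)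
    finally show "(c \<star> a) i = delta 0 (- 1) i" by (simp add: delta_def)
  qed
  have ac: "a \<star> c = delta 0 (- 1)"
  proof
    fix i
    have "(a \<star> c) i = - (?\<alpha> \<star> Gi \<star> (?c \<star> G)) i" unfolding a_def c_def by (rule conv_minus_left)
    also have "?\<alpha> \<star> Gi \<star> (?c \<star> G) = delta 0 1" by (rule product) (use \<alpha>c GGi e0 G Gi in auto)
    finally show "(a \<star> c) i = delta 0 (- 1) i" by (simp add: delta_def)
  qed
  have inv: "neg_inv_coeffs (h_fun d g) = (\<lambda>k. mat_of (a (int k)))"
  proof (rule neg_inv_coeffs_eq)
    fix z :: complex and i j assume z: "z \<in> ball 0 1"
    then have "norm z < 1" "z \<noteq> 1" "det (g z) \<noteq> 0" using g by (auto simp: regular_rational_def)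
    moreover have "(\<lambda>k. mat_of ((?\<alpha> \<star> Gi) (int k)) $ i $ j * z ^ k) sums ((1 - z) powr of_real d * matrix_inv (g z) $ i $ j)"
      by (rule emb_conv_sums) (use d Gi dGi Gi_sums z in auto)
    from sums_minus[OF this] show "(\<lambda>k. mat_of (a (int k)) $ i $ j * z ^ k) sums (- matrix_inv (h_fun d g z) $ i $ j)"
      using calculation by (simp add: a_def h_fun_inverse)
  qed
  have fourier: "fourier_coeff w k = mat_of ((c \<star> star c) k)" for k
  proof -
    have p: "continuous_on (cball 0 1) (\<lambda>z. g z $ i $ j)" for i j
    proof -
      obtain R F E where RF: "R > 1" "F i j holomorphic_on ball 0 R" "\<And>z. z \<in> cball 0 1 \<Longrightarrow> g z $ i $ j = F i j z"
        using regular_rational_holomorphic[OF g] by metis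
      have "continuous_on (cball 0 1) (F i j)"
        by (rule continuous_on_subset[OF holomorphic_on_imp_continuous_on[OF RF(2)]]) (use RF(1) in auto)
      then show ?thesis by (rule continuous_on_eq) (use RF(3) in auto)
    qed
    define x where "x = (\<lambda>i j l. mat_of (c l) $ i $ j)"
    have x0: "x i j l = 0" if "l < 0" for i j l using c0[OF that] by (simp add: x_def)
    have dx: "dec (1 - d) (x i j)" for i j
    proof -
      obtain C where C: "\<And>l. norm (c l) \<le> C * wt (1 - d) l" using decE[OF dc] by blast
      have "norm (x i j l) \<le> C * wt (1 - d) l" for l
        using order_trans[OF norm_entry_le C[of l, unfolded norm_cmat_eq]] by (simp add: x_def)
      then show ?thesis by (auto simp: dec_def)
    qed
    have xs: "(\<lambda>n. x i j (int n) * z ^ n) sums ((1 - z) powr of_real (- d) * g z $ i $ j)" if "norm z < 1" for i j z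
      unfolding x_def c_def by (rule emb_conv_sums) (use d G dG G_sums that in auto)
    define \<Phi> where "\<Phi> = (\<lambda>i j m \<theta>. indicator {-pi..pi} \<theta> *\<^sub>R
      (cis (- (of_int k * \<theta>)) * (of_real (norm (1 - cis \<theta>) powr (- 2 * d)) * (g (cis \<theta>) $ i $ m * cnj (g (cis \<theta>) $ j $ m)))))"
    have \<Phi>: "integrable lborel (\<Phi> i j m)" "integral\<^sup>L lborel (\<Phi> i j m) = 2 * of_real pi * (\<Sum>\<^sub>\<infinity>l. x i m l * cnj (x j m (l - k)))" for i j m
      using abel_parseval[where x = "x i m" and y = "x j m" and k = k, OF d x0 dx x0 dx p p xs xs] by (simp_all add: \<Phi>_def)
    define E where "E = (\<lambda>i j \<theta>. \<Sum>m\<in>UNIV. \<Phi> i j m \<theta>)"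
    have E_int: "integrable lborel (E i j)" for i j
      unfolding E_def by (intro Bochner_Integration.integrable_sum \<Phi>)
    have E_val: "integral\<^sup>L lborel (E i j) = 2 * of_real pi * mat_of ((c \<star> star c) k) $ i $ j" for i j
    proof -
      have "conv_abs c (star c) k"
        by (rule conv_bdd_abs[OF conv_bdd_dec[OF dc]]) (use dc d in \<open>auto simp: dec_star\<close>)
      then show ?thesis
        unfolding E_def conv_star_nth by (simp add: Bochner_Integration.integral_sum \<Phi> sum_distrib_left x_def conv_star_nth)
    qed
    define V :: "real \<Rightarrow> complex^'q^'q" where "V = (\<lambda>\<theta>. \<chi> i j. E i j \<theta>)"
    have V_int: "integrable lborel V" unfolding V_def by (rule integrable_matrixI[OF E_int])
    define U :: "real \<Rightarrow> complex^'q^'q" where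
      "U = (\<lambda>\<theta>. indicator {-pi..pi} \<theta> *\<^sub>R mscale (cis (- of_int k * \<theta>)) (w (cis \<theta>)))"
    \<comment> \<open>\<open>w\<close> is prescribed only off the point \<open>1\<close>, so the
      integrands are compared for \<open>\<theta> \<noteq> 0\<close>.\<close>
    have UV: "U \<theta> = V \<theta>" if "\<theta> \<noteq> 0" for \<theta>
    proof (cases "\<theta> \<in> {-pi..pi}")
      case True
      then have "\<bar>\<theta>\<bar> \<le> pi" by auto
      then have "cis \<theta> \<noteq> 1" using cis_eq_1_iff_in_period that by blast
      then have "w (cis \<theta>) = (norm (1 - cis \<theta>) powr (- 2 * d)) *\<^sub>R (g (cis \<theta>) ** hconj (g (cis \<theta>)))" by (intro w) auto
      then show ?thesis
        using True by (simp add: U_def V_def E_def \<Phi>_def vec_eq_iff matrix_matrix_mult_def hconj_nth sum_distrib_left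
            scaleR_conv_of_real[where 'a = complex] mult_ac)
    next
      case False
      then have "indicat_real {-pi..pi} \<theta> = 0" by (rule indicator_simps(2))
      then show ?thesis unfolding U_def V_def E_def \<Phi>_def by (simp only:) (simp add: vec_eq_iff)
    qed
    \<comment> \<open>Measurability of \<open>U\<close> is inherited from \<open>V\<close>, from
      which it differs at most at \<open>0\<close>.\<close>
    have "U = (\<lambda>\<theta>. if \<theta> = 0 then U 0 else V \<theta>)" using UV by auto
    moreover have "(\<lambda>\<theta>. if \<theta> = 0 then U 0 else V \<theta>) \<in> borel_measurable lborel"
      using borel_measurable_integrable[OF V_int] by measurable
    ultimately have U_meas: "U \<in> borel_measurable lborel" by simp
    have "AE \<theta> in lborel. \<theta> \<noteq> (0 :: real)" by (rule AE_lborel_singleton)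
    then have "AE \<theta> in lborel. U \<theta> = V \<theta>" by eventually_elim (rule UV)
    then have UVi: "integral\<^sup>L lborel U = integral\<^sup>L lborel V"
      by (intro integral_cong_AE U_meas borel_measurable_integrable[OF V_int])
    have "integral\<^sup>L lborel V $ i $ j = 2 * of_real pi * mat_of ((c \<star> star c) k) $ i $ j" for i j
    proof -
      have "bounded_linear (\<lambda>A :: complex^'q^'q. A $ i $ j)"
        by (rule bounded_linear_compose[OF bounded_linear_vec_nth bounded_linear_vec_nth])
      from integral_bounded_linear[OF this V_int] show ?thesis using E_val[of i j] by (simp add: V_def)
    qed
    then show ?thesis
      unfolding fourier_coeff_def set_lebesgue_integral_def U_def[symmetric] UVi
      by (simp add: vec_eq_iff scaleR_conv_of_real[where 'a = complex])
  qed
  show thesis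
    by (rule that[OF dG dGi sumG sumGi a_def c_def a0 c0 da dc ca ac fourier inv])
qed

section \<open>Block linear algebra\<close>

text \<open>Gaussian elimination by induction on the columns. The index sets are arbitrary finite
  sets so that the entries of blocks can be indexed by pairs.\<close>

lemma square_system_solvable:
  fixes M :: "'i \<Rightarrow> 'j \<Rightarrow> 'k::field"
  assumes "finite J" "finite I" "card I = card J"
    and "\<And>v. (\<And>i. i \<in> I \<Longrightarrow> (\<Sum>j\<in>J. M i j * v j) = 0) \<Longrightarrow> (\<And>j. j \<in> J \<Longrightarrow> v j = 0)"
  shows "\<exists>v. \<forall>i\<in>I. (\<Sum>j\<in>J. M i j * v j) = y i"
  using assms
proof (induction J arbitrary: I M y rule: finite_induct)
  case empty
  then show ?case by simp
next
  case (insert j\<^sub>0 J)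
  note inj = insert.prems(3)
  have "\<exists>i\<^sub>0\<in>I. M i\<^sub>0 j\<^sub>0 \<noteq> 0"
  proof (rule ccontr)
    assume "\<not> ?thesis"
    then have "(\<Sum>j\<in>insert j\<^sub>0 J. M i j * (if j = j\<^sub>0 then 1 else 0)) = 0" if "i \<in> I" for i
      using that insert.hyps by (auto intro!: sum.neutral)
    from inj[OF this, of j\<^sub>0] show False by simp
  qed
  then obtain i\<^sub>0 where i0: "i\<^sub>0 \<in> I" "M i\<^sub>0 j\<^sub>0 \<noteq> 0" by blast
  \<comment> \<open>The Schur complement of the pivot; \<open>ext\<close> is back substitution for
    the pivot variable when the pivot row has right-hand side \<open>r\<close>.\<close>
  define M' where "M' = (\<lambda>i j. M i j - M i j\<^sub>0 / M i\<^sub>0 j\<^sub>0 * M i\<^sub>0 j)"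
  define ext where "ext = (\<lambda>r v j. if j = j\<^sub>0 then (r - (\<Sum>j\<in>J. M i\<^sub>0 j * v j)) / M i\<^sub>0 j\<^sub>0 else v j)"
  have ext: "(\<Sum>j\<in>insert j\<^sub>0 J. M i j * ext r v j) = (\<Sum>j\<in>J. M' i j * v j) + M i j\<^sub>0 / M i\<^sub>0 j\<^sub>0 * r" for i r v
  proof -
    have "(\<Sum>j\<in>J. M i j * ext r v j) = (\<Sum>j\<in>J. M i j * v j)"
      using insert.hyps by (intro sum.cong) (auto simp: ext_def)
    moreover have "(\<Sum>j\<in>J. M' i j * v j) = (\<Sum>j\<in>J. M i j * v j) - M i j\<^sub>0 / M i\<^sub>0 j\<^sub>0 * (\<Sum>j\<in>J. M i\<^sub>0 j * v j)"
      by (simp add: M'_def left_diff_distrib sum_subtractf sum_distrib_left mult.assoc)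
    ultimately show ?thesis
      using insert.hyps by (simp add: ext_def diff_divide_distrib right_diff_distrib)
  qed
  have M'0: "M' i\<^sub>0 j = 0" for j using i0 by (simp add: M'_def)
  have "\<exists>v. \<forall>i\<in>I - {i\<^sub>0}. (\<Sum>j\<in>J. M' i j * v j) = y i - M i j\<^sub>0 / M i\<^sub>0 j\<^sub>0 * y i\<^sub>0"
  proof (rule insert.IH)
    show "finite (I - {i\<^sub>0})" "card (I - {i\<^sub>0}) = card J" using insert.prems insert.hyps i0 by auto
    fix v j assume v: "\<And>i. i \<in> I - {i\<^sub>0} \<Longrightarrow> (\<Sum>j\<in>J. M' i j * v j) = 0" and j: "j \<in> J"
    have "(\<Sum>j\<in>insert j\<^sub>0 J. M i j * ext 0 v j) = 0" if "i \<in> I" for i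
      unfolding ext using v[of i] that by (cases "i = i\<^sub>0") (auto simp: M'0)
    from inj[OF this, of j] j insert.hyps show "v j = 0" by (auto simp: ext_def split: if_splits)
  qed
  then obtain v where v: "\<And>i. i \<in> I - {i\<^sub>0} \<Longrightarrow> (\<Sum>j\<in>J. M' i j * v j) = y i - M i j\<^sub>0 / M i\<^sub>0 j\<^sub>0 * y i\<^sub>0" by blast
  have "(\<Sum>j\<in>insert j\<^sub>0 J. M i j * ext (y i\<^sub>0) v j) = y i" if "i \<in> I" for i
    unfolding ext using v[of i] that i0 by (cases "i = i\<^sub>0") (auto simp: M'0)
  then show ?case by blast
qed

text \<open>Blocks are flattened to scalars indexed by pairs, and the columns of \<open>B\<close>
  solve the systems with unit vectors on the right.\<close>

lemma block_right_inverse: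
  fixes T :: "nat \<Rightarrow> nat \<Rightarrow> 'q::finite cmat"
  assumes inj: "\<And>x. (\<And>s. s \<in> {1..n} \<Longrightarrow> (\<Sum>l=1..n. T s l * x l) = 0) \<Longrightarrow> (\<And>s. s \<in> {1..n} \<Longrightarrow> x s = 0)"
  shows "\<exists>B. \<forall>s\<in>{1..n}. \<forall>t\<in>{1..n}. (\<Sum>l=1..n. T s l * B l t) = (if s = t then 1 else 0)"
proof -
  define I where "I = {1..n} \<times> (UNIV :: 'q set)"
  define M where "M = (\<lambda>(s, i) (l, m). mat_of (T s l) $ i $ m)"
  have entry: "mat_of (\<Sum>l=1..n. T s l * Cmat (\<chi> m k. v k (l, m))) $ i $ k = (\<Sum>p\<in>I. M (s, i) p * v k p)" for s i k and v :: "'q \<Rightarrow> nat \<times> 'q \<Rightarrow> complex"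
    by (simp add: mat_of_sum sum_component matrix_matrix_mult_def I_def M_def sum.cartesian_product case_prod_unfold)
  have "\<exists>v. \<forall>p\<in>I. (\<Sum>p'\<in>I. M p p' * v p') = y p" for y
  proof (rule square_system_solvable)
    fix v p assume v: "\<And>p. p \<in> I \<Longrightarrow> (\<Sum>p'\<in>I. M p p' * v p') = 0" and p: "p \<in> I"
    \<comment> \<open>A vector becomes a block column by repeating it in every column of each block,
      so that injectivity for blocks applies.\<close>
    have "(\<Sum>l=1..n. T s l * Cmat (\<chi> m k. v (l, m))) = 0" if "s \<in> {1..n}" for s
      unfolding mat_of_eq_iff vec_eq_iff using entry[of s "\<lambda>_. v"] v[of "(s, _)"] that by (simp add: I_def)
    from inj[OF this, of "fst p"] p have "Cmat (\<chi> m k. v (fst p, m)) = 0" by (auto simp: I_def)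
    then have "mat_of (Cmat (\<chi> m k. v (fst p, m))) $ snd p $ snd p = 0" by simp
    then show "v p = 0" by simp
  qed (auto simp: I_def)
  then obtain V where V: "\<And>y p. p \<in> I \<Longrightarrow> (\<Sum>p'\<in>I. M p p' * V y p') = y p" by metis
  define B where "B = (\<lambda>l t. Cmat (\<chi> m k. V (\<lambda>p. if p = (t, k) then 1 else 0) (l, m)))"
  have "(\<Sum>l=1..n. T s l * B l t) = (if s = t then 1 else 0)" if "s \<in> {1..n}" for s t
    unfolding B_def mat_of_eq_iff vec_eq_iff
    using entry[of s "\<lambda>k. V (\<lambda>p. if p = (t, k) then 1 else 0)"] V[of "(s, _)"] that
    by (auto simp: I_def mat_def)
  then show ?thesis by blast
qed

lemma block_id_iff:
  "is_block_id n (block_mult n A B) \<longleftrightarrow>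
    (\<forall>s\<in>{1..n}. \<forall>t\<in>{1..n}. (\<Sum>l=1..n. Cmat (A s l) * Cmat (B l t)) = (if s = t then 1 else 0))"
  unfolding is_block_id_def block_mult_def mat_of_eq_iff
  by (intro ball_cong refl) (simp add: mat_of_sum)

text \<open>If \<open>B\<close> is a right inverse of \<open>T\<close>, the columns of
  \<open>B T - 1\<close> are annihilated by \<open>T\<close>, so \<open>B\<close> is a left inverse
  too. Hence the choice in \<open>block_inv\<close> has a witness.\<close>

lemma block_inv_correct:
  fixes A :: "'q::finite block_matrix"
  assumes inj: "\<And>x. (\<And>s. s \<in> {1..n} \<Longrightarrow> (\<Sum>l=1..n. Cmat (A s l) * x l) = 0) \<Longrightarrow> (\<And>s. s \<in> {1..n} \<Longrightarrow> x s = 0)"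
  shows "is_block_id n (block_mult n A (block_inv n A))" "is_block_id n (block_mult n (block_inv n A) A)"
proof -
  let ?T = "\<lambda>s t. Cmat (A s t)"
  obtain B where B: "\<And>s t. s \<in> {1..n} \<Longrightarrow> t \<in> {1..n} \<Longrightarrow> (\<Sum>l=1..n. ?T s l * B l t) = (if s = t then 1 else 0)"
    using block_right_inverse[of n ?T] inj by blast
  have left: "(\<Sum>k=1..n. B s k * ?T k t) = (if s = t then 1 else 0)" if s: "s \<in> {1..n}" and t: "t \<in> {1..n}" for s t
  proof -
    define x where "x = (\<lambda>l. (\<Sum>k=1..n. B l k * ?T k t) - (if l = t then 1 else 0))"
    have "(\<Sum>l=1..n. ?T r l * x l) = 0" if r: "r \<in> {1..n}" for r
    proof -
      have "(\<Sum>l=1..n. ?T r l * (\<Sum>k=1..n. B l k * ?T k t)) = (\<Sum>k=1..n. (\<Sum>l=1..n. ?T r l * B l k) * ?T k t)"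
        by (simp add: sum_distrib_left sum_distrib_right mult.assoc) (rule sum.swap)
      also have "\<dots> = (\<Sum>k=1..n. (if r = k then 1 else 0) * ?T k t)"
        using B r by (intro sum.cong) auto
      also have "\<dots> = ?T r t" using r by (simp add: if_distrib[of "\<lambda>u. u * _"] cong: if_cong)
      finally have 1: "(\<Sum>l=1..n. ?T r l * (\<Sum>k=1..n. B l k * ?T k t)) = ?T r t" .
      have 2: "(\<Sum>l=1..n. ?T r l * (if l = t then 1 else 0)) = ?T r t"
        using t by (simp add: if_distrib[of "\<lambda>u. _ * u"] cong: if_cong)
      show ?thesis unfolding x_def right_diff_distrib sum_subtractf 1 2 by simp
    qed
    from inj[OF this s] show ?thesis by (simp add: x_def)
  qed
  have "is_block_id n (block_mult n A (\<lambda>s t. mat_of (B s t))) \<and> is_block_id n (block_mult n (\<lambda>s t. mat_of (B s t)) A)"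
    unfolding block_id_iff using B left by simp
  then have "\<exists>B. is_block_id n (block_mult n A B) \<and> is_block_id n (block_mult n B A)" by blast
  from someI_ex[OF this] show "is_block_id n (block_mult n A (block_inv n A))" "is_block_id n (block_mult n (block_inv n A) A)"
    unfolding block_inv_def by auto
qed

text \<open>The adjoint of a left inverse of a Hermitian matrix is a right inverse, and right
  inverses are unique by injectivity.\<close>

lemma block_inv_hermitian:
  fixes A :: "'q::finite block_matrix"
  assumes inj: "\<And>x. (\<And>s. s \<in> {1..n} \<Longrightarrow> (\<Sum>l=1..n. Cmat (A s l) * x l) = 0) \<Longrightarrow> (\<And>s. s \<in> {1..n} \<Longrightarrow> x s = 0)"
    and herm: "\<And>s t. hconj (A s t) = A t s" and st: "s \<in> {1..n}" "t \<in> {1..n}"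
  shows "hconj (block_inv n A s t) = block_inv n A t s"
proof -
  let ?T = "\<lambda>s t. Cmat (A s t)" and ?D = "\<lambda>s t. Cmat (block_inv n A s t)"
  have "is_block_id n (block_mult n A (block_inv n A))" by (rule block_inv_correct(1)) (use inj in blast)
  then have R: "(\<Sum>l=1..n. ?T s l * ?D l t) = (if s = t then 1 else 0)" if "s \<in> {1..n}" "t \<in> {1..n}" for s t
    using that unfolding block_id_iff by blast
  have "is_block_id n (block_mult n (block_inv n A) A)" by (rule block_inv_correct(2)) (use inj in blast)
  then have L: "(\<Sum>l=1..n. ?D s l * ?T l t) = (if s = t then 1 else 0)" if "s \<in> {1..n}" "t \<in> {1..n}" for s t
    using that unfolding block_id_iff by blast
  have adjT: "adj (?T s t) = ?T t s" for s t by (simp add: mat_of_eq_iff herm)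
  have "(\<Sum>l=1..n. ?T r l * (?D l s - adj (?D s l))) = 0" if r: "r \<in> {1..n}" for r
  proof -
    have "(\<Sum>l=1..n. ?T r l * adj (?D s l)) = adj (\<Sum>l=1..n. ?D s l * ?T l r)"
      by (simp add: adj_sum adj_mult adjT)
    then show ?thesis using R[OF r st(1)] L[OF st(1) r] by (simp add: right_diff_distrib sum_subtractf)
  qed
  from inj[OF this st(2)] have "?D t s = adj (?D s t)" by simp
  then show ?thesis by (simp add: mat_of_eq_iff)
qed

lemma block_norm_1_le:
  assumes "n \<ge> 1" "\<And>t. t \<in> {1..n} \<Longrightarrow> (\<Sum>s=1..n. spectral_norm (A s t)) \<le> K"
  shows "\<bar>block_norm_1 n A\<bar> \<le> K"
proof -
  have "block_norm_1 n A \<le> K" unfolding block_norm_1_def by (rule cSUP_least) (use assms in auto)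
  moreover have "0 \<le> (\<Sum>s=1..n. spectral_norm (A s 1))" by (intro sum_nonneg spectral_norm_nonneg)
  moreover have "(\<Sum>s=1..n. spectral_norm (A s 1)) \<le> block_norm_1 n A"
    unfolding block_norm_1_def by (rule cSUP_upper) (use assms in auto)
  ultimately show ?thesis by linarith
qed

lemma block_norm_inf_eq: "block_norm_inf n A = block_norm_1 n (\<lambda>s t. A t s)"
  by (simp add: block_norm_inf_def block_norm_1_def)

lemma spectral_norm_hconj [simp]: "spectral_norm (hconj A) = spectral_norm A"
  using norm_adj[of "Cmat A"] by (simp add: norm_cmat_eq)

lemma hconj_mat_1: "hconj (mat 1) = mat 1"
  by (simp add: vec_eq_iff hconj_nth mat_def)

lemma hconj_coeff_gram: "hconj (coeff_gram c s t) = coeff_gram c t s"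
proof -
  have "hconj (\<Sum>l\<in>A. F l) = (\<Sum>l\<in>A. hconj (F l))" for A and F :: "nat \<Rightarrow> complex^'a^'a"
    by (simp add: vec_eq_iff hconj_nth sum_component)
  then show ?thesis by (simp add: coeff_gram_def hconj_mult min.commute)
qed

lemma hconj_Omega: "hconj (Omega \<delta> d g gs n s t) = Omega \<delta> d g gs n t s"
proof -
  have add: "hconj ((1 / 2) *\<^sub>R (A + B)) = (1 / 2) *\<^sub>R (hconj A + hconj B)" for A B :: "complex^'a^'a"
    by (simp add: vec_eq_iff hconj_nth)
  show ?thesis by (auto simp: Omega_def Tinf_inv_def Tinf_tilde_inv_def hconj_coeff_gram add)
qed

text \<open>Terms with \<open>l > t\<close> vanish by causality, which reconciles the summation
  bounds \<open>s\<close> and \<open>min s t\<close>.\<close>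

lemma coeff_gram_eq:
  assumes "\<And>k. k < 0 \<Longrightarrow> a k = 0"
  shows "coeff_gram (\<lambda>k. mat_of (a (int k))) s t = mat_of (\<Sum>l\<in>{1..int s}. adj (a (int s - l)) * a (int t - l))"
proof -
  have "(\<Sum>l\<in>{1..int s}. adj (a (int s - l)) * a (int t - l)) = (\<Sum>l=1..s. adj (a (int s - int l)) * a (int t - int l))"
    by (rule sum_nat_int_interval)
  also have "\<dots> = (\<Sum>l=1..min s t. adj (a (int s - int l)) * a (int t - int l))"
    by (rule sum.mono_neutral_right) (use assms in auto)
  also have "\<dots> = (\<Sum>l=1..min s t. adj (a (int (s - l))) * a (int (t - l)))"
    by (rule sum.cong) (auto simp: of_nat_diff)
  finally show ?thesis by (simp add: coeff_gram_def mat_of_sum)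
qed

section \<open>The approximation theorem\<close>

text \<open>Conjugated coefficients keep the entries rational, and the adjoint of an invertible
  matrix is invertible.\<close>

lemma regular_rational_reflect:
  fixes g :: "complex \<Rightarrow> complex^'q::finite^'q"
  assumes "regular_rational g"
  shows "regular_rational (\<lambda>z. hconj (g (cnj z)))"
  unfolding regular_rational_def
proof (intro conjI allI ballI)
  fix i j
  obtain p r where pr: "\<And>z. z \<in> cball 0 1 \<Longrightarrow> poly r z \<noteq> 0 \<and> g z $ j $ i = poly p z / poly r z"
    using assms unfolding regular_rational_def by blast
  have cnj_poly: "poly (map_poly cnj p) z = cnj (poly p (cnj z))" for p z
    using poly_cnj[of p "cnj z"] by simp
  show "\<exists>p r. \<forall>z\<in>cball 0 1. poly r z \<noteq> 0 \<and> hconj (g (cnj z)) $ i $ j = poly p z / poly r z"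
  proof (intro exI ballI)
    fix z :: complex assume "z \<in> cball 0 1"
    then have "cnj z \<in> cball 0 1" by simp
    from pr[OF this] show "poly (map_poly cnj r) z \<noteq> 0 \<and>
        hconj (g (cnj z)) $ i $ j = poly (map_poly cnj p) z / poly (map_poly cnj r) z"
      by (simp add: cnj_poly hconj_nth)
  qed
next
  fix z :: complex assume "z \<in> cball 0 1"
  then have "det (g (cnj z)) \<noteq> 0" using assms by (simp add: regular_rational_def)
  from arg_cong[OF mult_matrix_inv(2)[OF this], of hconj]
  have "hconj (g (cnj z)) ** hconj (matrix_inv (g (cnj z))) = mat 1"
    by (simp add: hconj_mult hconj_mat_1)
  from arg_cong[OF this, of det] show "det (hconj (g (cnj z))) \<noteq> 0" by (auto simp: det_mul)
qed

lemma fourier_coeff_reflect: "fourier_coeff (\<lambda>z. w (cnj z)) k = fourier_coeff w (- k)"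
proof -
  have "(LINT \<theta>:{-pi..pi}|lborel. mscale (cis (- of_int (- k) * \<theta>)) (w (cis \<theta>)))
      = (LINT \<theta>:{-pi..pi}|lborel. mscale (cis (- of_int k * \<theta>)) (w (cnj (cis \<theta>))))"
    unfolding set_lebesgue_integral_def
    by (subst lborel_integral_real_affine[where c = "- 1" and t = 0])
      (simp_all add: cis_cnj indicator_def if_distrib conj_commute minus_le_iff le_minus_iff cong: if_cong)
  then show ?thesis by (simp add: fourier_coeff_def)
qed

lemma adj_conv:
  assumes "conv_abs g f i"
  shows "((\<lambda>k. adj (f k)) \<star> (\<lambda>k. adj (g k))) i = adj ((g \<star> f) i)"
proof -
  have "(\<lambda>k. adj (f k)) = (\<lambda>k. star f (- k))" "(\<lambda>k. adj (g k)) = (\<lambda>k. star g (- k))"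
    by (simp_all add: fun_eq_iff star_def)
  then have "((\<lambda>k. adj (f k)) \<star> (\<lambda>k. adj (g k))) i = (star f \<star> star g) (- i)"
    by (simp only: conv_reflect)
  also have "\<dots> = adj ((g \<star> f) i)"
    using star_conv[of g f "- i"] assms by (simp add: star_def)
  finally show ?thesis .
qed

theorem theorem3p4:
  fixes d \<delta> :: real
    and w g gs :: "complex \<Rightarrow> complex^'q::finite^'q"
  assumes d: "0 < d" "d < 1 / 2"
    and \<delta>: "0 < \<delta>" "\<delta> \<le> 1 / 2"
    and g: "regular_rational g"
    and w: "\<And>z. norm z = 1 \<Longrightarrow> z \<noteq> 1 \<Longrightarrow>
              w z = (norm (1 - z) powr (- 2 * d)) *\<^sub>R (g z ** hconj (g z))"
    and g_sharp: "regular_rational gs"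
    and factor: "\<And>z. norm z = 1 \<Longrightarrow> g z ** hconj (g z) = hconj (gs z) ** gs z"
  shows "(\<forall>n\<ge>1. block_hermitian n (Omega \<delta> d g gs n)) \<and>
    (\<lambda>n. block_norm_1 n (\<lambda>s t. block_inv n (toeplitz w) s t - Omega \<delta> d g gs n s t))
      \<in> O(\<lambda>n. real n powr (- d)) \<and>
    (\<lambda>n. block_norm_inf n (\<lambda>s t. block_inv n (toeplitz w) s t - Omega \<delta> d g gs n s t))
      \<in> O(\<lambda>n. real n powr (- d))"
proof -
  obtain G Gi a c :: "int \<Rightarrow> 'q cmat" where dG: "dec 4 G" "dec 4 Gi"
    and sG: "infsum G UNIV = Cmat (g 1)" "infsum Gi UNIV = Cmat (matrix_inv (g 1))"
    and a: "a = (\<lambda>k. - (emb (bcoef d) \<star> Gi) k)" and c: "c = emb (bcoef (- d)) \<star> G"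
    and ac0: "\<And>k. k < 0 \<Longrightarrow> a k = 0" "\<And>k. k < 0 \<Longrightarrow> c k = 0" and dac: "dec (1 + d) a" "dec (1 - d) c"
    and inv_ac: "c \<star> a = delta 0 (- 1)" "a \<star> c = delta 0 (- 1)"
    and fourier: "\<And>k. fourier_coeff w k = mat_of ((c \<star> star c) k)"
    and coeffs: "neg_inv_coeffs (h_fun d g) = (\<lambda>k. mat_of (a (int k)))"
    by (rule symbol_factor[OF d g w]) (assumption+, rule that)
  \<comment> \<open>\<open>factor\<close> at \<open>cnj z\<close> turns
    \<open>g (cnj z) ** hconj (g (cnj z))\<close> into \<open>g' z ** hconj (g' z)\<close>, so
    \<open>g'\<close> is a left factor of the reflected symbol, as \<open>g\<close> is of
    \<open>w\<close>.\<close>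
  define g' where "g' = (\<lambda>z. hconj (gs (cnj z)))"
  define w' where "w' = (\<lambda>z. w (cnj z))"
  have g': "regular_rational g'" unfolding g'_def by (rule regular_rational_reflect[OF g_sharp])
  have w': "w' z = (norm (1 - z) powr (- 2 * d)) *\<^sub>R (g' z ** hconj (g' z))" if "norm z = 1" "z \<noteq> 1" for z
  proof -
    have "norm (1 - cnj z) = norm (1 - z)" using complex_mod_cnj[of "1 - z"] by simp
    moreover have "cnj z \<noteq> 1" using that(2) by (metis complex_cnj_cnj complex_cnj_one)
    ultimately show ?thesis using w[of "cnj z"] factor[of "cnj z"] that by (simp add: w'_def g'_def)
  qed
  obtain G' Gi' a' c' :: "int \<Rightarrow> 'q cmat" where dG': "dec 4 G'" "dec 4 Gi'"
    and sG': "infsum G' UNIV = Cmat (g' 1)" "infsum Gi' UNIV = Cmat (matrix_inv (g' 1))"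
    and a': "a' = (\<lambda>k. - (emb (bcoef d) \<star> Gi') k)" and c': "c' = emb (bcoef (- d)) \<star> G'"
    and ac0': "\<And>k. k < 0 \<Longrightarrow> a' k = 0" "\<And>k. k < 0 \<Longrightarrow> c' k = 0" and dac': "dec (1 + d) a'" "dec (1 - d) c'"
    and inv_ac': "c' \<star> a' = delta 0 (- 1)" "a' \<star> c' = delta 0 (- 1)"
    and fourier': "\<And>k. fourier_coeff w' k = mat_of ((c' \<star> star c') k)"
    and coeffs': "neg_inv_coeffs (h_fun d g') = (\<lambda>k. mat_of (a' (int k)))"
    by (rule symbol_factor[OF d g' w']) (assumption+, rule that)
  define \<gamma> where "\<gamma> = (\<lambda>k. Cmat (fourier_coeff w k))"
  \<comment> \<open>Adjoints undo the conjugation in \<open>g'\<close>: \<open>b\<close> and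
    \<open>e\<close> carry the coefficients of \<open>- 1 / h\<close> and \<open>h\<close> formed
    with \<open>gs\<close>.\<close>
  define b where "b = (\<lambda>k. adj (a' k))"
  define e where "e = (\<lambda>k. adj (c' k))"
  have l1a': "l1 a'" and bc': "bdd c'" using l1_dec[OF dac'(1)] bdd_dec[OF dac'(2)] d by auto
  interpret toeplitz_factors d a b c e \<gamma>
  proof
    show "0 < d" "d < 1 / 2" by (fact d)+
    show "a k = 0" "b k = 0" "c k = 0" "e k = 0" if "k < 0" for k
      using that ac0 ac0' by (simp_all add: b_def e_def)
    show "dec (1 + d) a" "dec (1 - d) c" by (fact dac)+
    show "dec (1 + d) b" "dec (1 - d) e" using dac' by (simp_all add: b_def e_def dec_def)
    show "c \<star> a = delta 0 (- 1)" "a \<star> c = delta 0 (- 1)" by (fact inv_ac)+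
    show "e \<star> b = delta 0 (- 1)"
      unfolding e_def b_def using adj_conv[OF conv_bdd_abs[OF conv_bddI1[OF l1a' bc']]]
      by (simp add: fun_eq_iff inv_ac' delta_def)
    show "b \<star> e = delta 0 (- 1)"
      unfolding e_def b_def using adj_conv[OF conv_bdd_abs[OF conv_bddI2[OF bc' l1a']]]
      by (simp add: fun_eq_iff inv_ac' delta_def)
    show "\<gamma> = c \<star> star c" by (simp add: \<gamma>_def fourier)
    show "\<gamma> = star e \<star> e"
    proof
      fix k
      have "star e = (\<lambda>k. c' (- k))" "e = (\<lambda>k. star c' (- k))" by (simp_all add: fun_eq_iff e_def star_def)
      then have "(star e \<star> e) k = (c' \<star> star c') (- k)" by (simp only: conv_reflect)
      also have "\<dots> = \<gamma> k"
        using fourier'[of "- k"] fourier_coeff_reflect[of w "- k"] by (simp add: \<gamma>_def w'_def mat_of_eq_iff)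
      finally show "\<gamma> k = (star e \<star> e) k" by simp
    qed
    define H where "H = (\<lambda>k. adj (G' k))"
    have dH: "dec 4 H" using dG' by (simp add: H_def dec_def)
    have e_eq: "e = emb (bcoef (- d)) \<star> H"
    proof
      fix k
      have "emb (bcoef (- d)) = (\<lambda>k. adj (emb (bcoef (- d)) k) :: 'q cmat)" by (simp add: fun_eq_iff emb_def)
      then have "(emb (bcoef (- d)) \<star> H) k = ((\<lambda>k. adj (emb (bcoef (- d)) k)) \<star> (\<lambda>k. adj (G' k))) k"
        by (simp only: H_def)
      also have "\<dots> = adj ((G' \<star> emb (bcoef (- d))) k)"
        by (rule adj_conv[OF conv_bdd_abs[OF conv_bdd_dec[OF dG'(1)]]]) (use dec_bcoef_d[OF d] d in auto)
      finally show "e k = (emb (bcoef (- d)) \<star> H) k"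
        by (simp add: e_def c' emb_commute[of "bcoef (- d)" G'])
    qed
    \<comment> \<open>By \<open>factor\<close> at \<open>1\<close>, the matrix
      \<open>matrix_inv (g 1) ** hconj (gs 1)\<close> is a coisometry.\<close>
    have "norm (infsum Gi UNIV * infsum (star H) UNIV) \<le> 1"
    proof (rule norm_le_1_if_coisometry)
      have "infsum (star H) UNIV = infsum G' UNIV"
        using infsum_reindex_bij_betw[OF bij_uminus, of G'] by (simp add: star_def[abs_def] H_def)
      then have u: "infsum Gi UNIV * infsum (star H) UNIV = Cmat (matrix_inv (g 1)) * Cmat (hconj (gs 1))"
        by (simp add: sG sG' g'_def)
      have dz: "det (g 1) \<noteq> 0" using g by (simp add: regular_rational_def)
      have "matrix_inv (g 1) ** hconj (gs 1) ** hconj (matrix_inv (g 1) ** hconj (gs 1))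
          = matrix_inv (g 1) ** (hconj (gs 1) ** gs 1) ** hconj (matrix_inv (g 1))"
        by (simp add: hconj_mult matrix_mul_assoc)
      also have "hconj (gs 1) ** gs 1 = g 1 ** hconj (g 1)" using factor[of 1] by simp
      also have "matrix_inv (g 1) ** (g 1 ** hconj (g 1)) ** hconj (matrix_inv (g 1))
          = (matrix_inv (g 1) ** g 1) ** hconj (matrix_inv (g 1) ** g 1)"
        by (simp add: hconj_mult matrix_mul_assoc)
      also have "\<dots> = mat 1"
        unfolding mult_matrix_inv(2)[OF dz] by (simp add: hconj_mat_1)
      finally show "infsum Gi UNIV * infsum (star H) UNIV * adj (infsum Gi UNIV * infsum (star H) UNIV) = 1"
        unfolding u by (simp add: mat_of_eq_iff)
    qed
    then show "\<exists>\<theta><1. \<exists>N. \<forall>j\<ge>N. pi * of_int j * norm ((a \<star> star e) j) \<le> \<theta>"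
      unfolding a e_eq by (rule phase_bound[OF d dG(2) dH])
  qed
  have h_tilde: "h_tilde d gs z = h_fun d g' z" if "z \<in> ball 0 1" for z
  proof -
    \<comment> \<open>The base stays off the branch cut, so conjugation commutes with the principal
      power.\<close>
    have "Re (1 - cnj z) > 0" using that complex_Re_le_cmod[of "cnj z"] by simp
    then have "cnj ((1 - cnj z) powr of_real (- d)) = (1 - z) powr of_real (- d)"
      by (subst cnj_powr) auto
    then show ?thesis by (simp add: h_tilde_def h_fun_def g'_def vec_eq_iff hconj_nth)
  qed
  have X_eq: "Tinf_inv d gs s t = mat_of (X (int s) (int t))" for s t
  proof -
    have "neg_inv_coeffs (h_tilde d gs) = (\<lambda>k. mat_of (a' (int k)))"
      unfolding coeffs'[symmetric] by (rule neg_inv_coeffs_cong) (rule h_tilde)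
    then show ?thesis unfolding X_def unfolding Tinf_inv_def b_def by (simp add: coeff_gram_eq ac0')
  qed
  have Y_eq: "Tinf_tilde_inv d g s t = mat_of (Y (int s) (int t))" for s t
    unfolding Tinf_tilde_inv_def coeffs by (simp add: coeff_gram_eq ac0 Y_def)
  have Omega_eq: "Omega \<delta> d g gs n s t = mat_of (approx_inverse \<delta> n s t)" for n s t
    by (simp add: Omega_def approx_inverse_def X_eq Y_eq)
  have T_eq: "Cmat (toeplitz w s t) = \<gamma> (int s - int t)" for s t by (simp add: toeplitz_def \<gamma>_def)
  have T_herm: "hconj (toeplitz w s t) = toeplitz w t s" for s t
    using adj_\<gamma>[of "int s - int t"] by (simp add: mat_of_eq_iff T_eq[symmetric])
  \<comment> \<open>For large \<open>n\<close>, as an asymptotic statement requires, this makes the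
    choice in \<open>block_inv\<close> a true inverse.\<close>
  obtain N\<^sub>0 where inj: "\<And>n x s. n \<ge> N\<^sub>0 \<Longrightarrow> (\<And>s. s \<in> {1..n} \<Longrightarrow> (\<Sum>l=1..n. Cmat (toeplitz w s l) * x l) = 0) \<Longrightarrow>
      s \<in> {1..n} \<Longrightarrow> x s = 0"
    using finite_section_injective unfolding T_eq by metis
  obtain C N where C: "\<And>n D t. n \<ge> N \<Longrightarrow> t \<in> {1..n} \<Longrightarrow>
      (\<forall>s\<in>{1..n}. \<forall>t\<in>{1..n}. (\<Sum>l=1..n. \<gamma> (int s - int l) * D l t) = (if s = t then 1 else 0)) \<Longrightarrow>
      (\<Sum>s=1..n. norm (D s t - approx_inverse \<delta> n s t)) \<le> C * real n powr (- d)"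
    using approx_inverse_estimate[OF \<delta>] by blast
  define E where "E = (\<lambda>n s t. block_inv n (toeplitz w) s t - Omega \<delta> d g gs n s t)"
  have col: "(\<Sum>s=1..n. spectral_norm (E n s t)) \<le> C * real n powr (- d)" if n: "n \<ge> max N N\<^sub>0" and t: "t \<in> {1..n}" for n t
  proof -
    have "(\<Sum>s=1..n. norm (Cmat (block_inv n (toeplitz w) s t) - approx_inverse \<delta> n s t)) \<le> C * real n powr (- d)"
    proof (rule C[OF _ t])
      have "is_block_id n (block_mult n (toeplitz w) (block_inv n (toeplitz w)))"
        by (rule block_inv_correct(1)) (use inj[of n] n in auto)
      then show "\<forall>s\<in>{1..n}. \<forall>t\<in>{1..n}. (\<Sum>l=1..n. \<gamma> (int s - int l) * Cmat (block_inv n (toeplitz w) l t)) = (if s = t then 1 else 0)"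
        unfolding block_id_iff T_eq .
    qed (use n in simp)
    then show ?thesis by (simp add: norm_cmat_eq E_def Omega_eq)
  qed
  have E_herm: "hconj (E n s t) = E n t s" if n: "n \<ge> max N N\<^sub>0" and st: "s \<in> {1..n}" "t \<in> {1..n}" for n s t
  proof -
    have "hconj (block_inv n (toeplitz w) s t) = block_inv n (toeplitz w) t s"
      by (rule block_inv_hermitian) (use inj[of n] n T_herm st in auto)
    moreover have "hconj (A - B) = hconj A - hconj B" for A B :: "complex^'q^'q"
      by (simp add: vec_eq_iff hconj_nth)
    ultimately show ?thesis by (simp add: E_def hconj_Omega)
  qed
  have norm1: "\<bar>block_norm_1 n (E n)\<bar> \<le> C * real n powr (- d)" if "n \<ge> max 1 (max N N\<^sub>0)" for n
    by (rule block_norm_1_le) (use that col in auto)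
  \<comment> \<open>\<open>E n\<close> is Hermitian and \<open>hconj\<close> preserves the spectral
    norm, so its row sums are column sums.\<close>
  have norm2: "\<bar>block_norm_inf n (E n)\<bar> \<le> C * real n powr (- d)" if n: "n \<ge> max 1 (max N N\<^sub>0)" for n
    unfolding block_norm_inf_eq
  proof (rule block_norm_1_le)
    fix t assume t: "t \<in> {1..n}"
    have "(\<Sum>s=1..n. spectral_norm (E n t s)) = (\<Sum>s=1..n. spectral_norm (E n s t))"
    proof (rule sum.cong)
      fix s assume s: "s \<in> {1..n}"
      then have "E n t s = hconj (E n s t)" using E_herm[of n s t] n t by simp
      then show "spectral_norm (E n t s) = spectral_norm (E n s t)" by simp
    qed simp
    then show "(\<Sum>s=1..n. spectral_norm (E n t s)) \<le> C * real n powr (- d)" using col[of n t] n t by simp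
  qed (use n in simp)
  have herm: "block_hermitian n (Omega \<delta> d g gs n)" for n
    unfolding block_hermitian_def hconj_nth[symmetric] hconj_Omega by simp
  have "(\<lambda>n. block_norm_1 n (E n)) \<in> O(\<lambda>n. real n powr (- d))"
    by (rule bigoI[of _ C], rule eventually_sequentiallyI[of "max 1 (max N N\<^sub>0)"]) (use norm1 in simp)
  moreover have "(\<lambda>n. block_norm_inf n (E n)) \<in> O(\<lambda>n. real n powr (- d))"
    by (rule bigoI[of _ C], rule eventually_sequentiallyI[of "max 1 (max N N\<^sub>0)"]) (use norm2 in simp)
  ultimately show ?thesis using herm unfolding E_def by blast
qed

end
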